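(* Let $X$ be separably metrizable and let $\beta$ be the strict topology on $C_b(X)$. Then the dual $\mathcal{M}_\tau(X)$ of $(C_b(X),\beta)$ is weakly sequentially complete, i.e. every Cauchy sequence for the weak topology $\sigma(\mathcal{M}_\tau(X),C_b(X))$ converges in this topology to an element of $\mathcal{M}_\tau(X)$.
   Context: $C_b(X)$ is the space of bounded continuous real-valued functions on $X$. A (finite signed) Borel measure $\mu$ on $X$ is $\tau$-additive if for every increasing net $\{U_\alpha\}_\alpha$ of open sets $\lim_\alpha |\mu|(U_\alpha) = |\mu|(\bigcup_\alpha U_\alpha)$; $\mathcal{M}_\tau(X)$ is the space of these measures. It is the continuous dual of $(C_b(X),\beta)$ via $\langle f,\mu\rangle=\int f\,\mathrm{d}\mu$. Strict topology $\beta$ on $C_b(X)$: let $\check{X}$ be the Stone-Čech compactification of $X$. For each compact $Q \subseteq \check{X}\setminus X$ (including $Q=\emptyset$) let $\beta_Q$ be the locally convex topology on $C_b(X)$ generated by the seminorms $f \mapsto \sup_{x\in X}|h(x)f(x)|$, where $h$ ranges over the continuous functions on $\check{X}$ vanishing on $Q$. Then $\beta$ is the finest locally convex topology on $C_b(X)$ that is coarser than $\beta_Q$ for every such $Q$. *)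

theory Defs
  imports "HOL-Analysis.Analysis"
begin

text \<open>
  The space \<open>X\<close> is a type \<open>'a\<close> of class \<^class>\<open>topological_space\<close>, and \<open>C\<^sub>b(X)\<close> is the library type
  \<open>'a \<Rightarrow>\<^sub>C real\<close> of bounded continuous functions (of which only the vector space structure is used,
  not the norm topology).
\<close>

section \<open>Locally convex topologies\<close>

definition coarser_than :: "'v topology \<Rightarrow> 'v topology \<Rightarrow> bool" where
  "coarser_than S T \<longleftrightarrow> topspace S = topspace T \<and> (\<forall>U. openin S U \<longrightarrow> openin T U)"

text \<open>The Hausdorff property is not part of the definition.\<close>

definition locally_convex :: "'v::real_vector topology \<Rightarrow> bool" where
  "locally_convex T \<longleftrightarrow>
     topspace T = UNIV \<and>
     continuous_map (prod_topology T T) T (\<lambda>(x, y). x + y) \<and>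
     continuous_map (prod_topology euclideanreal T) T (\<lambda>(c, x). c *\<^sub>R x) \<and>
     (\<forall>U. openin T U \<and> 0 \<in> U \<longrightarrow> (\<exists>V. openin T V \<and> convex V \<and> 0 \<in> V \<and> V \<subseteq> U))"

definition seminorm_topology :: "('v::real_vector \<Rightarrow> real) set \<Rightarrow> 'v topology" where
  "seminorm_topology P =
     topology_generated_by {{y. p (y - x) < \<epsilon>} | p x \<epsilon>. p \<in> P \<and> \<epsilon> > 0}"

definition continuous_dual :: "'v::real_vector topology \<Rightarrow> ('v \<Rightarrow> real) set" where
  "continuous_dual T = {L. linear L \<and> continuous_map T euclideanreal L}"

section \<open>The Stone--Cech compactification\<close>

text \<open>
  For a completely regular Hausdorff space \<open>X\<close>, the Stone--Cech compactification is the closure of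
  the image of \<open>X\<close> under evaluation in the product of copies of the real line indexed by
  \<open>C\<^sub>b(X)\<close>; the function type carries the product topology. The closure is compact because
  each coordinate \<open>f\<close> stays in a bounded interval, and the continuous extension
  of \<open>f\<close> is the coordinate projection \<open>\<lambda>z. z f\<close>.
\<close>

definition sc_embed :: "'a::topological_space \<Rightarrow> (('a \<Rightarrow>\<^sub>C real) \<Rightarrow> real)" where
  "sc_embed x = (\<lambda>f. apply_bcontfun f x)"

definition stone_cech :: "(('a::topological_space \<Rightarrow>\<^sub>C real) \<Rightarrow> real) set" where
  "stone_cech = closure (range sc_embed)"

section \<open>The strict topology\<close>

definition admissible :: "(('a::topological_space \<Rightarrow>\<^sub>C real) \<Rightarrow> real) set \<Rightarrow> bool" where
  "admissible Q \<longleftrightarrow> compact Q \<and> Q \<subseteq> stone_cech - range sc_embed"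

definition beta_Q ::
    "(('a::topological_space \<Rightarrow>\<^sub>C real) \<Rightarrow> real) set \<Rightarrow> ('a \<Rightarrow>\<^sub>C real) topology" where
  "beta_Q Q = seminorm_topology
     {\<lambda>f. SUP x. \<bar>h (sc_embed x) * apply_bcontfun f x\<bar> | h.
        continuous_on stone_cech h \<and> (\<forall>z\<in>Q. h z = 0)}"

text \<open>
  The supremum of all locally convex topologies below every \<open>beta_Q Q\<close>. The theorem
  \<open>strict_topology_finest\<close> below shows that it is itself one of them, hence the finest one.
\<close>

definition strict_topology :: "('a::topological_space \<Rightarrow>\<^sub>C real) topology" where
  "strict_topology = topology_generated_by
     {U. \<exists>T. locally_convex T \<and> (\<forall>Q. admissible Q \<longrightarrow> coarser_than T (beta_Q Q)) \<and> openin T U}"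

lemma locally_convex_Sup:
  fixes \<T> :: "'v::real_vector topology set"
  assumes ne: "\<T> \<noteq> {}" and lc: "\<And>T. T \<in> \<T> \<Longrightarrow> locally_convex T"
  shows "locally_convex (topology_generated_by {U. \<exists>T\<in>\<T>. openin T U})"
proof -
  let ?B = "{U. \<exists>T\<in>\<T>. openin T U}"
  let ?S = "topology_generated_by ?B"
  have op: "openin ?S U" if "T \<in> \<T>" "openin T U" for T U
    using that by (auto intro: topology_generated_by_Basis)
  have UN: "\<Union>?B = UNIV"
  proof -
    obtain T where T: "T \<in> \<T>" using ne by auto
    then have "openin T UNIV" using lc[OF T] by (metis locally_convex_def openin_topspace)
    then show ?thesis using T by blast
  qed
  have top: "topspace ?S = UNIV" using UN by simp
  have id: "continuous_map ?S T (\<lambda>x. x)" if "T \<in> \<T>" for T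
    using that lc[OF that] op top by (auto simp: continuous_map_def locally_convex_def)
  have add: "continuous_map (prod_topology ?S ?S) ?S (\<lambda>(x, y). x + y)"
  proof (rule continuous_on_generated_topo)
    fix U assume "U \<in> ?B"
    then obtain T where T: "T \<in> \<T>" "openin T U" by auto
    have 1: "continuous_map (prod_topology T T) T (\<lambda>(x, y). x + y)"
      using lc[OF T(1)] by (simp add: locally_convex_def)
    have 2: "continuous_map (prod_topology ?S ?S) (prod_topology T T) (\<lambda>z. (fst z, snd z))"
      using continuous_map_compose[OF continuous_map_fst id[OF T(1)]]
            continuous_map_compose[OF continuous_map_snd id[OF T(1)]]
      by (intro iffD2[OF continuous_map_paired] conjI) (simp_all add: o_def)
    have "continuous_map (prod_topology ?S ?S) T (\<lambda>(x, y). x + y)"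
      using continuous_map_compose[OF 2 1] by (simp add: o_def case_prod_unfold)
    from openin_continuous_map_preimage[OF this T(2)]
    show "openin (prod_topology ?S ?S) ((\<lambda>(x, y). x + y) -` U \<inter> topspace (prod_topology ?S ?S))"
      by (simp add: vimage_def Int_def conj_commute)
  qed (use UN in auto)
  have scale: "continuous_map (prod_topology euclideanreal ?S) ?S (\<lambda>(c, x). c *\<^sub>R x)"
  proof (rule continuous_on_generated_topo)
    fix U assume "U \<in> ?B"
    then obtain T where T: "T \<in> \<T>" "openin T U" by auto
    have 1: "continuous_map (prod_topology euclideanreal T) T (\<lambda>(c, x). c *\<^sub>R x)"
      using lc[OF T(1)] by (simp add: locally_convex_def)
    have 2: "continuous_map (prod_topology euclideanreal ?S) (prod_topology euclideanreal T)
        (\<lambda>z. (fst z, snd z))"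
      using continuous_map_fst continuous_map_compose[OF continuous_map_snd id[OF T(1)]]
      by (intro iffD2[OF continuous_map_paired] conjI) (simp_all add: o_def)
    have "continuous_map (prod_topology euclideanreal ?S) T (\<lambda>(c, x). c *\<^sub>R x)"
      using continuous_map_compose[OF 2 1] by (simp add: o_def case_prod_unfold)
    from openin_continuous_map_preimage[OF this T(2)]
    show "openin (prod_topology euclideanreal ?S)
        ((\<lambda>(c, x). c *\<^sub>R x) -` U \<inter> topspace (prod_topology euclideanreal ?S))"
      by (simp add: vimage_def Int_def conj_commute)
  qed (use UN in auto)
  have conv: "\<exists>V. openin ?S V \<and> convex V \<and> 0 \<in> V \<and> V \<subseteq> U" if "openin ?S U" "0 \<in> U" for U
  proof -
    have "generate_topology_on ?B U" using that(1) by (simp add: openin_topology_generated_by_iff)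
    then show ?thesis using that(2)
    proof (induction rule: generate_topology_on.induct)
      case (Int a b)
      then obtain V W where "openin ?S V" "convex V" "0 \<in> V" "V \<subseteq> a"
        "openin ?S W" "convex W" "0 \<in> W" "W \<subseteq> b" by auto
      then show ?case by (intro exI[of _ "V \<inter> W"]) (auto intro: convex_Int)
    next
      case (UN K)
      then show ?case by (meson Sup_upper UnionE subset_trans)
    next
      case (Basis s)
      then obtain T where T: "T \<in> \<T>" "openin T s" by auto
      then obtain V where "openin T V" "convex V" "0 \<in> V" "V \<subseteq> s"
        using lc[OF T(1)] Basis by (auto simp: locally_convex_def)
      then show ?case using op T(1) by blast
    qed auto
  qed
  show ?thesis unfolding locally_convex_def using top add scale conv by blast
qed

lemma topspace_seminorm_topology:
  assumes "P \<noteq> {}" shows "topspace (seminorm_topology P) = (UNIV :: 'v::real_vector set)"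
proof -
  obtain p where "p \<in> P" using assms by auto
  then have "x \<in> topspace (seminorm_topology P)" for x :: 'v
    unfolding seminorm_topology_def topology_generated_by_topspace
    by (intro UnionI[of "{y. p (y - 0) < \<bar>p x\<bar> + 1}"]) (auto intro!: exI[of _ p] exI[of _ 0] exI[of _ "\<bar>p x\<bar> + 1"])
  then show ?thesis by auto
qed

lemma topspace_beta_Q: "topspace (beta_Q Q) = UNIV"
proof -
  have "continuous_on stone_cech (\<lambda>_. 0 :: real)" by simp
  then show ?thesis unfolding beta_Q_def by (intro topspace_seminorm_topology) fastforce
qed

lemma locally_convex_indiscrete: "locally_convex (topology_generated_by {UNIV :: 'v::real_vector set})"
proof -
  let ?T = "topology_generated_by {UNIV :: 'v set}"
  have "U = {} \<or> U = UNIV" if "openin ?T U" for U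
  proof -
    have "generate_topology_on {UNIV} U" using that by (simp add: openin_topology_generated_by_iff)
    then show ?thesis by (induction rule: generate_topology_on.induct) auto
  qed
  moreover have "openin ?T UNIV" by (auto intro: topology_generated_by_Basis)
  moreover have "openin (prod_topology ?T ?T) UNIV" "openin (prod_topology euclideanreal ?T) UNIV"
    using openin_topspace[of "prod_topology ?T ?T"] openin_topspace[of "prod_topology euclideanreal ?T"]
    by simp_all
  ultimately show ?thesis
    unfolding locally_convex_def continuous_map_def
    by (intro conjI allI impI) (use convex_UNIV in force)+
qed

theorem strict_topology_finest:
  defines "\<beta> \<equiv> (strict_topology :: ('a::topological_space \<Rightarrow>\<^sub>C real) topology)"
  shows "locally_convex \<beta>"
    and "\<And>Q. admissible Q \<Longrightarrow> coarser_than \<beta> (beta_Q Q)"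
    and "\<And>T. locally_convex T \<Longrightarrow> (\<And>Q. admissible Q \<Longrightarrow> coarser_than T (beta_Q Q)) \<Longrightarrow>
      coarser_than T \<beta>"
  unfolding \<beta>_def
proof -
  let ?\<T> = "{T. locally_convex T \<and> (\<forall>Q. admissible Q \<longrightarrow> coarser_than T (beta_Q Q))}
     :: ('a \<Rightarrow>\<^sub>C real) topology set"
  have eq: "strict_topology = topology_generated_by {U. \<exists>T\<in>?\<T>. openin T U}"
    unfolding strict_topology_def by (rule arg_cong[where f = topology_generated_by]) auto
  have "topology_generated_by {UNIV} \<in> ?\<T>"
  proof -
    have "openin (beta_Q Q) U" if "openin (topology_generated_by {UNIV}) U"
      for Q :: "(('a \<Rightarrow>\<^sub>C real) \<Rightarrow> real) set" and U
    proof -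
      have "generate_topology_on {UNIV} U" using that by (simp add: openin_topology_generated_by_iff)
      then show ?thesis
      proof (induction rule: generate_topology_on.induct)
        case (Basis s) then show ?case using openin_topspace[of "beta_Q Q"] by (simp add: topspace_beta_Q)
      qed auto
    qed
    then show ?thesis using locally_convex_indiscrete by (auto simp: coarser_than_def topspace_beta_Q)
  qed
  then show lc: "locally_convex (strict_topology :: ('a \<Rightarrow>\<^sub>C real) topology)"
    unfolding eq by (intro locally_convex_Sup) auto
  show "coarser_than strict_topology (beta_Q Q)" if "admissible Q"
    for Q :: "(('a \<Rightarrow>\<^sub>C real) \<Rightarrow> real) set"
  proof -
    have "openin (beta_Q Q) U" if "openin strict_topology U" for U
    proof -
      have "generate_topology_on {U. \<exists>T\<in>?\<T>. openin T U} U"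
        using that unfolding eq by (simp add: openin_topology_generated_by_iff)
      then show ?thesis
        by (induction rule: generate_topology_on.induct)
           (use \<open>admissible Q\<close> in \<open>auto simp: coarser_than_def\<close>)
    qed
    then show ?thesis using lc by (simp add: coarser_than_def topspace_beta_Q locally_convex_def)
  qed
  show "coarser_than T strict_topology"
    if "locally_convex T" "\<And>Q. admissible Q \<Longrightarrow> coarser_than T (beta_Q Q)"
    for T :: "('a \<Rightarrow>\<^sub>C real) topology"
    using that lc unfolding coarser_than_def[of T strict_topology]
    by (auto simp: locally_convex_def eq intro!: topology_generated_by_Basis)
qed

section \<open>Signed Borel measures\<close>

text \<open>
  A finite signed Borel measure is a real-valued set function, normalised to be \<open>0\<close> off the Borel
  sets so that two measures are equal iff they agree on Borel sets.
\<close>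

definition signed_borel_measure :: "('a::topological_space set \<Rightarrow> real) \<Rightarrow> bool" where
  "signed_borel_measure \<mu> \<longleftrightarrow>
     \<mu> {} = 0 \<and>
     (\<forall>A::nat \<Rightarrow> 'a set. range A \<subseteq> sets borel \<and> disjoint_family A \<longrightarrow>
        (\<lambda>n. \<mu> (A n)) sums \<mu> (\<Union>n. A n)) \<and>
     (\<forall>A. A \<notin> sets borel \<longrightarrow> \<mu> A = 0)"

text \<open>The Jordan decomposition \<open>\<mu> = \<mu>\<^sup>+ - \<mu>\<^sup>-\<close>, with \<open>\<mu>\<^sup>-\<close> given by \<open>pos_variation (- \<mu>)\<close>.\<close>

definition pos_variation :: "('a::topological_space set \<Rightarrow> real) \<Rightarrow> 'a set \<Rightarrow> real" where
  "pos_variation \<mu> A = (SUP B\<in>{B \<in> sets borel. B \<subseteq> A}. \<mu> B)"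

definition total_variation :: "('a::topological_space set \<Rightarrow> real) \<Rightarrow> 'a set \<Rightarrow> real" where
  "total_variation \<mu> A = pos_variation \<mu> A + pos_variation (\<lambda>B. - \<mu> B) A"

definition pos_part :: "('a::topological_space set \<Rightarrow> real) \<Rightarrow> 'a measure" where
  "pos_part \<mu> = measure_of UNIV (sets borel) (\<lambda>A. ennreal (pos_variation \<mu> A))"

definition signed_integral :: "('a::topological_space set \<Rightarrow> real) \<Rightarrow> ('a \<Rightarrow>\<^sub>C real) \<Rightarrow> real" where
  "signed_integral \<mu> f =
     (LINT x|pos_part \<mu>. apply_bcontfun f x) - (LINT x|pos_part (\<lambda>A. - \<mu> A). apply_bcontfun f x)"

text \<open>
  An increasing net of open sets enters only through its range, so it suffices to consider a
  nonempty upward directed family \<open>D\<close> of open sets as a net indexed by itself, whose tails are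
  the sets \<open>{V \<in> D. U \<subseteq> V}\<close>. See \<open>tau_additive_net\<close> for arbitrary index sets.
\<close>

definition tau_additive :: "('a::topological_space set \<Rightarrow> real) \<Rightarrow> bool" where
  "tau_additive \<mu> \<longleftrightarrow>
     (\<forall>D. D \<noteq> {} \<and> (\<forall>U\<in>D. open U) \<and> (\<forall>U\<in>D. \<forall>V\<in>D. \<exists>W\<in>D. U \<subseteq> W \<and> V \<subseteq> W) \<longrightarrow>
        (total_variation \<mu> \<longlongrightarrow> total_variation \<mu> (\<Union>D)) (INF U\<in>D. principal {V \<in> D. U \<subseteq> V}))"

lemma tau_additive_net:
  fixes I :: "'i set" and le :: "'i \<Rightarrow> 'i \<Rightarrow> bool" and U :: "'i \<Rightarrow> 'a::topological_space set"
  assumes "tau_additive \<mu>" and "I \<noteq> {}"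
    and dir: "\<And>i j. i \<in> I \<Longrightarrow> j \<in> I \<Longrightarrow> \<exists>k\<in>I. le i k \<and> le j k"
    and op: "\<And>i. i \<in> I \<Longrightarrow> open (U i)"
    and mono: "\<And>i j. i \<in> I \<Longrightarrow> j \<in> I \<Longrightarrow> le i j \<Longrightarrow> U i \<subseteq> U j"
  shows "((\<lambda>i. total_variation \<mu> (U i)) \<longlongrightarrow> total_variation \<mu> (\<Union>i\<in>I. U i))
           (INF i\<in>I. principal {j \<in> I. le i j})"
proof -
  let ?D = "U ` I"
  let ?F = "INF i\<in>I. principal {j \<in> I. le i j}"
  let ?G = "INF W\<in>?D. principal {V \<in> ?D. W \<subseteq> V}"
  have "\<exists>W\<in>?D. A \<subseteq> W \<and> B \<subseteq> W" if AB: "A \<in> ?D" "B \<in> ?D" for A B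
  proof -
    obtain i j where "i \<in> I" "j \<in> I" "A = U i" "B = U j" using AB by auto
    then show ?thesis using dir[of i j] mono by blast
  qed
  then have *: "(total_variation \<mu> \<longlongrightarrow> total_variation \<mu> (\<Union>?D)) ?G"
    using assms(1) \<open>I \<noteq> {}\<close> op unfolding tau_additive_def by (elim allE[of _ ?D]) (auto simp del: INF_image)
  have "filterlim U ?G ?F"
    unfolding filterlim_INF
  proof (intro ballI)
    fix W assume "W \<in> ?D"
    then obtain i where i: "i \<in> I" "W = U i" by auto
    have "?F \<le> principal {j \<in> I. le i j}" using i by (intro INF_lower)
    then have "eventually (\<lambda>j. j \<in> I \<and> le i j) ?F"
      by (simp add: le_principal)
    then show "filterlim U (principal {V \<in> ?D. W \<subseteq> V}) ?F"
      unfolding filterlim_principal by (rule eventually_mono) (use i mono in auto)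
  qed
  from filterlim_compose[OF * this] show ?thesis by simp
qed

definition M_tau :: "('a::topological_space set \<Rightarrow> real) set" where
  "M_tau = {\<mu>. signed_borel_measure \<mu> \<and> tau_additive \<mu>}"

section \<open>The weak topology on the space of \<open>\<tau>\<close>-additive measures\<close>

text \<open>\<open>\<sigma>(M_tau, C\<^sub>b)\<close>: the initial topology of the functionals \<open>\<mu> \<mapsto> \<integral>f d\<mu>\<close>.\<close>

definition weak_topology :: "('a::topological_space set \<Rightarrow> real) topology" where
  "weak_topology = topology_generated_by {{\<mu> \<in> M_tau. signed_integral \<mu> f \<in> U} | f U. open U}"

text \<open>Cauchy sequences with respect to the translation-invariant uniformity of the weak topology.\<close>

definition weakly_Cauchy :: "(nat \<Rightarrow> 'a::topological_space set \<Rightarrow> real) \<Rightarrow> bool" where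
  "weakly_Cauchy \<mu> \<longleftrightarrow>
     (\<forall>V. openin weak_topology V \<and> (\<lambda>A. 0) \<in> V \<longrightarrow>
        (\<exists>N. \<forall>m\<ge>N. \<forall>n\<ge>N. (\<lambda>A. \<mu> m A - \<mu> n A) \<in> V))"

end

theory Submission
  imports Defs
begin

text \<open>
  Let \<open>L\<close> be linear on \<open>C\<^sub>b(X)\<close>, and call it \<open>\<sigma>\<close>-smooth if \<open>L (f n)\<close> tends to \<open>0\<close> whenever \<open>f n\<close> decreases
  pointwise to \<open>0\<close>. A \<open>\<sigma>\<close>-smooth \<open>L\<close> is a difference of two positive ones (the supremum of \<open>L\<close> over
  order intervals is finite and \<open>\<sigma>\<close>-smooth), and a positive one is integration against a finite Borel
  measure (Daniell), obtained from the volume \<open>I (g - f)\<close> of the region between the graphs of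
  \<open>f \<le> g\<close>. On a second countable space all finite signed Borel measures are \<open>\<tau>\<close>-additive, so
  \<open>M_tau\<close> consists exactly of the \<open>\<sigma>\<close>-smooth functionals; these are the \<open>\<beta>\<close>-continuous ones.

  For a weak Cauchy sequence of measures the pointwise limit \<open>L\<close> is therefore in the dual as soon as it is
  \<open>\<sigma>\<close>-smooth. If \<open>f n\<close> decreases to \<open>0\<close>, then every subseries of \<open>\<Sum>(f k - f (k + 1))\<close> has a continuous
  sum, so the measures induce a setwise convergent sequence of measures on the subsets of the
  natural numbers, and Nikodym's convergence theorem gives that \<open>L (f n)\<close>, the limit on a tail, tends
  to \<open>0\<close>.
\<close>

section \<open>Smooth functionals and their positive parts\<close>

text \<open>Continuity of the limit functional is awkward to test directly, since
  \<open>\<beta>\<close> is defined through all admissible \<open>Q\<close> at once. Smoothness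
  speaks of one sequence at a time, which is the form in which Nikodym's theorem delivers its
  conclusion. The link between the two notions is a Dini argument on the compactification: a
  sequence decreasing to 0 on \<open>X\<close> need not become uniformly small, but the points where
  it stays large form an admissible \<open>Q\<close>. For the converse, a weight must vanish on
  \<open>Q\<close>, be positive on \<open>X\<close> and suit a given finite measure. Here the
  Lindelof property supplies countably many separating functions that serve all points of
  \<open>X\<close>; it is also what yields \<open>\<tau>\<close>-additivity. Metrizability acts
  through perfect normality: every open set is the positivity set of a continuous function, so
  regions between graphs reach all Borel sets, and integrals of continuous functions determine a
  measure. The measure is first built on \<open>X \<times> \<real>\<close> because half-open regions
  between graphs form a semiring of sets, on which Caratheodory's theorem can start.\<close>

definition sigma_smooth :: "(('a::topological_space \<Rightarrow>\<^sub>C real) \<Rightarrow> real) \<Rightarrow> bool" where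
  "sigma_smooth L \<longleftrightarrow>
     (\<forall>f :: nat \<Rightarrow> 'a \<Rightarrow>\<^sub>C real. (\<forall>n x. apply_bcontfun (f (Suc n)) x \<le> apply_bcontfun (f n) x) \<and> (\<forall>x. (\<lambda>n. apply_bcontfun (f n) x) \<longlonglongrightarrow> 0) \<longrightarrow>
        (\<lambda>n. L (f n)) \<longlonglongrightarrow> 0)"

lemma sigma_smoothD:
  fixes f :: "nat \<Rightarrow> 'a::topological_space \<Rightarrow>\<^sub>C real"
  assumes "sigma_smooth L" "\<And>n x. apply_bcontfun (f (Suc n)) x \<le> apply_bcontfun (f n) x" "\<And>x. (\<lambda>n. apply_bcontfun (f n) x) \<longlonglongrightarrow> 0"
  shows "(\<lambda>n. L (f n)) \<longlonglongrightarrow> 0"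
  using assms unfolding sigma_smooth_def by blast

lemma ex_bcontfun:
  fixes f :: "'a::topological_space \<Rightarrow> real"
  assumes "continuous_on UNIV f" "\<And>x. \<bar>f x\<bar> \<le> b"
  shows "\<exists>F. apply_bcontfun F = f"
  by (metis assms bcontfunE bcontfun_normI real_norm_def)

section \<open>Pointwise lattice operations on bounded continuous functions\<close>

definition bmin :: "('a::topological_space \<Rightarrow>\<^sub>C real) \<Rightarrow> ('a \<Rightarrow>\<^sub>C real) \<Rightarrow> 'a \<Rightarrow>\<^sub>C real" where
  "bmin f g = Bcontfun (\<lambda>x. min (f x) (g x))"

definition bmax :: "('a::topological_space \<Rightarrow>\<^sub>C real) \<Rightarrow> ('a \<Rightarrow>\<^sub>C real) \<Rightarrow> 'a \<Rightarrow>\<^sub>C real" where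
  "bmax f g = Bcontfun (\<lambda>x. max (f x) (g x))"

lemma abs_apply_le_norm: "\<bar>apply_bcontfun f x\<bar> \<le> norm f" for f :: "'a::topological_space \<Rightarrow>\<^sub>C real"
  using norm_bounded[of f x] by simp

lemma apply_bmin [simp]: "apply_bcontfun (bmin f g) x = min (f x) (g x)"
proof -
  have "norm (min (f x) (g x)) \<le> norm f + norm g" for x
    using abs_apply_le_norm[of f x] abs_apply_le_norm[of g x] norm_ge_zero[of f] norm_ge_zero[of g]
    by (auto simp: min_def)
  then have "(\<lambda>x. min (f x) (g x)) \<in> bcontfun"
    by (intro bcontfun_normI continuous_on_min) auto
  then show ?thesis by (simp add: bmin_def Bcontfun_inverse)
qed

lemma apply_bmax [simp]: "apply_bcontfun (bmax f g) x = max (f x) (g x)"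
proof -
  have "norm (max (f x) (g x)) \<le> norm f + norm g" for x
    using abs_apply_le_norm[of f x] abs_apply_le_norm[of g x] norm_ge_zero[of f] norm_ge_zero[of g]
    by (auto simp: max_def)
  then have "(\<lambda>x. max (f x) (g x)) \<in> bcontfun"
    by (intro bcontfun_normI continuous_on_max) auto
  then show ?thesis by (simp add: bmax_def Bcontfun_inverse)
qed

lemma apply_sum_bcontfun [simp]:
  "apply_bcontfun (sum F A) x = (\<Sum>i\<in>A. apply_bcontfun (F i) x)"
  for F :: "'i \<Rightarrow> 'a::topological_space \<Rightarrow>\<^sub>C real"
  by (induction A rule: infinite_finite_induct) auto

lemma apply_const_bcontfun [simp]: "apply_bcontfun (const_bcontfun c) x = c"
  by (simp add: const_bcontfun.rep_eq)

section \<open>The positive part of a smooth functional\<close>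

definition order_interval :: "('a::topological_space \<Rightarrow>\<^sub>C real) \<Rightarrow> ('a \<Rightarrow>\<^sub>C real) set" where
  "order_interval f = {g. \<forall>x. 0 \<le> apply_bcontfun g x \<and> apply_bcontfun g x \<le> apply_bcontfun f x}"

text \<open>The Riesz-Kantorovich formula. It is meaningful for \<open>f \<ge> 0\<close> only, the
  order interval being empty otherwise.\<close>

definition positive_part :: "(('a::topological_space \<Rightarrow>\<^sub>C real) \<Rightarrow> real) \<Rightarrow> ('a \<Rightarrow>\<^sub>C real) \<Rightarrow> real" where
  "positive_part L f = (SUP g\<in>order_interval f. L g)"

lemma zero_in_order_interval:
  "(\<And>x. 0 \<le> apply_bcontfun f x) \<Longrightarrow> 0 \<in> order_interval f"
  by (simp add: order_interval_def)

lemma sigma_smooth_uminus: "sigma_smooth L \<Longrightarrow> sigma_smooth (\<lambda>f. - L f)"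
  unfolding sigma_smooth_def by (metis minus_zero tendsto_minus)

text \<open>If \<open>L (g n) > 2 ^ n\<close> with all \<open>g n\<close> in the interval, the
  series of \<open>(1/2) ^ n * g n\<close> converges uniformly to a member of
  \<open>C\<^sub>b(X)\<close>. Its remainders decrease to 0, so \<open>L\<close> of them tends to 0,
  and so do the differences of successive values; but these are
  \<open>(1/2) ^ n * L (g n) > 1\<close>.\<close>

lemma sigma_smooth_bdd_above:
  fixes L :: "('a::topological_space \<Rightarrow>\<^sub>C real) \<Rightarrow> real"
  assumes lin: "linear L" and smooth: "sigma_smooth L"
  shows "bdd_above (L ` order_interval f)"
proof (rule ccontr)
  assume "\<not> bdd_above (L ` order_interval f)"
  then have "\<exists>g\<in>order_interval f. L g > 2 ^ n" for n :: nat
    unfolding bdd_above_def by (metis (no_types, lifting) imageE linorder_not_less)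
  then obtain g where g: "\<And>n. g n \<in> order_interval f" "\<And>n. L (g n) > 2 ^ n"
    by metis
  have g0: "0 \<le> apply_bcontfun (g n) x" and gf: "apply_bcontfun (g n) x \<le> norm f" for n x
    using g(1)[of n] abs_apply_le_norm[of f x] by (auto simp: order_interval_def dest: spec[of _ x])
  define a where "a n x = (1/2) ^ n * apply_bcontfun (g n) x" for n x
  have a: "0 \<le> a n x" "a n x \<le> (1/2) ^ n * norm f" for n x
    using g0 gf by (auto simp: a_def intro!: mult_left_mono)
  have sN: "summable (\<lambda>n. (1/2::real) ^ n * norm f)"
    by (intro summable_mult2 summable_geometric) simp
  have sa: "summable (\<lambda>n. a n x)" for x
    by (rule summable_comparison_test'[OF sN, of 0]) (use a in auto)
  have "uniform_limit UNIV (\<lambda>n x. \<Sum>i<n. a i x) (\<lambda>x. suminf (\<lambda>i. a i x)) sequentially"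
    by (rule Weierstrass_m_test[OF _ sN]) (use a in auto)
  then have "continuous_on UNIV (\<lambda>x. suminf (\<lambda>i. a i x))"
    by (rule uniform_limit_theorem[rotated])
       (auto simp: a_def intro!: always_eventually continuous_intros)
  moreover have "\<bar>suminf (\<lambda>i. a i x)\<bar> \<le> suminf (\<lambda>n. (1/2::real) ^ n * norm f)" for x
    using suminf_nonneg[OF sa a(1)] suminf_le[OF a(2) sa sN] by simp
  ultimately obtain F where F: "apply_bcontfun F = (\<lambda>x. suminf (\<lambda>i. a i x))"
    using ex_bcontfun by blast
  define r where "r n = F - (\<Sum>i<n. (1/2) ^ i *\<^sub>R g i)" for n
  have r: "apply_bcontfun (r n) x = suminf (\<lambda>i. a i x) - (\<Sum>i<n. a i x)" for n x
    by (simp add: r_def F a_def)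
  have "(\<lambda>n. L (r n)) \<longlonglongrightarrow> 0"
  proof (rule sigma_smoothD[OF smooth])
    show "apply_bcontfun (r (Suc n)) x \<le> apply_bcontfun (r n) x" for n x
      using a(1) by (simp add: r)
    show "(\<lambda>n. apply_bcontfun (r n) x) \<longlonglongrightarrow> 0" for x
      using tendsto_diff[OF tendsto_const[of "suminf (\<lambda>i. a i x)"] summable_LIMSEQ[OF sa[of x]]] by (simp add: r)
  qed
  then have "(\<lambda>n. L (r n) - L (r (Suc n))) \<longlonglongrightarrow> 0 - 0"
    by (intro tendsto_diff LIMSEQ_Suc)
  moreover have "L (r n) - L (r (Suc n)) = (1/2) ^ n * L (g n)" for n
    by (simp add: r_def linear_diff[OF lin] linear_add[OF lin] linear_cmul[OF lin])
  ultimately have "(\<lambda>n. (1/2) ^ n * L (g n)) \<longlonglongrightarrow> 0" by simp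
  moreover have "1 \<le> (1/2) ^ n * L (g n)" for n
    using g(2)[of n] by (simp add: field_simps)
  ultimately show False
    using LIMSEQ_le_const[of _ 0 1] by fastforce
qed

lemma positive_part_upper:
  assumes "linear L" "sigma_smooth L" "g \<in> order_interval f"
  shows "L g \<le> positive_part L f"
  unfolding positive_part_def
  by (rule cSUP_upper[OF assms(3) sigma_smooth_bdd_above[OF assms(1,2)]])

lemma positive_part_least:
  assumes "\<And>x. 0 \<le> apply_bcontfun f x" "\<And>g. g \<in> order_interval f \<Longrightarrow> L g \<le> c"
  shows "positive_part L f \<le> c"
  unfolding positive_part_def
  by (rule cSUP_least) (use assms zero_in_order_interval in auto)

lemma positive_part_nonneg:
  assumes "linear L" "sigma_smooth L" "\<And>x. 0 \<le> apply_bcontfun f x"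
  shows "0 \<le> positive_part L f"
  using positive_part_upper[OF assms(1,2) zero_in_order_interval[OF assms(3)]] linear_0[OF assms(1)]
  by simp

text \<open>Riesz decomposition: a function below \<open>f + g\<close> splits into
  \<open>bmin h f\<close> below \<open>f\<close> and a rest below \<open>g\<close>. For the reverse
  inequality the two suprema are taken one after the other.\<close>

lemma positive_part_add:
  assumes L: "linear L" "sigma_smooth L"
    and f: "\<And>x. 0 \<le> apply_bcontfun f x" and g: "\<And>x. 0 \<le> apply_bcontfun g x"
  shows "positive_part L (f + g) = positive_part L f + positive_part L g"
proof (rule antisym)
  show "positive_part L (f + g) \<le> positive_part L f + positive_part L g"
  proof (rule positive_part_least)
    fix h assume h: "h \<in> order_interval (f + g)"
    have "bmin h f \<in> order_interval f"
      using h f by (auto simp: order_interval_def)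
    moreover have "h - bmin h f \<in> order_interval g"
      using h g by (auto simp: order_interval_def min_def algebra_simps)
    ultimately have "L (bmin h f) + L (h - bmin h f) \<le> positive_part L f + positive_part L g"
      by (intro add_mono positive_part_upper L)
    then show "L h \<le> positive_part L f + positive_part L g"
      by (simp add: linear_diff[OF L(1)])
  qed (use f g in \<open>simp add: add_nonneg_nonneg\<close>)
  have "positive_part L f \<le> positive_part L (f + g) - L k" if k: "k \<in> order_interval g" for k
  proof (rule positive_part_least[OF f])
    fix h assume "h \<in> order_interval f"
    then have "h + k \<in> order_interval (f + g)"
      using k by (auto simp: order_interval_def intro: add_mono)
    from positive_part_upper[OF L this] show "L h \<le> positive_part L (f + g) - L k"
      by (simp add: linear_add[OF L(1)])
  qed
  then have "positive_part L g \<le> positive_part L (f + g) - positive_part L f"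
    by (intro positive_part_least[OF g]) fastforce
  then show "positive_part L f + positive_part L g \<le> positive_part L (f + g)" by simp
qed

text \<open>The reflection \<open>g \<mapsto> f - g\<close> maps the order interval to itself, and
  \<open>L g = L f - L (f - g)\<close>.\<close>

lemma positive_part_diff:
  assumes L: "linear L" "sigma_smooth L" and f: "\<And>x. 0 \<le> apply_bcontfun f x"
  shows "positive_part L f = L f + positive_part (\<lambda>g. - L g) f"
proof (rule antisym)
  let ?N = "\<lambda>g. - L g"
  have N: "linear ?N" "sigma_smooth ?N"
    using L by (auto intro: linear_compose_neg sigma_smooth_uminus)
  have flip: "f - g \<in> order_interval f" if "g \<in> order_interval f" for g
    using that by (auto simp: order_interval_def)
  show "positive_part L f \<le> L f + positive_part ?N f"
  proof (rule positive_part_least[OF f])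
    fix g assume "g \<in> order_interval f"
    from positive_part_upper[OF N flip[OF this]] show "L g \<le> L f + positive_part ?N f"
      by (simp add: linear_diff[OF L(1)])
  qed
  have "positive_part ?N f \<le> positive_part L f - L f"
  proof (rule positive_part_least[OF f])
    fix g assume "g \<in> order_interval f"
    from positive_part_upper[OF L flip[OF this]] show "- L g \<le> positive_part L f - L f"
      by (simp add: linear_diff[OF L(1)])
  qed
  then show "L f + positive_part ?N f \<le> positive_part L f" by simp
qed

text \<open>Take \<open>g\<close> almost maximal for \<open>f 0\<close>. The functions
  \<open>bmin g (f n)\<close> decrease to 0, so \<open>L\<close> is eventually small on them, and
  what remains of \<open>g\<close> lies below \<open>f 0 - f n\<close>. Hence
  \<open>f 0 - f n\<close> already carries almost all of \<open>positive_part L (f 0)\<close>, and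
  additivity leaves little for \<open>f n\<close>.\<close>

lemma positive_part_smooth:
  fixes f :: "nat \<Rightarrow> 'a::topological_space \<Rightarrow>\<^sub>C real"
  assumes L: "linear L" "sigma_smooth L"
    and dec: "\<And>n x. apply_bcontfun (f (Suc n)) x \<le> apply_bcontfun (f n) x"
    and lim: "\<And>x. (\<lambda>n. apply_bcontfun (f n) x) \<longlonglongrightarrow> 0"
  shows "(\<lambda>n. positive_part L (f n)) \<longlonglongrightarrow> 0"
proof -
  have decs: "decseq (\<lambda>n. apply_bcontfun (f n) x)" for x
    by (rule decseq_SucI) (rule dec)
  have f0: "0 \<le> apply_bcontfun (f n) x" for n x
    by (rule decseq_ge[OF decs lim])
  show ?thesis
  proof (rule LIMSEQ_I)
    fix e :: real assume e: "e > 0"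
    have "\<exists>g\<in>order_interval (f 0). positive_part L (f 0) - e/2 < L g"
      unfolding positive_part_def
      by (subst less_cSUP_iff[symmetric])
         (use e zero_in_order_interval[OF f0] sigma_smooth_bdd_above[OF L] in auto)
    then obtain g where g: "g \<in> order_interval (f 0)" "positive_part L (f 0) - e/2 < L g" by auto
    have "(\<lambda>n. L (bmin g (f n))) \<longlonglongrightarrow> 0"
    proof (rule sigma_smoothD[OF L(2)])
      fix x
      have "(\<lambda>n. min (apply_bcontfun g x) (apply_bcontfun (f n) x)) \<longlonglongrightarrow> min (apply_bcontfun g x) 0"
        by (intro tendsto_min tendsto_const lim)
      then show "(\<lambda>n. apply_bcontfun (bmin g (f n)) x) \<longlonglongrightarrow> 0"
        using g(1) by (simp add: order_interval_def)
    qed (use dec in \<open>auto simp: min_def intro: order_trans\<close>)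
    from LIMSEQ_D[OF this, of "e/2"] e obtain N where
      N: "\<And>n. n \<ge> N \<Longrightarrow> \<bar>L (bmin g (f n))\<bar> < e/2" by auto
    have "norm (positive_part L (f n) - 0) < e" if "n \<ge> N" for n
    proof -
      have le: "apply_bcontfun (f n) x \<le> apply_bcontfun (f 0) x" for x
        using decseqD[OF decs, of 0 n] by simp
      \<comment> \<open>Where \<open>g \<le> f n\<close> the left side is 0; elsewhere it is
        \<open>g - f n\<close>, and \<open>g \<le> f 0\<close>.\<close>
      have "g - bmin g (f n) \<in> order_interval (f 0 - f n)"
        using g(1) le by (auto simp: order_interval_def min_def)
      then have "L g - L (bmin g (f n)) \<le> positive_part L (f 0 - f n)"
        using positive_part_upper[OF L] by (metis linear_diff[OF L(1)])
      moreover have "positive_part L (f 0 - f n + f n) = positive_part L (f 0 - f n) + positive_part L (f n)"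
        by (rule positive_part_add[OF L]) (use f0 le in auto)
      ultimately have "positive_part L (f n) < e"
        using g(2) N[OF that] by simp
      then show ?thesis using positive_part_nonneg[OF L f0] by simp
    qed
    then show "\<exists>N. \<forall>n\<ge>N. norm (positive_part L (f n) - 0) < e" by blast
  qed
qed

section \<open>Daniell integration\<close>

text \<open>Half-open at the top, so that removing a strip from a strip leaves half-open pieces
  again.\<close>

definition strip :: "('a::topological_space \<Rightarrow>\<^sub>C real) \<Rightarrow> ('a \<Rightarrow>\<^sub>C real) \<Rightarrow> ('a \<times> real) set" where
  "strip f g = {(x, t). apply_bcontfun f x \<le> t \<and> t < apply_bcontfun g x}"

definition strips :: "('a::topological_space \<times> real) set set" where
  "strips = {strip f g | f g. \<forall>x. apply_bcontfun f x \<le> apply_bcontfun g x}"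

lemma stripsE:
  assumes "A \<in> strips"
  obtains f g where "A = strip f g" "\<And>x. apply_bcontfun f x \<le> apply_bcontfun g x"
  using assms by (auto simp: strips_def)

lemma strip_in_strips: "(\<And>x. apply_bcontfun f x \<le> apply_bcontfun g x) \<Longrightarrow> strip f g \<in> strips"
  by (auto simp: strips_def)

lemma semiring_strips: "semiring_of_sets UNIV strips"
proof
  have "{} = strip 0 0" by (auto simp: strip_def)
  then show "{} \<in> strips" by (metis order_refl strip_in_strips)
  fix A B :: "('a \<times> real) set" assume "A \<in> strips" "B \<in> strips"
  then obtain f g h k where A: "A = strip f g" "\<And>x. apply_bcontfun f x \<le> apply_bcontfun g x"
    and B: "B = strip h k" "\<And>x. apply_bcontfun h x \<le> apply_bcontfun k x"
    by (elim stripsE) blast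
  \<comment> \<open>The outer \<open>bmax\<close> lifts the upper graph to the lower one over points
    where the two fibres do not meet, which makes the fibre empty there and keeps the graphs
    ordered.\<close>
  have "A \<inter> B = strip (bmax f h) (bmax (bmax f h) (bmin g k))"
    by (auto simp: A B strip_def)
  moreover have "strip (bmax f h) (bmax (bmax f h) (bmin g k)) \<in> strips"
    by (rule strip_in_strips) auto
  ultimately show "A \<inter> B \<in> strips" by simp
  \<comment> \<open>The part of \<open>A\<close> below the lower graph \<open>h\<close> of
    \<open>B\<close>, and the part above its upper graph \<open>k\<close>, both clipped to stay
    between \<open>f\<close> and \<open>g\<close>.\<close>
  let ?C1 = "strip f (bmax f (bmin g h))" and ?C2 = "strip (bmin g (bmax f k)) g"
  have "?C1 \<in> strips" "?C2 \<in> strips"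
    using A(2) by (auto intro!: strip_in_strips)
  moreover have "?C1 \<inter> ?C2 = {}"
  proof -
    have False if "(x, t) \<in> ?C1" "(x, t) \<in> ?C2" for x t
      using that A(2)[of x] B(2)[of x] by (auto simp: strip_def min_def max_def split: if_splits)
    then show ?thesis by auto
  qed
  moreover have "A - B = \<Union>{?C1, ?C2}"
  proof -
    have "(x, t) \<in> A - B \<longleftrightarrow> (x, t) \<in> ?C1 \<or> (x, t) \<in> ?C2" for x t
      using A(2)[of x] B(2)[of x] by (auto simp: A(1) B(1) strip_def min_def max_def split: if_splits)
    then show ?thesis by auto
  qed
  ultimately show "\<exists>C\<subseteq>strips. finite C \<and> disjoint C \<and> A - B = \<Union>C"
    by (intro exI[of _ "{?C1, ?C2}"]) (auto simp: disjoint_def Int_commute)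
qed simp

text \<open>Fibre lengths recover \<open>g - f\<close> from the set alone. The pair
  \<open>(f, g)\<close> is not determined by the strip, whose fibre is empty wherever the two
  functions agree.\<close>

definition strip_volume ::
    "(('a::topological_space \<Rightarrow>\<^sub>C real) \<Rightarrow> real) \<Rightarrow> ('a \<times> real) set \<Rightarrow> ennreal" where
  "strip_volume I A = ennreal (I (Bcontfun (\<lambda>x. measure lborel (Pair x -` A))))"

lemma strip_section: "Pair x -` strip f g = {apply_bcontfun f x..<apply_bcontfun g x}"
  by (auto simp: strip_def)

lemma strip_volume_strip:
  assumes "\<And>x. apply_bcontfun f x \<le> apply_bcontfun g x"
  shows "strip_volume I (strip f g) = ennreal (I (g - f))"
proof -
  have "(\<lambda>x. measure lborel (Pair x -` strip f g)) = apply_bcontfun (g - f)"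
    using assms by (simp add: strip_section fun_eq_iff)
  then show ?thesis unfolding strip_volume_def by (simp only: apply_bcontfun_inverse)
qed

text \<open>Only the restriction of \<open>I\<close> to nonnegative functions matters; it is extended to a measure by
  applying Caratheodory's theorem to \<open>strip f g \<mapsto> I (g - f)\<close>.\<close>

locale daniell =
  fixes I :: "('a::topological_space \<Rightarrow>\<^sub>C real) \<Rightarrow> real"
  assumes I_nonneg: "\<And>f. (\<And>x. 0 \<le> apply_bcontfun f x) \<Longrightarrow> 0 \<le> I f"
    and I_add: "\<And>f g. (\<And>x. 0 \<le> apply_bcontfun f x) \<Longrightarrow> (\<And>x. 0 \<le> apply_bcontfun g x) \<Longrightarrow>
      I (f + g) = I f + I g"
    and I_smooth: "\<And>f. (\<And>n x. apply_bcontfun (f (Suc n)) x \<le> apply_bcontfun (f n) x) \<Longrightarrow>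
      (\<And>x. (\<lambda>n. apply_bcontfun (f n) x) \<longlonglongrightarrow> 0) \<Longrightarrow> (\<lambda>n. I (f n)) \<longlonglongrightarrow> 0"
begin

lemma I_zero: "I 0 = 0"
  using I_add[of 0 0] by simp

lemma I_sum:
  assumes "\<And>i x. i \<in> A \<Longrightarrow> 0 \<le> apply_bcontfun (F i) x"
  shows "I (sum F A) = (\<Sum>i\<in>A. I (F i))"
  using assms
proof (induction A rule: infinite_finite_induct)
  case (insert a A)
  then have "I (F a + sum F A) = I (F a) + I (sum F A)"
    by (intro I_add) (auto intro: sum_nonneg)
  with insert show ?case by simp
qed (auto simp: I_zero)

text \<open>Over each \<open>x\<close> the fibres partition an interval, so countable additivity of
  Lebesgue measure gives \<open>g - f\<close> as the pointwise sum of the \<open>G i - F i\<close>.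
  The remainders of this series decrease to 0, and smoothness of \<open>I\<close> turns pointwise
  summation into summation of the values of \<open>I\<close>.\<close>

lemma countably_additive_strip_volume: "countably_additive strips (strip_volume I)"
  unfolding countably_additive_def
proof (intro allI impI)
  fix A :: "nat \<Rightarrow> ('a \<times> real) set"
  assume A: "range A \<subseteq> strips" "disjoint_family A" "(\<Union>i. A i) \<in> strips"
  from A(3) obtain f g where fg: "(\<Union>i. A i) = strip f g" "\<And>x. apply_bcontfun f x \<le> apply_bcontfun g x"
    by (elim stripsE) blast
  have "\<exists>f g. A i = strip f g \<and> (\<forall>x. apply_bcontfun f x \<le> apply_bcontfun g x)" for i
    using A(1)[THEN subsetD, OF rangeI, of i] unfolding strips_def by blast
  then obtain F G where FG: "\<And>i. A i = strip (F i) (G i)"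
    "\<And>i x. apply_bcontfun (F i) x \<le> apply_bcontfun (G i) x"
    by metis
  have sums: "(\<lambda>i. apply_bcontfun (G i - F i) x) sums apply_bcontfun (g - f) x" for x
  proof -
    have UN: "(\<Union>i. Pair x -` A i) = {apply_bcontfun f x..<apply_bcontfun g x}"
      unfolding vimage_UN[symmetric] fg(1) strip_section ..
    have "(\<lambda>i. measure lborel (Pair x -` A i)) sums measure lborel (\<Union>i. Pair x -` A i)"
    proof (rule measure_UNION)
      show "range (\<lambda>i. Pair x -` A i) \<subseteq> sets lborel"
        by (auto simp: FG strip_section)
      show "disjoint_family (\<lambda>i. Pair x -` A i)"
        using A(2) by (auto simp: disjoint_family_on_def)
      show "emeasure lborel (\<Union>i. Pair x -` A i) \<noteq> \<infinity>" unfolding UN using fg(2) by simp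
    qed
    then show ?thesis
      unfolding UN unfolding FG(1) strip_section using fg(2) FG(2) by simp
  qed
  define r where "r n = (g - f) - (\<Sum>i<n. G i - F i)" for n
  have r: "apply_bcontfun (r n) x =
      apply_bcontfun (g - f) x - (\<Sum>i<n. apply_bcontfun (G i - F i) x)" for n x
    by (simp add: r_def)
  have "(\<lambda>n. I (r n)) \<longlonglongrightarrow> 0"
  proof (rule I_smooth)
    show "apply_bcontfun (r (Suc n)) x \<le> apply_bcontfun (r n) x" for n x
      using FG(2)[of n x] by (simp add: r)
    show "(\<lambda>n. apply_bcontfun (r n) x) \<longlonglongrightarrow> 0" for x
      using tendsto_diff[OF tendsto_const[of "apply_bcontfun (g - f) x"] sums[of x, unfolded sums_def]]
      by (simp add: r)
  qed
  moreover have "I (g - f) = I (r n) + (\<Sum>i<n. I (G i - F i))" for n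
  proof -
    have "0 \<le> apply_bcontfun (r n) x" for x
      unfolding r using sum_le_suminf[OF sums_summable[OF sums[of x]], of "{..<n}"]
        sums_unique[OF sums[of x]] FG(2) by simp
    then have "I (r n + (\<Sum>i<n. G i - F i)) = I (r n) + I (\<Sum>i<n. G i - F i)"
      by (intro I_add) (use FG(2) in \<open>auto intro!: sum_nonneg\<close>)
    also have "I (\<Sum>i<n. G i - F i) = (\<Sum>i<n. I (G i - F i))"
      by (rule I_sum) (use FG(2) in auto)
    finally show ?thesis by (simp add: r_def)
  qed
  then have "I (r n) = I (g - f) - (\<Sum>i<n. I (G i - F i))" for n
    by (metis add_diff_cancel_right')
  ultimately have "(\<lambda>n. I (g - f) - (I (g - f) - (\<Sum>i<n. I (G i - F i)))) \<longlonglongrightarrow> I (g - f) - 0"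
    by (intro tendsto_diff tendsto_const) simp
  then have "(\<lambda>i. I (G i - F i)) sums I (g - f)"
    by (simp add: sums_def)
  then have "(\<Sum>i. ennreal (I (G i - F i))) = ennreal (I (g - f))"
    by (intro suminf_ennreal_eq I_nonneg) (use FG(2) in auto)
  then show "(\<Sum>i. strip_volume I (A i)) = strip_volume I (\<Union>i. A i)"
    unfolding fg(1) unfolding FG(1) using fg(2) FG(2) by (simp add: strip_volume_strip)
qed

lemma ex_strip_measure:
  "\<exists>m. space m = UNIV \<and> sets m = sigma_sets UNIV strips \<and>
     (\<forall>f g. (\<forall>x. apply_bcontfun f x \<le> apply_bcontfun g x) \<longrightarrow> emeasure m (strip f g) = ennreal (I (g - f)))"
proof -
  interpret semiring_of_sets UNIV "strips :: ('a \<times> real) set set" by (rule semiring_strips)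
  have "{} = (strip 0 0 :: ('a \<times> real) set)" by (auto simp: strip_def)
  then have "strip_volume I {} = 0" using strip_volume_strip[of 0 0 I] I_zero by simp
  then have "positive strips (strip_volume I)" by (simp add: positive_def)
  from caratheodory[OF this countably_additive_strip_volume]
  obtain \<mu> where \<mu>: "\<And>A. A \<in> strips \<Longrightarrow> \<mu> A = strip_volume I A"
    "measure_space UNIV (sigma_sets UNIV strips) \<mu>" by blast
  let ?m = "measure_of UNIV strips \<mu>"
  have "emeasure ?m (strip f g) = ennreal (I (g - f))"
    if "\<forall>x. apply_bcontfun f x \<le> apply_bcontfun g x" for f g
  proof -
    have "emeasure ?m (strip f g) = \<mu> (strip f g)"
      using \<mu>(2) that by (intro emeasure_measure_of) (auto simp: measure_space_def strip_in_strips)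
    then show ?thesis using \<mu>(1)[of "strip f g"] that by (simp add: strip_in_strips strip_volume_strip)
  qed
  then show ?thesis by (intro exI[of _ ?m]) auto
qed

end

text \<open>Open sets are cozero sets; the functions \<open>min 1 (n * g)\<close> then increase to
  the indicator of \<open>U\<close>.\<close>

definition perfectly_normal :: "'a::topological_space itself \<Rightarrow> bool" where
  "perfectly_normal _ \<longleftrightarrow>
     (\<forall>U :: 'a set. open U \<longrightarrow> (\<exists>g :: 'a \<Rightarrow>\<^sub>C real. (\<forall>x. 0 \<le> apply_bcontfun g x) \<and> U = {x. 0 < apply_bcontfun g x}))"

text \<open>A discrete layer-cake formula: the \<open>j\<close>-th term is the part of
  \<open>y\<close> lying between \<open>j\<close> and \<open>j + 1\<close>. It cuts
  \<open>n * f\<close> into functions with values in \<open>[0, 1]\<close>.\<close>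

lemma sum_unit_slices:
  fixes y :: real assumes "0 \<le> y"
  shows "(\<Sum>j<N. min 1 (max 0 (y - real j))) = min y (real N)"
  using assms by (induction N) auto

text \<open>Counting whole layers instead of their filled parts overshoots by at most 1,
  independently of the size of \<open>y\<close>.\<close>

lemma sum_unit_steps:
  fixes y :: real assumes "0 \<le> y"
  shows "(\<Sum>j<N. of_bool (real j < y)) \<le> min (real N) (y + 1)"
  using assms by (induction N) auto

section \<open>The representing measure of a Daniell functional\<close>

context daniell
begin

text \<open>The measure of \<open>A\<close> is the volume of \<open>A \<times> {0..<1}\<close>:
  restrict the strip measure to the slab of height 1 and project. The last inequality holds because
  the strip under \<open>\<phi>\<close> lies in \<open>U \<times> {0..<1}\<close>.\<close>

lemma ex_measure:
  assumes "perfectly_normal TYPE('a)"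
  shows "\<exists>\<nu> :: 'a measure. finite_measure \<nu> \<and> sets \<nu> = sets borel \<and>
    measure \<nu> UNIV = I (const_bcontfun 1) \<and>
    (\<forall>U \<phi>. open U \<longrightarrow> (\<forall>x. 0 \<le> apply_bcontfun \<phi> x \<and> apply_bcontfun \<phi> x \<le> indicator U x) \<longrightarrow>
       I \<phi> \<le> measure \<nu> U)"
proof -
  obtain m where m: "space m = UNIV" "sets m = sigma_sets UNIV (strips :: ('a \<times> real) set set)"
    "\<And>f g. (\<And>x. apply_bcontfun f x \<le> apply_bcontfun g x) \<Longrightarrow> emeasure m (strip f g) = ennreal (I (g - f))"
    using ex_strip_measure by blast
  let ?one = "const_bcontfun 1 :: 'a \<Rightarrow>\<^sub>C real"
  let ?S = "UNIV \<times> {0..<1} :: ('a \<times> real) set"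
  have sm: "strip f g \<in> sets m" if "\<And>x. apply_bcontfun f x \<le> apply_bcontfun g x" for f g
    using strip_in_strips[of f g] that by (auto simp: m(2))
  have S: "?S = strip 0 ?one" by (auto simp: strip_def)
  have Sm: "?S \<in> sets m" unfolding S by (rule sm) simp
  have fst: "fst \<in> restrict_space m ?S \<rightarrow>\<^sub>M borel"
  proof (rule borel_measurableI)
    fix U :: "'a set" assume "open U"
    then obtain g :: "'a \<Rightarrow>\<^sub>C real" where g: "\<And>x. 0 \<le> apply_bcontfun g x" "U = {x. 0 < apply_bcontfun g x}"
      using assms unfolding perfectly_normal_def by blast
    \<comment> \<open>The strips under \<open>min 1 (n * g)\<close> exhaust the cylinder over the
      cozero set of \<open>g\<close>.\<close>
    have "U \<times> {0..<1} = (\<Union>n. strip 0 (bmin ?one (real n *\<^sub>R g)))"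
    proof (intro equalityI subsetI)
      fix z :: "'a \<times> real" assume "z \<in> U \<times> {0..<1}"
      then obtain x t where z: "z = (x, t)" "0 < apply_bcontfun g x" "0 \<le> t" "t < 1" by (auto simp: g)
      obtain n where "t < real n * apply_bcontfun g x" using reals_Archimedean3[OF z(2)] by blast
      then show "z \<in> (\<Union>n. strip 0 (bmin ?one (real n *\<^sub>R g)))" using z by (auto simp: strip_def)
    next
      fix z :: "'a \<times> real" assume "z \<in> (\<Union>n. strip 0 (bmin ?one (real n *\<^sub>R g)))"
      then obtain n x t where z: "z = (x, t)" "0 \<le> t" "t < 1" "t < real n * apply_bcontfun g x"
        by (auto simp: strip_def)
      then have "apply_bcontfun g x \<noteq> 0" by auto
      with g(1)[of x] have "0 < apply_bcontfun g x" by simp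
      with z show "z \<in> U \<times> {0..<1}" by (auto simp: g(2))
    qed
    moreover have "strip 0 (bmin ?one (real n *\<^sub>R g)) \<in> sets m" for n
      by (rule sm) (use g(1) in auto)
    ultimately have "U \<times> {0..<1} \<in> sets m" by auto
    moreover have "fst -` U \<inter> space (restrict_space m ?S) = U \<times> {0..<1}"
      by (auto simp: space_restrict_space m(1))
    ultimately show "fst -` U \<inter> space (restrict_space m ?S) \<in> sets (restrict_space m ?S)"
      using Sm by (auto simp: sets_restrict_space_iff m(1))
  qed
  define \<nu> where "\<nu> = distr (restrict_space m ?S) borel fst"
  have sets\<nu>: "sets \<nu> = sets borel" by (simp add: \<nu>_def)
  have \<nu>: "emeasure \<nu> A = emeasure m (A \<times> {0..<1})" "A \<times> {0..<1} \<in> sets m" if "A \<in> sets borel" for A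
  proof -
    have eq: "fst -` A \<inter> space (restrict_space m ?S) = A \<times> {0..<1}"
      by (auto simp: space_restrict_space m(1))
    have "emeasure \<nu> A = emeasure (restrict_space m ?S) (A \<times> {0..<1})"
      unfolding \<nu>_def by (subst emeasure_distr[OF fst that]) (simp add: eq)
    also have "\<dots> = emeasure m (A \<times> {0..<1})"
      by (rule emeasure_restrict_space) (use Sm in \<open>auto simp: m(1)\<close>)
    finally show "emeasure \<nu> A = emeasure m (A \<times> {0..<1})" .
    show "A \<times> {0..<1} \<in> sets m"
      using measurable_sets[OF fst that] Sm unfolding eq by (auto simp: sets_restrict_space_iff m(1))
  qed
  have UNIV\<nu>: "emeasure \<nu> UNIV = ennreal (I ?one)"
    using \<nu>(1)[of UNIV] m(3)[of 0 ?one] by (simp add: S)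
  have fin: "finite_measure \<nu>"
    by (rule finite_measureI) (use UNIV\<nu> sets_eq_imp_space_eq[OF sets\<nu>] in auto)
  have "I \<phi> \<le> measure \<nu> U"
    if U: "open U" and \<phi>: "\<forall>x. 0 \<le> apply_bcontfun \<phi> x \<and> apply_bcontfun \<phi> x \<le> indicator U x" for U \<phi>
  proof -
    have "strip 0 \<phi> \<subseteq> U \<times> {0..<1}"
    proof
      fix z assume "z \<in> strip 0 \<phi>"
      then obtain x t where z: "z = (x, t)" "0 \<le> t" "t < apply_bcontfun \<phi> x" by (auto simp: strip_def)
      with \<phi>[rule_format, of x] show "z \<in> U \<times> {0..<1}" by (cases "x \<in> U") auto
    qed
    then have "emeasure m (strip 0 \<phi>) \<le> emeasure m (U \<times> {0..<1})"
      by (rule emeasure_mono) (use \<nu>(2) U in auto)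
    then have "ennreal (I \<phi>) \<le> ennreal (measure \<nu> U)"
      using m(3)[of 0 \<phi>] \<phi> \<nu>(1)[of U] U finite_measure.emeasure_eq_measure[OF fin, of U] by simp
    then show ?thesis by (simp add: ennreal_le_iff)
  qed
  moreover have "measure \<nu> UNIV = I ?one"
    by (simp add: measure_def UNIV\<nu> I_nonneg)
  ultimately show ?thesis using fin sets\<nu> by blast
qed

text \<open>Each unit slice of \<open>n * f\<close> satisfies the inequality of
  \<open>ex_measure\<close> on the set where \<open>n * f > j\<close>. Summing gives
  \<open>n * I f \<le> n * \<integral>f + \<nu>(X)\<close>; the rounding error does not grow with
  \<open>n\<close>, so \<open>I f \<le> \<integral>f\<close>. Applied to a constant minus
  \<open>f\<close>, the same bound gives the reverse inequality, as both sides agree on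
  constants.\<close>

lemma riesz:
  assumes "perfectly_normal TYPE('a)"
  shows "\<exists>\<nu> :: 'a measure. finite_measure \<nu> \<and> sets \<nu> = sets borel \<and>
    (\<forall>f. (\<forall>x. 0 \<le> apply_bcontfun f x) \<longrightarrow> I f = (LINT x|\<nu>. apply_bcontfun f x))"
proof -
  obtain \<nu> :: "'a measure" where fin: "finite_measure \<nu>" and [measurable_cong]: "sets \<nu> = sets borel"
    and tot: "measure \<nu> UNIV = I (const_bcontfun 1)"
    and le: "\<And>U \<phi>. open U \<Longrightarrow> (\<And>x. 0 \<le> apply_bcontfun \<phi> x \<and> apply_bcontfun \<phi> x \<le> indicator U x) \<Longrightarrow>
      I \<phi> \<le> measure \<nu> U"
    using ex_measure[OF assms] by blast
  interpret \<nu>: finite_measure \<nu> by (rule fin)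
  have sp[simp]: "space \<nu> = UNIV" using sets_eq_imp_space_eq[OF \<open>sets \<nu> = sets borel\<close>] by simp
  have bm[measurable]: "apply_bcontfun f \<in> borel_measurable \<nu>" for f :: "'a \<Rightarrow>\<^sub>C real"
    by (simp add: measurable_cong_sets[OF \<open>sets \<nu> = sets borel\<close> refl] borel_measurable_continuous_onI)
  have int[simp]: "integrable \<nu> (apply_bcontfun f)" for f :: "'a \<Rightarrow>\<^sub>C real"
    by (rule \<nu>.integrable_const_bound[of _ "norm f"]) (use abs_apply_le_norm[of f] in auto)
  have I_nat: "I (real n *\<^sub>R f) = real n * I f" if "\<And>x. 0 \<le> apply_bcontfun f x" for n f
    using I_sum[of "{..<n}" "\<lambda>_. f"] that by (simp add: sum_constant_scaleR)
  have upper: "I f \<le> (LINT x|\<nu>. apply_bcontfun f x)" if f: "\<And>x. 0 \<le> apply_bcontfun f x" for f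
  proof -
    have "real n * I f \<le> real n * (LINT x|\<nu>. apply_bcontfun f x) + measure \<nu> UNIV" for n :: nat
    proof -
      \<comment> \<open>\<open>N\<close> is large enough for the slices to exhaust
        \<open>n * f\<close>, and does not occur in the resulting estimate.\<close>
      obtain N :: nat where N: "real n * norm f \<le> real N" using real_arch_simple by blast
      define \<phi> where "\<phi> j = bmin (const_bcontfun 1) (bmax 0 (real n *\<^sub>R f - const_bcontfun (real j)))" for j
      define U where "U j = {x. real j < real n * apply_bcontfun f x}" for j
      have [measurable]: "U j \<in> sets \<nu>" for j unfolding U_def by measurable
      have "real n *\<^sub>R f = (\<Sum>j<N. \<phi> j)"
      proof (rule bcontfun_eqI)
        fix x
        have "real n * apply_bcontfun f x \<le> real N"
          using abs_apply_le_norm[of f x] N by (smt (verit) mult_left_mono of_nat_0_le_iff)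
        then show "apply_bcontfun (real n *\<^sub>R f) x = apply_bcontfun (\<Sum>j<N. \<phi> j) x"
          using sum_unit_slices[of "real n * apply_bcontfun f x" N] f by (simp add: \<phi>_def)
      qed
      then have "real n * I f = I (\<Sum>j<N. \<phi> j)" using I_nat[OF f] by metis
      also have "\<dots> = (\<Sum>j<N. I (\<phi> j))"
        by (rule I_sum) (simp add: \<phi>_def)
      also have "\<dots> \<le> (\<Sum>j<N. measure \<nu> (U j))"
      proof (intro sum_mono le)
        show "open (U j)" for j unfolding U_def
          by (intro open_Collect_less continuous_intros) auto
        show "0 \<le> apply_bcontfun (\<phi> j) x \<and> apply_bcontfun (\<phi> j) x \<le> indicator (U j) x" for j x
          by (auto simp: \<phi>_def U_def indicator_def)
      qed
      also have "\<dots> = (LINT x|\<nu>. (\<Sum>j<N. indicator (U j) x))"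
        by (subst Bochner_Integration.integral_sum) (auto simp: \<nu>.emeasure_eq_measure)
      also have "\<dots> \<le> (LINT x|\<nu>. real n * apply_bcontfun f x + 1)"
      proof (rule integral_mono)
        fix x
        have "(\<Sum>j<N. indicator (U j) x :: real) = (\<Sum>j<N. of_bool (real j < real n * apply_bcontfun f x))"
          by (simp add: U_def indicator_def)
        then show "(\<Sum>j<N. indicator (U j) x) \<le> real n * apply_bcontfun f x + 1"
          using sum_unit_steps[of "real n * apply_bcontfun f x" N] f by simp
      qed (auto simp: \<nu>.emeasure_eq_measure intro!: Bochner_Integration.integrable_sum)
      also have "\<dots> = real n * (LINT x|\<nu>. apply_bcontfun f x) + measure \<nu> UNIV"
        by (simp add: Bochner_Integration.integral_add)
      finally show ?thesis .
    qed
    then have *: "real n * (I f - (LINT x|\<nu>. apply_bcontfun f x)) \<le> measure \<nu> UNIV" for n :: nat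
      unfolding right_diff_distrib by (simp add: diff_le_eq add.commute)
    show ?thesis
    proof (rule ccontr)
      assume "\<not> ?thesis"
      then have "0 < I f - (LINT x|\<nu>. apply_bcontfun f x)" by simp
      from reals_Archimedean3[OF this] obtain n :: nat
        where "measure \<nu> UNIV < real n * (I f - (LINT x|\<nu>. apply_bcontfun f x))" by blast
      with *[of n] show False by simp
    qed
  qed
  have "I f = (LINT x|\<nu>. apply_bcontfun f x)" if f: "\<forall>x. 0 \<le> apply_bcontfun f x" for f
  proof (rule antisym)
    show "I f \<le> (LINT x|\<nu>. apply_bcontfun f x)" using upper f by blast
    obtain N :: nat where N: "norm f \<le> real N" using real_arch_simple by blast
    let ?c = "real N *\<^sub>R const_bcontfun 1 :: 'a \<Rightarrow>\<^sub>C real"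
    have d: "0 \<le> apply_bcontfun (?c - f) x" for x
      using abs_apply_le_norm[of f x] N by simp
    have "I ?c = I f + I (?c - f)"
      using I_add[of f "?c - f"] f d by simp
    moreover have "I ?c = real N * measure \<nu> UNIV"
      using I_nat[of "const_bcontfun 1" N] tot by simp
    moreover have "I (?c - f) \<le> (LINT x|\<nu>. apply_bcontfun (?c - f) x)"
      by (rule upper[OF d])
    moreover have "(LINT x|\<nu>. apply_bcontfun (?c - f) x) = real N * measure \<nu> UNIV - (LINT x|\<nu>. apply_bcontfun f x)"
      by (simp add: Bochner_Integration.integral_diff)
    ultimately show "(LINT x|\<nu>. apply_bcontfun f x) \<le> I f" by simp
  qed
  then show ?thesis using fin \<open>sets \<nu> = sets borel\<close> by blast
qed

end

section \<open>Metrizable and second countable spaces\<close>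

lemma second_countable_if_separable_metrizable:
  assumes "metrizable_space X" "separable_space X"
  shows "second_countable X"
proof -
  obtain M d where md: "Metric_space M d" "X = Metric_space.mtopology M d"
    using assms(1) by (auto simp: metrizable_space_def)
  interpret Metric_space M d by (rule md(1))
  obtain C where C: "countable C" "C \<subseteq> M" "mtopology closure_of C = M"
    using assms(2) unfolding separable_space_def md(2) topspace_mtopology by auto
  define B where "B = (\<lambda>(c, n). mball c (inverse (real (Suc n)))) ` (C \<times> UNIV)"
  have "\<exists>V\<in>B. x \<in> V \<and> V \<subseteq> U" if U: "openin X U" and x: "x \<in> U" for U x
  proof -
    obtain r where r: "0 < r" "mball x r \<subseteq> U" and xM: "x \<in> M"
      using U x unfolding md(2) openin_mtopology by blast
    \<comment> \<open>With this radius, a ball about a point of \<open>C\<close> that contains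
      \<open>x\<close> stays inside \<open>mball x r\<close>.\<close>
    obtain n where n: "inverse (real (Suc n)) < r / 2"
      using reals_Archimedean[of "r / 2"] r(1) by auto
    let ?e = "inverse (real (Suc n))"
    have "x \<in> mtopology closure_of C" using C(3) xM by simp
    then have "\<forall>r>0. \<exists>y\<in>C. y \<in> mball x r" unfolding metric_closure_of by blast
    moreover have "0 < ?e" by simp
    ultimately obtain c where c: "c \<in> C" "c \<in> mball x ?e" by blast
    have "mball c ?e \<subseteq> mball x r"
    proof
      fix y assume "y \<in> mball c ?e"
      then show "y \<in> mball x r"
        using c n triangle[of x c y] by (auto simp: in_mball)
    qed
    moreover have "x \<in> mball c ?e" using c commute by (auto simp: in_mball)
    ultimately show ?thesis
      using r(2) c(1) by (intro bexI[of _ "mball c ?e"]) (auto simp: B_def)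
  qed
  moreover have "countable B" using C(1) by (auto simp: B_def)
  moreover have "\<forall>V\<in>B. openin X V" by (auto simp: B_def md(2))
  ultimately show ?thesis unfolding second_countable_def by blast
qed

text \<open>Choose one member of \<open>D\<close> for each basic set that fits into some member of
  \<open>D\<close>.\<close>

lemma Lindelof_open_cover:
  fixes D :: "'a::topological_space set set"
  assumes "second_countable (euclidean :: 'a topology)" "\<And>U. U \<in> D \<Longrightarrow> open U"
  obtains E where "countable E" "E \<subseteq> D" "\<Union>E = \<Union>D"
proof -
  obtain B :: "'a set set" where B: "countable B"
    "\<And>U x. open U \<Longrightarrow> x \<in> U \<Longrightarrow> \<exists>V\<in>B. x \<in> V \<and> V \<subseteq> U"
    using assms(1) unfolding second_countable_def by auto
  define pick where "pick V = (SOME U. U \<in> D \<and> V \<subseteq> U)" for V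
  define B' where "B' = {V\<in>B. \<exists>U\<in>D. V \<subseteq> U}"
  have pick: "pick V \<in> D" "V \<subseteq> pick V" if "V \<in> B'" for V
  proof -
    have "\<exists>U. U \<in> D \<and> V \<subseteq> U" using that by (auto simp: B'_def)
    from someI_ex[OF this] show "pick V \<in> D" "V \<subseteq> pick V" by (auto simp: pick_def)
  qed
  show thesis
  proof
    show "countable (pick ` B')" using B(1) by (simp add: B'_def)
    show "pick ` B' \<subseteq> D" using pick by auto
    show "\<Union>(pick ` B') = \<Union>D"
    proof
      show "\<Union>(pick ` B') \<subseteq> \<Union>D" using pick by blast
      show "\<Union>D \<subseteq> \<Union>(pick ` B')"
      proof
        fix x assume "x \<in> \<Union>D"
        then obtain U where U: "U \<in> D" "x \<in> U" by blast
        then obtain V where V: "V \<in> B" "x \<in> V" "V \<subseteq> U" using B(2) assms(2) by blast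
        then have "V \<in> B'" using U by (auto simp: B'_def)
        then show "x \<in> \<Union>(pick ` B')" using pick(2) V(2) by blast
      qed
    qed
  qed
qed

lemma perfectly_normal_if_metrizable:
  assumes "metrizable_space (euclidean :: 'a::topological_space topology)"
  shows "perfectly_normal TYPE('a)"
  unfolding perfectly_normal_def
proof (intro allI impI)
  fix U :: "'a set" assume U: "open U"
  obtain d where md: "Metric_space UNIV d" "(euclidean :: 'a topology) = Metric_space.mtopology UNIV d"
    using assms unfolding metrizable_space_def
    by (metis Metric_space.topspace_mtopology topspace_euclidean)
  interpret Metric_space UNIV d by (rule md(1))
  \<comment> \<open>The type has a topology but no metric of its own, so openness is expressed
    through \<open>d\<close> once; continuity of \<open>g\<close> is checked against this
    form.\<close>
  have op: "open S \<longleftrightarrow> (\<forall>x\<in>S. \<exists>r>0. \<forall>y. d x y < r \<longrightarrow> y \<in> S)" for S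
    using openin_mtopology[of S] unfolding md(2)[symmetric] open_openin[symmetric]
    by (auto simp: in_mball subset_iff)
  \<comment> \<open>\<open>g x = min 1 (d(x, - U))\<close>; the index \<open>None\<close> keeps the infimum meaningful if \<open>U = UNIV\<close>\<close>
  define g where "g x = (INF y\<in>insert None (Some ` (- U)). case y of None \<Rightarrow> 1 | Some y \<Rightarrow> d x y)" for x
  let ?F = "\<lambda>x. (\<lambda>y. case y of None \<Rightarrow> 1 | Some y \<Rightarrow> d x y) ` insert None (Some ` (- U))"
  have bdd: "bdd_below (?F x)" for x
    by (rule bdd_belowI[of _ 0]) (auto split: option.splits)
  have g0: "0 \<le> g x" for x
    unfolding g_def by (rule cINF_greatest) (auto split: option.splits)
  have g1: "g x \<le> 1" for x
    unfolding g_def using cINF_lower[OF bdd, of None] by auto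
  have gd: "g x \<le> d x y" if "y \<notin> U" for x y
    unfolding g_def using cINF_lower[OF bdd, of "Some y" x] that by auto
  \<comment> \<open>An infimum of 1-Lipschitz functions, the constant 1 among them.\<close>
  have lip: "g x \<le> g y + d x y" for x y
  proof -
    have "g x - d x y \<le> g y"
      unfolding g_def[of y]
    proof (rule cINF_greatest)
      fix z assume "z \<in> insert None (Some ` (- U))"
      then consider "z = None" | w where "z = Some w" "w \<notin> U" by auto
      then show "g x - d x y \<le> (case z of None \<Rightarrow> 1 | Some u \<Rightarrow> d y u)"
      proof cases
        case 1 then show ?thesis using g1[of x] nonneg[of x y] by (simp add: diff_le_eq add_increasing2)
      next
        case 2 then show ?thesis using gd[of w x] triangle[of x y w] by simp
      qed
    qed simp
    then show ?thesis by simp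
  qed
  have "continuous_on UNIV g"
    unfolding continuous_on_open_vimage[OF open_UNIV]
  proof (intro allI impI)
    fix S :: "real set" assume S: "open S"
    show "open (g -` S \<inter> UNIV)"
      unfolding op
    proof
      fix x assume "x \<in> g -` S \<inter> UNIV"
      then obtain e where e: "e > 0" "\<And>z. \<bar>z - g x\<bar> < e \<Longrightarrow> z \<in> S"
        using S unfolding open_dist dist_real_def by auto
      have "y \<in> g -` S \<inter> UNIV" if "d x y < e" for y
        using e(2)[of "g y"] lip[of x y] lip[of y x] that commute[of x y] by (auto simp: abs_less_iff)
      then show "\<exists>r>0. \<forall>y. d x y < r \<longrightarrow> y \<in> g -` S \<inter> UNIV" using e(1) by blast
    qed
  qed
  moreover have "\<bar>g x\<bar> \<le> 1" for x using g0[of x] g1[of x] by simp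
  ultimately obtain G where G: "apply_bcontfun G = g" using ex_bcontfun[of g 1] by blast
  have "0 < g x" if x: "x \<in> U" for x
  proof -
    obtain r where r: "r > 0" "\<And>y. d x y < r \<Longrightarrow> y \<in> U" using U x unfolding op by blast
    have "min 1 r \<le> g x"
      unfolding g_def
    proof (rule cINF_greatest)
      fix z assume "z \<in> insert None (Some ` (- U))"
      then consider "z = None" | w where "z = Some w" "w \<notin> U" by auto
      then show "min 1 r \<le> (case z of None \<Rightarrow> 1 | Some u \<Rightarrow> d x u)"
      proof cases
        case (2 w) then show ?thesis using r(2)[of w] by (cases "d x w < r") auto
      qed simp
    qed simp
    then show ?thesis using r(1) by simp
  qed
  moreover have "g x = 0" if "x \<notin> U" for x
    using gd[OF that, of x] g0[of x] by simp
  ultimately have "U = {x. 0 < g x}" by (metis (mono_tags) less_irrefl mem_Collect_eq subsetI subset_antisym)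
  then show "\<exists>g :: 'a \<Rightarrow>\<^sub>C real. (\<forall>x. 0 \<le> apply_bcontfun g x) \<and> U = {x. 0 < apply_bcontfun g x}"
    using g0 by (intro exI[of _ G]) (simp add: G)
qed

section \<open>The Jordan decomposition of a signed measure\<close>

lemma signed_empty: "signed_borel_measure \<mu> \<Longrightarrow> \<mu> {} = 0"
  by (simp add: signed_borel_measure_def)

lemma signed_nonborel: "signed_borel_measure \<mu> \<Longrightarrow> A \<notin> sets borel \<Longrightarrow> \<mu> A = 0"
  by (simp add: signed_borel_measure_def)

lemma signed_sums:
  "signed_borel_measure \<mu> \<Longrightarrow> range A \<subseteq> sets borel \<Longrightarrow> disjoint_family A \<Longrightarrow>
    (\<lambda>n :: nat. \<mu> (A n)) sums \<mu> (\<Union>n. A n)"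
  by (simp add: signed_borel_measure_def)

lemma signed_Un:
  assumes "signed_borel_measure \<mu>" "A \<in> sets borel" "B \<in> sets borel" "A \<inter> B = {}"
  shows "\<mu> (A \<union> B) = \<mu> A + \<mu> B"
proof -
  have "(\<lambda>n. \<mu> (binaryset A B n)) sums \<mu> (\<Union>n. binaryset A B n)"
    by (rule signed_sums[OF assms(1)])
       (use assms in \<open>auto simp: range_binaryset_eq disjoint_family_on_def binaryset_def\<close>)
  moreover have "(\<lambda>n. \<mu> (binaryset A B n)) sums (\<mu> A + \<mu> B)"
    by (rule binaryset_sums) (rule signed_empty[OF assms(1)])
  ultimately show ?thesis by (simp add: UN_binaryset_eq sums_unique2)
qed

lemma signed_Diff:
  assumes "signed_borel_measure \<mu>" "A \<in> sets borel" "B \<in> sets borel" "A \<subseteq> B"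
  shows "\<mu> (B - A) = \<mu> B - \<mu> A"
  using signed_Un[OF assms(1,2) sets.Diff[OF assms(3,2)]] assms(4)
  by (simp add: Un_absorb1 Diff_partition)

lemma signed_uminus: "signed_borel_measure \<mu> \<Longrightarrow> signed_borel_measure (\<lambda>A. - \<mu> A)"
  by (simp add: signed_borel_measure_def sums_minus)

lemma signed_diff:
  "signed_borel_measure \<mu> \<Longrightarrow> signed_borel_measure \<nu> \<Longrightarrow> signed_borel_measure (\<lambda>A. \<mu> A - \<nu> A)"
  by (simp add: signed_borel_measure_def sums_diff)

text \<open>Otherwise one could split off, again and again, a set of measure at least \<open>1\<close> in absolute
  value while keeping a remainder on which \<open>\<mu>\<close> is unbounded.\<close>

lemma signed_bounded:
  fixes \<mu> :: "'a::topological_space set \<Rightarrow> real"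
  assumes \<mu>: "signed_borel_measure \<mu>"
  obtains c where "\<And>A. \<bar>\<mu> A\<bar> \<le> c"
proof -
  define bad where "bad A \<longleftrightarrow> A \<in> sets borel \<and> \<not> (\<exists>c. \<forall>B\<in>sets borel. B \<subseteq> A \<longrightarrow> \<bar>\<mu> B\<bar> \<le> c)" for A
  have bad_borel: "A \<in> sets borel" if "bad A" for A using that by (simp add: bad_def)
  have bad_big: "\<exists>B\<in>sets borel. B \<subseteq> A \<and> c < \<bar>\<mu> B\<bar>" if "bad A" for A c
    using that unfolding bad_def by (metis not_le)
  have badI: "bad A" if "A \<in> sets borel" "\<And>c. \<exists>B\<in>sets borel. B \<subseteq> A \<and> c < \<bar>\<mu> B\<bar>" for A
    using that unfolding bad_def by (metis not_le)
  have step: "\<exists>A'. bad A' \<and> A' \<subseteq> A \<and> 1 \<le> \<bar>\<mu> (A - A')\<bar>" if A: "bad A" for A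
  proof -
    \<comment> \<open>The margin \<open>\<bar>\<mu> A\<bar> + 1\<close> makes both \<open>B\<close>
      and \<open>A - B\<close> have measure at least 1 in absolute value, so either may be split off
      and a bad one kept.\<close>
    obtain B where B: "B \<in> sets borel" "B \<subseteq> A" "\<bar>\<mu> A\<bar> + 1 < \<bar>\<mu> B\<bar>"
      using bad_big[OF A] by blast
    have AB: "A \<in> sets borel" "A - B \<in> sets borel" using bad_borel[OF A] B(1) by auto
    have "\<mu> (A - B) = \<mu> A - \<mu> B" by (rule signed_Diff[OF \<mu> B(1) AB(1) B(2)])
    then have big: "1 \<le> \<bar>\<mu> (A - B)\<bar>" "1 \<le> \<bar>\<mu> B\<bar>" using B(3) by auto
    have "bad B \<or> bad (A - B)"
    proof (rule ccontr)
      assume "\<not> (bad B \<or> bad (A - B))"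
      then have "\<not> bad B" "\<not> bad (A - B)" by auto
      then obtain b c where b: "\<And>E. E \<in> sets borel \<Longrightarrow> E \<subseteq> B \<Longrightarrow> \<bar>\<mu> E\<bar> \<le> b"
        and c: "\<And>E. E \<in> sets borel \<Longrightarrow> E \<subseteq> A - B \<Longrightarrow> \<bar>\<mu> E\<bar> \<le> c"
        using badI[OF B(1)] badI[OF AB(2)] by (metis not_le)
      have "\<bar>\<mu> E\<bar> \<le> b + c" if E: "E \<in> sets borel" "E \<subseteq> A" for E
      proof -
        have "\<mu> (E - E \<inter> B) = \<mu> E - \<mu> (E \<inter> B)"
          by (rule signed_Diff[OF \<mu>]) (use E B in auto)
        moreover have "\<bar>\<mu> (E \<inter> B)\<bar> \<le> b" by (rule b) (use E B in auto)
        moreover have "\<bar>\<mu> (E - E \<inter> B)\<bar> \<le> c" by (rule c) (use E B in auto)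
        ultimately show ?thesis by linarith
      qed
      then show False using bad_big[OF A, of "b + c"] by (metis not_le)
    qed
    then show ?thesis
    proof
      assume "bad B" then show ?thesis using B big by blast
    next
      assume "bad (A - B)"
      moreover have "A - (A - B) = B" using B(2) by blast
      ultimately show ?thesis using big by (intro exI[of _ "A - B"]) auto
    qed
  qed
  have "\<not> bad UNIV"
  proof
    assume "bad UNIV"
    then obtain A where A: "\<And>n :: nat. bad (A n)" "\<And>n. A (Suc n) \<subseteq> A n \<and> 1 \<le> \<bar>\<mu> (A n - A (Suc n))\<bar>"
      using dependent_nat_choice[of "\<lambda>n. bad" "\<lambda>n A A'. A' \<subseteq> A \<and> 1 \<le> \<bar>\<mu> (A - A')\<bar>"] step
      by metis
    \<comment> \<open>The complements increase, and their successive differences are the sets split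
      off.\<close>
    have "disjoint_family (\<lambda>n. - A (Suc n) - - A n)"
      by (rule disjoint_family_Suc) (use A(2) in auto)
    then have "disjoint_family (\<lambda>n. A n - A (Suc n))"
      by (auto simp: disjoint_family_on_def)
    then have "(\<lambda>n. \<mu> (A n - A (Suc n))) sums \<mu> (\<Union>n. A n - A (Suc n))"
      by (intro signed_sums[OF \<mu>]) (use A(1) bad_borel in auto)
    then have "(\<lambda>n. \<mu> (A n - A (Suc n))) \<longlonglongrightarrow> 0"
      by (intro summable_LIMSEQ_zero sums_summable)
    from LIMSEQ_D[OF this, of 1] obtain n where "\<bar>\<mu> (A n - A (Suc n))\<bar> < 1" by auto
    with A(2)[of n] show False by simp
  qed
  then obtain c where c: "\<And>B. B \<in> sets borel \<Longrightarrow> \<bar>\<mu> B\<bar> \<le> c" using badI[of UNIV] by (metis not_le sets.top space_borel subset_UNIV)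
  have "\<bar>\<mu> A\<bar> \<le> c" for A
    using c[of A] c[of "{}"] signed_nonborel[OF \<mu>, of A] by (cases "A \<in> sets borel") auto
  then show thesis by (rule that)
qed

section \<open>Variations as measures\<close>

context
  fixes \<mu> :: "'a::topological_space set \<Rightarrow> real"
  assumes \<mu>: "signed_borel_measure \<mu>"
begin

lemma pos_variation_upper:
  assumes "B \<in> sets borel" "B \<subseteq> A"
  shows "\<mu> B \<le> pos_variation \<mu> A"
proof -
  obtain c where "\<And>A. \<bar>\<mu> A\<bar> \<le> c" using signed_bounded[OF \<mu>] by blast
  then have "bdd_above (\<mu> ` {B \<in> sets borel. B \<subseteq> A})"
    by (intro bdd_aboveI[of _ c]) (auto simp: abs_le_iff)
  then show ?thesis unfolding pos_variation_def by (rule cSUP_upper[rotated]) (use assms in auto)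
qed

lemma pos_variation_least:
  assumes "\<And>B. B \<in> sets borel \<Longrightarrow> B \<subseteq> A \<Longrightarrow> \<mu> B \<le> c"
  shows "pos_variation \<mu> A \<le> c"
  unfolding pos_variation_def by (rule cSUP_least) (use assms in auto)

lemma pos_variation_nonneg: "0 \<le> pos_variation \<mu> A"
  using pos_variation_upper[of "{}" A] signed_empty[OF \<mu>] by simp

lemma pos_variation_mono: "A \<subseteq> B \<Longrightarrow> pos_variation \<mu> A \<le> pos_variation \<mu> B"
  by (rule pos_variation_least) (auto intro: pos_variation_upper)

lemma pos_variation_empty: "pos_variation \<mu> {} = 0"
  using pos_variation_nonneg[of "{}"] pos_variation_least[of "{}" 0] signed_empty[OF \<mu>] by auto

lemma pos_variation_superadd:
  assumes "A \<inter> B = {}"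
  shows "pos_variation \<mu> A + pos_variation \<mu> B \<le> pos_variation \<mu> (A \<union> B)"
proof -
  have "pos_variation \<mu> A \<le> pos_variation \<mu> (A \<union> B) - \<mu> C" if C: "C \<in> sets borel" "C \<subseteq> B" for C
  proof (rule pos_variation_least)
    fix E assume E: "E \<in> sets borel" "E \<subseteq> A"
    have "\<mu> (E \<union> C) = \<mu> E + \<mu> C" by (rule signed_Un[OF \<mu>]) (use E C assms in auto)
    moreover have "\<mu> (E \<union> C) \<le> pos_variation \<mu> (A \<union> B)"
      by (rule pos_variation_upper) (use E C in auto)
    ultimately show "\<mu> E \<le> pos_variation \<mu> (A \<union> B) - \<mu> C" by simp
  qed
  then have "\<mu> C \<le> pos_variation \<mu> (A \<union> B) - pos_variation \<mu> A"
    if "C \<in> sets borel" "C \<subseteq> B" for C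
    using that by (simp add: le_diff_eq add.commute)
  then have "pos_variation \<mu> B \<le> pos_variation \<mu> (A \<union> B) - pos_variation \<mu> A"
    by (rule pos_variation_least)
  then show ?thesis by simp
qed

text \<open>One inequality is superadditivity on finite unions with monotonicity. For the other, a
  Borel subset of the union is cut along the \<open>A i\<close>, where \<open>\<mu>\<close> is
  countably additive.\<close>

lemma pos_variation_sums:
  fixes A :: "nat \<Rightarrow> 'a set"
  assumes A: "range A \<subseteq> sets borel" "disjoint_family A"
  shows "(\<lambda>n. pos_variation \<mu> (A n)) sums pos_variation \<mu> (\<Union>n. A n)"
proof -
  let ?v = "pos_variation \<mu>"
  have fin: "(\<Sum>i<n. ?v (A i)) \<le> ?v (\<Union>i<n. A i)" for n
  proof (induction n)
    case (Suc n)
    have "A i \<inter> A n = {}" if "i < n" for i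
      using disjoint_family_onD[OF A(2), of i n] that by simp
    then have "(\<Union>i<n. A i) \<inter> A n = {}" by blast
    from pos_variation_superadd[OF this] Suc show ?case by (simp add: lessThan_Suc Un_commute)
  qed (simp add: pos_variation_nonneg)
  have le: "(\<Sum>i<n. ?v (A i)) \<le> ?v (\<Union>i. A i)" for n
    by (rule order_trans[OF fin pos_variation_mono]) auto
  have sm: "summable (\<lambda>i. ?v (A i))"
    by (rule summableI_nonneg_bounded[OF pos_variation_nonneg le])
  have "?v (\<Union>i. A i) \<le> (\<Sum>i. ?v (A i))"
  proof (rule pos_variation_least)
    fix B assume B: "B \<in> sets borel" "B \<subseteq> (\<Union>i. A i)"
    have "(\<lambda>i. \<mu> (B \<inter> A i)) sums \<mu> (\<Union>i. B \<inter> A i)"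
      by (rule signed_sums[OF \<mu>]) (use A B in \<open>auto simp: disjoint_family_on_def\<close>)
    moreover have "(\<Union>i. B \<inter> A i) = B" using B by auto
    ultimately have s: "(\<lambda>i. \<mu> (B \<inter> A i)) sums \<mu> B" by simp
    have "\<mu> (B \<inter> A i) \<le> ?v (A i)" for i
      by (rule pos_variation_upper) (use A B in auto)
    then show "\<mu> B \<le> (\<Sum>i. ?v (A i))"
      using suminf_le[OF _ sums_summable[OF s] sm] sums_unique[OF s] by simp
  qed
  moreover have "(\<Sum>i. ?v (A i)) \<le> ?v (\<Union>i. A i)"
    by (rule suminf_le_const[OF sm le])
  ultimately have "?v (\<Union>i. A i) = (\<Sum>i. ?v (A i))" by (rule antisym)
  then show ?thesis using summable_sums[OF sm] by metis
qed

lemma sets_pos_part [simp, measurable_cong]: "sets (pos_part \<mu>) = sets borel"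
  unfolding pos_part_def by (metis sets.sigma_sets_eq sets_measure_of_conv space_borel sets.space_closed)

lemma emeasure_pos_part:
  assumes "A \<in> sets borel" shows "emeasure (pos_part \<mu>) A = ennreal (pos_variation \<mu> A)"
  unfolding pos_part_def
proof (rule emeasure_measure_of_sigma[OF _ _ _ assms])
  show "sigma_algebra UNIV (sets borel)" using sets.sigma_algebra_axioms[of borel] by simp
  show "positive (sets borel) (\<lambda>A. ennreal (pos_variation \<mu> A))"
    by (simp add: positive_def pos_variation_empty)
  show "countably_additive (sets borel) (\<lambda>A. ennreal (pos_variation \<mu> A))"
    unfolding countably_additive_def
    using suminf_ennreal_eq[OF pos_variation_nonneg pos_variation_sums] by blast
qed

lemma measure_pos_part:
  assumes "A \<in> sets borel" shows "measure (pos_part \<mu>) A = pos_variation \<mu> A"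
  by (simp add: measure_def emeasure_pos_part[OF assms] pos_variation_nonneg)

lemma space_pos_part [simp]: "space (pos_part \<mu>) = UNIV"
  using sets_eq_imp_space_eq[OF sets_pos_part] by simp

lemma finite_measure_pos_part: "finite_measure (pos_part \<mu>)"
  by (rule finite_measureI) (simp add: emeasure_pos_part)

end

text \<open>Passing from \<open>B\<close> to \<open>A - B\<close> exchanges the two suprema, because
  \<open>\<mu> B = \<mu> A - \<mu> (A - B)\<close>.\<close>

lemma jordan_decomposition:
  assumes \<mu>: "signed_borel_measure \<mu>" and A: "A \<in> sets borel"
  shows "\<mu> A = pos_variation \<mu> A - pos_variation (\<lambda>B. - \<mu> B) A"
proof -
  note \<mu>' = signed_uminus[OF \<mu>]
  have "pos_variation \<mu> A \<le> \<mu> A + pos_variation (\<lambda>B. - \<mu> B) A"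
  proof (rule pos_variation_least[OF \<mu>])
    fix B assume B: "B \<in> sets borel" "B \<subseteq> A"
    have "- \<mu> (A - B) \<le> pos_variation (\<lambda>B. - \<mu> B) A"
      by (rule pos_variation_upper[OF \<mu>']) (use A B in auto)
    then show "\<mu> B \<le> \<mu> A + pos_variation (\<lambda>B. - \<mu> B) A"
      using signed_Diff[OF \<mu> B(1) A B(2)] by simp
  qed
  moreover have "pos_variation (\<lambda>B. - \<mu> B) A \<le> pos_variation \<mu> A - \<mu> A"
  proof (rule pos_variation_least[OF \<mu>'])
    fix B assume B: "B \<in> sets borel" "B \<subseteq> A"
    have "\<mu> (A - B) \<le> pos_variation \<mu> A"
      by (rule pos_variation_upper[OF \<mu>]) (use A B in auto)
    then show "- \<mu> B \<le> pos_variation \<mu> A - \<mu> A"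
      using signed_Diff[OF \<mu> B(1) A B(2)] by simp
  qed
  ultimately show ?thesis by simp
qed

section \<open>Integration with respect to signed measures\<close>

lemma finite_borel_measure_integrable:
  assumes "finite_measure M" "sets M = sets borel" "u \<in> borel_measurable borel" "\<And>x. \<bar>u x\<bar> \<le> (b :: real)"
  shows "integrable M u"
proof (rule finite_measure.integrable_const_bound[OF assms(1)])
  show "AE x in M. norm (u x) \<le> b" using assms(4) by (intro AE_I2) simp
  show "u \<in> borel_measurable M" using assms(3) measurable_cong_sets[OF assms(2) refl] by blast
qed

lemma borel_measurable_apply_bcontfun [measurable]:
  "apply_bcontfun f \<in> borel_measurable borel" for f :: "'a::topological_space \<Rightarrow>\<^sub>C real"
  by (simp add: borel_measurable_continuous_onI)

lemma finite_borel_measure_integrable_bcontfun: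
  "finite_measure M \<Longrightarrow> sets M = sets borel \<Longrightarrow> integrable M (apply_bcontfun f)"
  for f :: "'a::topological_space \<Rightarrow>\<^sub>C real"
  by (rule finite_borel_measure_integrable[where b = "norm f"]) (auto simp: abs_apply_le_norm)

text \<open>The Jordan parts of a difference of signed measures are not the obvious sums of the
  given parts. Only a linear relation between several measures is available, and this carries such a
  relation over to integrals.\<close>

lemma integral_combination_nonneg:
  fixes M :: "'i \<Rightarrow> 'a::topological_space measure" and u :: "'a \<Rightarrow> real"
  assumes fin: "\<And>i. i \<in> J \<Longrightarrow> finite_measure (M i)" and sets: "\<And>i. i \<in> J \<Longrightarrow> sets (M i) = sets borel"
    and eq: "\<And>A. A \<in> sets borel \<Longrightarrow> (\<Sum>i\<in>J. c i * measure (M i) A) = 0"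
    and u: "u \<in> borel_measurable borel" "\<And>x. 0 \<le> u x" and bdd: "\<And>x. u x \<le> b"
  shows "(\<Sum>i\<in>J. c i * (LINT x|M i. u x)) = 0"
proof -
  have space: "space (M i) = UNIV" if "i \<in> J" for i
    using sets_eq_imp_space_eq[OF sets[OF that]] by simp
  \<comment> \<open>Boundedness provides integrability. The bound is quantified inside the claim
    because scaling by \<open>k\<close> needs it at \<open>b / k\<close>.\<close>
  have "\<forall>b. (\<forall>x. u x \<le> b) \<longrightarrow> (\<Sum>i\<in>J. c i * (LINT x|M i. u x)) = 0"
    using u
  proof (induction rule: borel_measurable_induct_real)
    case (set A)
    have "(\<Sum>i\<in>J. c i * (LINT x|M i. indicator A x)) = (\<Sum>i\<in>J. c i * measure (M i) A)"
      by (rule sum.cong) (auto simp: space)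
    with eq[OF set] show ?case by simp
  next
    case (mult u k)
    show ?case
    proof (cases "k = 0")
      case False
      then have "k > 0" using mult(1) by simp
      show ?thesis
      proof (intro allI impI)
        fix b assume "\<forall>x. k * u x \<le> b"
        then have "\<forall>x. u x \<le> b / k" using \<open>k > 0\<close> by (simp add: field_simps)
        then have "(\<Sum>i\<in>J. c i * (LINT x|M i. u x)) = 0" using mult.IH by blast
        then have "k * (\<Sum>i\<in>J. c i * (LINT x|M i. u x)) = 0" by simp
        then show "(\<Sum>i\<in>J. c i * (LINT x|M i. k * u x)) = 0"
          by (simp add: sum_distrib_left mult.left_commute)
      qed
    qed simp
  next
    case (add u v)
    show ?case
    proof (intro allI impI)
      fix b assume b: "\<forall>x. v x + u x \<le> b"
      have ub: "u x \<le> b" and vb: "v x \<le> b" for x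
        using b[rule_format, of x] add.hyps(2)[of x] add.hyps(4)[of x] by linarith+
      have "(\<Sum>i\<in>J. c i * (LINT x|M i. v x + u x)) =
          (\<Sum>i\<in>J. c i * (LINT x|M i. v x) + c i * (LINT x|M i. u x))"
      proof (rule sum.cong[OF refl])
        fix i assume i: "i \<in> J"
        have "integrable (M i) u" "integrable (M i) v"
          using add.hyps(1-4) ub vb
          by (auto intro!: finite_borel_measure_integrable[OF fin[OF i] sets[OF i], where b = b])
        then show "c i * (LINT x|M i. v x + u x) = c i * (LINT x|M i. v x) + c i * (LINT x|M i. u x)"
          by (simp add: distrib_left)
      qed
      also have "\<dots> = (\<Sum>i\<in>J. c i * (LINT x|M i. v x)) + (\<Sum>i\<in>J. c i * (LINT x|M i. u x))"
        by (rule sum.distrib)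
      also have "(\<Sum>i\<in>J. c i * (LINT x|M i. v x)) = 0" using add.IH(2) vb by blast
      also have "(\<Sum>i\<in>J. c i * (LINT x|M i. u x)) = 0" using add.IH(1) ub by blast
      finally show "(\<Sum>i\<in>J. c i * (LINT x|M i. v x + u x)) = 0" by simp
    qed
  next
    case (seq U)
    show ?case
    proof (intro allI impI)
      fix b assume b: "\<forall>x. u x \<le> b"
      have Ub: "U n x \<le> b" for n x
      proof -
        have "U n x \<le> u x"
          using seq.hyps(4)[of x] \<open>incseq U\<close>
          by (intro incseq_le) (auto simp: incseq_def le_fun_def)
        then show ?thesis using b by (meson order_trans)
      qed
      have "(\<lambda>n. \<Sum>i\<in>J. c i * (LINT x|M i. U n x)) \<longlonglongrightarrow> (\<Sum>i\<in>J. c i * (LINT x|M i. u x))"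
      proof (intro tendsto_sum tendsto_mult tendsto_const)
        fix i assume i: "i \<in> J"
        note [measurable_cong] = sets[OF i]
        show "(\<lambda>n. LINT x|M i. U n x) \<longlonglongrightarrow> (LINT x|M i. u x)"
        proof (rule integral_dominated_convergence[where w = "\<lambda>_. b"])
          show "integrable (M i) (\<lambda>_. b)"
            by (rule finite_borel_measure_integrable[OF fin[OF i] sets[OF i], where b = "\<bar>b\<bar>"]) auto
        qed (use u seq.hyps Ub in \<open>auto simp: measurable_cong_sets[OF sets[OF i] refl]\<close>)
      qed
      moreover have "(\<Sum>i\<in>J. c i * (LINT x|M i. U n x)) = 0" for n
        using seq.IH[of n] Ub by blast
      ultimately show "(\<Sum>i\<in>J. c i * (LINT x|M i. u x)) = 0"
        by (simp add: LIMSEQ_const_iff)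
    qed
  qed
  then show ?thesis using bdd by blast
qed

text \<open>Adding \<open>norm f\<close> makes the integrand nonnegative; the added constant
  contributes a multiple of the relation at \<open>UNIV\<close>, which is 0.\<close>

lemma integral_combination:
  fixes M :: "'i \<Rightarrow> 'a::topological_space measure" and f :: "'a \<Rightarrow>\<^sub>C real"
  assumes fin: "\<And>i. i \<in> J \<Longrightarrow> finite_measure (M i)" and sets: "\<And>i. i \<in> J \<Longrightarrow> sets (M i) = sets borel"
    and eq: "\<And>A. A \<in> sets borel \<Longrightarrow> (\<Sum>i\<in>J. c i * measure (M i) A) = 0"
  shows "(\<Sum>i\<in>J. c i * (LINT x|M i. apply_bcontfun f x)) = 0"
proof -
  have "(\<Sum>i\<in>J. c i * (LINT x|M i. apply_bcontfun f x + norm f)) = 0"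
  proof (rule integral_combination_nonneg[OF fin sets eq, where b = "norm f + norm f"])
    show "0 \<le> apply_bcontfun f x + norm f" "apply_bcontfun f x + norm f \<le> norm f + norm f" for x
      using abs_apply_le_norm[of f x] by auto
  qed auto
  moreover have "(LINT x|M i. apply_bcontfun f x + norm f) =
      (LINT x|M i. apply_bcontfun f x) + norm f * measure (M i) UNIV" if i: "i \<in> J" for i
  proof -
    interpret finite_measure "M i" by (rule fin[OF i])
    show ?thesis
      using sets_eq_imp_space_eq[OF sets[OF i]] finite_borel_measure_integrable_bcontfun[OF fin[OF i] sets[OF i]]
      by (subst Bochner_Integration.integral_add) auto
  qed
  ultimately have "0 = (\<Sum>i\<in>J. c i * ((LINT x|M i. apply_bcontfun f x) + norm f * measure (M i) UNIV))"
    by simp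
  also have "\<dots> = (\<Sum>i\<in>J. c i * (LINT x|M i. apply_bcontfun f x)) + norm f * (\<Sum>i\<in>J. c i * measure (M i) UNIV)"
    by (simp add: sum_distrib_left distrib_left sum.distrib mult.left_commute)
  finally show ?thesis using eq[of UNIV] by simp
qed

section \<open>Signed integrals through Jordan parts\<close>

abbreviation neg_part :: "('a::topological_space set \<Rightarrow> real) \<Rightarrow> 'a measure" where
  "neg_part \<mu> \<equiv> pos_part (\<lambda>A. - \<mu> A)"

lemma signed_eq_parts:
  assumes "signed_borel_measure \<mu>" "A \<in> sets borel"
  shows "\<mu> A = measure (pos_part \<mu>) A - measure (neg_part \<mu>) A"
  using jordan_decomposition[OF assms] measure_pos_part[OF assms(1,2)]
    measure_pos_part[OF signed_uminus[OF assms(1)] assms(2)] by simp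

lemma jordan_parts:
  assumes "signed_borel_measure \<mu>"
  shows "finite_measure (pos_part \<mu>)" "finite_measure (neg_part \<mu>)"
    "sets (pos_part \<mu>) = sets borel" "sets (neg_part \<mu>) = sets borel"
    "space (pos_part \<mu>) = UNIV" "space (neg_part \<mu>) = UNIV"
  using finite_measure_pos_part sets_pos_part space_pos_part assms signed_uminus[OF assms] by blast+

lemma signed_measure_of_finite_measures:
  fixes P N :: "'a::topological_space measure"
  assumes "finite_measure P" "finite_measure N" "sets P = sets borel" "sets N = sets borel"
  obtains \<mu> where "signed_borel_measure \<mu>"
    "\<And>f. signed_integral \<mu> f = (LINT x|P. apply_bcontfun f x) - (LINT x|N. apply_bcontfun f x)"
proof
  define \<mu> where "\<mu> A = (if A \<in> sets borel then measure P A - measure N A else 0)" for A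
  show \<mu>: "signed_borel_measure \<mu>"
    unfolding signed_borel_measure_def
  proof (intro conjI allI impI)
    fix A :: "nat \<Rightarrow> 'a set" assume A: "range A \<subseteq> sets borel \<and> disjoint_family A"
    have "(\<lambda>n. measure P (A n) - measure N (A n)) sums (measure P (\<Union>n. A n) - measure N (\<Union>n. A n))"
      using A assms by (intro sums_diff finite_measure.finite_measure_UNION) auto
    moreover have "A n \<in> sets borel" for n using A by auto
    ultimately show "(\<lambda>n. \<mu> (A n)) sums \<mu> (\<Union>n. A n)" by (simp add: \<mu>_def)
  qed (auto simp: \<mu>_def)
  fix f :: "'a \<Rightarrow>\<^sub>C real"
  \<comment> \<open>\<open>P\<close> and \<open>N\<close> may overlap and need not be the Jordan
    parts of \<open>\<mu>\<close>. The relation used is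
    \<open>pos_part \<mu> - neg_part \<mu> - P + N = 0\<close> on Borel sets.\<close>
  let ?M = "\<lambda>i. [pos_part \<mu>, neg_part \<mu>, P, N] ! i" and ?c = "\<lambda>i. [1, - 1, - 1, 1 :: real] ! i"
  have "(\<Sum>i<4. ?c i * (LINT x|?M i. apply_bcontfun f x)) = 0"
  proof (rule integral_combination)
    fix A :: "'a set" assume A: "A \<in> sets borel"
    show "(\<Sum>i<4. ?c i * measure (?M i) A) = 0"
      using signed_eq_parts[OF \<mu> A] A by (simp add: \<mu>_def numeral_eq_Suc)
  next
    fix i :: nat assume "i \<in> {..<4}"
    then have i: "i = 0 \<or> i = 1 \<or> i = 2 \<or> i = 3" by auto
    show "finite_measure (?M i)" "sets (?M i) = sets borel"
      using i assms jordan_parts[OF \<mu>] by (elim disjE; simp add: numeral_eq_Suc)+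
  qed
  then show "signed_integral \<mu> f = (LINT x|P. apply_bcontfun f x) - (LINT x|N. apply_bcontfun f x)"
    by (simp add: signed_integral_def numeral_eq_Suc)
qed

lemma signed_integral_measure_diff:
  fixes f :: "'a::topological_space \<Rightarrow>\<^sub>C real"
  assumes \<mu>: "signed_borel_measure \<mu>" and \<nu>: "signed_borel_measure \<nu>"
  shows "signed_integral (\<lambda>A. \<mu> A - \<nu> A) f = signed_integral \<mu> f - signed_integral \<nu> f"
proof -
  let ?\<rho> = "\<lambda>A. \<mu> A - \<nu> A"
  note \<rho> = signed_diff[OF \<mu> \<nu>]
  let ?M = "\<lambda>i. [pos_part ?\<rho>, neg_part ?\<rho>, pos_part \<mu>, neg_part \<mu>, pos_part \<nu>, neg_part \<nu>] ! i"
    and ?c = "\<lambda>i. [1, - 1, - 1, 1, 1, - 1 :: real] ! i"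
  have "(\<Sum>i<6. ?c i * (LINT x|?M i. apply_bcontfun f x)) = 0"
  proof (rule integral_combination)
    fix A :: "'a set" assume A: "A \<in> sets borel"
    show "(\<Sum>i<6. ?c i * measure (?M i) A) = 0"
      using signed_eq_parts[OF \<mu> A] signed_eq_parts[OF \<nu> A] signed_eq_parts[OF \<rho> A]
      by (simp add: numeral_eq_Suc)
  next
    fix i :: nat assume "i \<in> {..<6}"
    then have i: "i = 0 \<or> i = 1 \<or> i = 2 \<or> i = 3 \<or> i = 4 \<or> i = 5" by auto
    show "finite_measure (?M i)" "sets (?M i) = sets borel"
      using i jordan_parts[OF \<mu>] jordan_parts[OF \<nu>] jordan_parts[OF \<rho>]
      by (elim disjE; simp add: numeral_eq_Suc)+
  qed
  then show ?thesis by (simp add: signed_integral_def numeral_eq_Suc)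
qed

lemma linear_signed_integral:
  assumes \<mu>: "signed_borel_measure \<mu>"
  shows "linear (signed_integral \<mu>)"
proof (rule linearI)
  have int: "integrable (pos_part \<mu>) (apply_bcontfun f)" "integrable (neg_part \<mu>) (apply_bcontfun f)"
    for f :: "'a \<Rightarrow>\<^sub>C real"
    by (auto intro!: finite_borel_measure_integrable_bcontfun jordan_parts[OF \<mu>])
  show "signed_integral \<mu> (f + g) = signed_integral \<mu> f + signed_integral \<mu> g" for f g
    by (simp add: signed_integral_def int)
  show "signed_integral \<mu> (r *\<^sub>R f) = r *\<^sub>R signed_integral \<mu> f" for r f
    by (simp add: signed_integral_def right_diff_distrib)
qed

text \<open>The limit \<open>g\<close> is merely Borel, such as an indicator, hence the two separate
  integrals in place of \<open>signed_integral\<close>.\<close>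

lemma signed_integral_dominated_convergence:
  fixes f :: "nat \<Rightarrow> 'a::topological_space \<Rightarrow>\<^sub>C real" and g :: "'a \<Rightarrow> real"
  assumes \<mu>: "signed_borel_measure \<mu>" and g: "g \<in> borel_measurable borel"
    and b: "\<And>n x. \<bar>apply_bcontfun (f n) x\<bar> \<le> b"
    and lim: "\<And>x. (\<lambda>n. apply_bcontfun (f n) x) \<longlonglongrightarrow> g x"
  shows "(\<lambda>n. signed_integral \<mu> (f n)) \<longlonglongrightarrow> (LINT x|pos_part \<mu>. g x) - (LINT x|neg_part \<mu>. g x)"
proof -
  have conv: "(\<lambda>n. LINT x|M. apply_bcontfun (f n) x) \<longlonglongrightarrow> (LINT x|M. g x)"
    if M: "finite_measure M" "sets M = sets borel" for M :: "'a measure"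
  proof (rule integral_dominated_convergence[where w = "\<lambda>_. b"])
    show "integrable M (\<lambda>_. b)"
      by (rule finite_borel_measure_integrable[OF M, where b = "\<bar>b\<bar>"]) auto
  qed (use g b lim in \<open>auto simp: measurable_cong_sets[OF M(2) refl]\<close>)
  then show ?thesis
    unfolding signed_integral_def by (intro tendsto_diff conv jordan_parts[OF \<mu>])
qed

text \<open>Continuous functions increasing to the indicator of an open set determine the measure
  there; open sets are stable under intersection, so agreement extends to the Borel sets. Elsewhere
  both set functions are 0 by normalisation.\<close>

lemma signed_measure_eqI:
  fixes \<mu> \<nu> :: "'a::topological_space set \<Rightarrow> real"
  assumes pn: "perfectly_normal TYPE('a)"
    and \<mu>: "signed_borel_measure \<mu>" and \<nu>: "signed_borel_measure \<nu>"
    and eq: "\<And>f. signed_integral \<mu> f = signed_integral \<nu> f"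
  shows "\<mu> = \<nu>"
proof
  fix A
  have op: "\<mu> U = \<nu> U" if U: "open U" for U
  proof -
    obtain g :: "'a \<Rightarrow>\<^sub>C real" where g: "\<And>x. 0 \<le> apply_bcontfun g x" "U = {x. 0 < apply_bcontfun g x}"
      using pn U unfolding perfectly_normal_def by blast
    define f where "f n = bmin (const_bcontfun 1) (real n *\<^sub>R g)" for n
    have lim: "(\<lambda>n. apply_bcontfun (f n) x) \<longlonglongrightarrow> indicator U x" for x
    proof (cases "x \<in> U")
      case True
      then have "0 < apply_bcontfun g x" by (simp add: g)
      then obtain N where N: "1 < real N * apply_bcontfun g x" using reals_Archimedean3 by blast
      have "apply_bcontfun (f n) x = 1" if "n \<ge> N" for n
      proof -
        have "real N * apply_bcontfun g x \<le> real n * apply_bcontfun g x"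
          using that g(1) by (intro mult_right_mono) auto
        then show ?thesis using N by (simp add: f_def)
      qed
      then show ?thesis using True by (intro tendsto_eventually) (auto simp: eventually_sequentially)
    next
      case False
      then have "apply_bcontfun g x = 0" using g(1)[of x] by (auto simp: g(2))
      then show ?thesis using False by (simp add: f_def)
    qed
    have conv: "(\<lambda>n. signed_integral \<rho> (f n)) \<longlonglongrightarrow> \<rho> U" if \<rho>: "signed_borel_measure \<rho>" for \<rho>
    proof -
      have "(\<lambda>n. signed_integral \<rho> (f n)) \<longlonglongrightarrow>
          (LINT x|pos_part \<rho>. indicator U x) - (LINT x|neg_part \<rho>. indicator U x)"
        by (rule signed_integral_dominated_convergence[OF \<rho> _ _ lim, where b = 1])
           (use U g(1) in \<open>auto simp: f_def min_def\<close>)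
      then show ?thesis
        using signed_eq_parts[OF \<rho>, of U] U by (simp add: space_pos_part[OF \<rho>] space_pos_part[OF signed_uminus[OF \<rho>]])
    qed
    show ?thesis using LIMSEQ_unique[OF conv[OF \<mu>]] conv[OF \<nu>] by (simp add: eq)
  qed
  show "\<mu> A = \<nu> A"
  proof (cases "A \<in> sets borel")
    case True
    have "Int_stable {S :: 'a set. open S}" by (auto simp: Int_stable_def)
    moreover have "{S :: 'a set. open S} \<subseteq> Pow UNIV" by simp
    moreover have "A \<in> sigma_sets UNIV {S. open S}" using True by (simp add: sets_borel)
    ultimately show ?thesis
    proof (induction rule: sigma_sets_induct_disjoint)
      case (basic A) then show ?case using op by simp
    next
      case empty then show ?case by (simp add: signed_empty \<mu> \<nu>)
    next
      case (compl A)
      then have "A \<in> sets borel" by (simp add: sets_borel)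
      then show ?case using signed_Diff[OF \<mu>, of A UNIV] signed_Diff[OF \<nu>, of A UNIV] compl op[of UNIV] by simp
    next
      case (union A)
      then have "range A \<subseteq> sets borel" by (auto simp: sets_borel)
      then have "(\<lambda>n. \<mu> (A n)) sums \<mu> (\<Union>n. A n)" "(\<lambda>n. \<nu> (A n)) sums \<nu> (\<Union>n. A n)"
        using union signed_sums \<mu> \<nu> by blast+
      then show ?case using union by (simp add: sums_unique2)
    qed
  qed (simp add: signed_nonborel \<mu> \<nu>)
qed

text \<open>By Lindelof, countably many members of \<open>D\<close> have the same union.
  Directedness puts each finite union of them inside a member \<open>W n\<close> of
  \<open>D\<close>, and monotonicity squeezes the variation of every
  \<open>V \<supseteq> W n\<close> between that of the finite union and that of
  \<open>\<Union>D\<close>.\<close>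

lemma signed_tau_additive:
  fixes \<mu> :: "'a::topological_space set \<Rightarrow> real"
  assumes sc: "second_countable (euclidean :: 'a topology)" and \<mu>: "signed_borel_measure \<mu>"
  shows "tau_additive \<mu>"
  unfolding tau_additive_def
proof (intro allI impI, elim conjE)
  fix D :: "'a set set"
  assume D: "D \<noteq> {}" "\<forall>U\<in>D. open U" and dir: "\<forall>U\<in>D. \<forall>V\<in>D. \<exists>W\<in>D. U \<subseteq> W \<and> V \<subseteq> W"
  let ?v = "total_variation \<mu>"
  note \<mu>' = signed_uminus[OF \<mu>]
  have mono: "?v A \<le> ?v B" if "A \<subseteq> B" for A B
    unfolding total_variation_def by (intro add_mono pos_variation_mono[OF \<mu>] pos_variation_mono[OF \<mu>'] that)
  obtain E where E: "countable E" "E \<subseteq> D" "\<Union>E = \<Union>D"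
    by (rule Lindelof_open_cover[OF sc, of D]) (use D(2) in auto)
  obtain U0 where U0: "U0 \<in> D" using D(1) by blast
  \<comment> \<open>\<open>E\<close> may be empty, when \<open>\<Union>D\<close> is;
    \<open>U0\<close> makes the set enumerable without changing the union.\<close>
  define e where "e = from_nat_into (insert U0 E)"
  have e: "range e = insert U0 E" unfolding e_def using E(1) by (intro range_from_nat_into) auto
  have eD: "e n \<in> D" for n
  proof -
    have "e n \<in> insert U0 E" unfolding e[symmetric] by (rule rangeI)
    then show ?thesis using E(2) U0 by auto
  qed
  have "\<exists>W\<in>D. (\<Union>i\<le>n. e i) \<subseteq> W" for n
  proof (induction n)
    case 0 then show ?case using eD[of 0] by auto
  next
    case (Suc n)
    then obtain W where W: "W \<in> D" "(\<Union>i\<le>n. e i) \<subseteq> W" by blast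
    then obtain W' where "W' \<in> D" "W \<subseteq> W'" "e (Suc n) \<subseteq> W'" using dir eD[of "Suc n"] by meson
    then show ?case using W by (intro bexI[of _ W']) (auto simp: atMost_Suc)
  qed
  then obtain W where W: "\<And>n. W n \<in> D" "\<And>n. (\<Union>i\<le>n. e i) \<subseteq> W n" by metis
  have eb: "e i \<in> sets borel" for i using D(2) eD[of i] by (intro borel_open) blast
  have un: "(\<Union>n. \<Union>i\<le>n. e i) = \<Union>D"
  proof -
    have "(\<Union>n. \<Union>i\<le>n. e i) = (\<Union>n. e n)" by auto
    also have "\<dots> = \<Union>D" using e E(3) U0 by auto
    finally show ?thesis .
  qed
  have "(\<lambda>n. measure M (\<Union>i\<le>n. e i)) \<longlonglongrightarrow> measure M (\<Union>D)"
    if M: "finite_measure M" "sets M = sets borel" for M :: "'a measure"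
    unfolding un[symmetric]
    by (rule finite_measure.finite_Lim_measure_incseq[OF M(1)])
       (use eb in \<open>auto simp: M(2) incseq_def intro: order_trans\<close>)
  from this[OF jordan_parts(1,3)[OF \<mu>]] this[OF jordan_parts(2,4)[OF \<mu>]]
  have "(\<lambda>n. measure (pos_part \<mu>) (\<Union>i\<le>n. e i) + measure (neg_part \<mu>) (\<Union>i\<le>n. e i))
      \<longlonglongrightarrow> measure (pos_part \<mu>) (\<Union>D) + measure (neg_part \<mu>) (\<Union>D)"
    by (rule tendsto_add)
  moreover have "\<Union>D \<in> sets borel" using D(2) by (intro borel_open open_Union) auto
  moreover have "(\<Union>i\<le>n. e i) \<in> sets borel" for n using eb by auto
  ultimately have lim: "(\<lambda>n. ?v (\<Union>i\<le>n. e i)) \<longlonglongrightarrow> ?v (\<Union>D)"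
    by (simp add: total_variation_def measure_pos_part[OF \<mu>] measure_pos_part[OF \<mu>'])
  show "(?v \<longlongrightarrow> ?v (\<Union>D)) (INF U\<in>D. principal {V \<in> D. U \<subseteq> V})"
  proof (rule tendstoI)
    fix \<epsilon> :: real assume "\<epsilon> > 0"
    from LIMSEQ_D[OF lim this] obtain n where n: "\<bar>?v (\<Union>i\<le>n. e i) - ?v (\<Union>D)\<bar> < \<epsilon>" by auto
    show "\<forall>\<^sub>F V in INF U\<in>D. principal {V \<in> D. U \<subseteq> V}. dist (?v V) (?v (\<Union>D)) < \<epsilon>"
    proof (rule eventually_INF1[OF W(1)])
      have "dist (?v V) (?v (\<Union>D)) < \<epsilon>" if "V \<in> D" "W n \<subseteq> V" for V
      proof -
        have "?v (\<Union>i\<le>n. e i) \<le> ?v V" by (rule mono) (use W(2)[of n] that in blast)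
        moreover have "?v V \<le> ?v (\<Union>D)" by (rule mono) (use that in blast)
        ultimately show ?thesis using n by (simp add: dist_real_def)
      qed
      then show "eventually (\<lambda>V. dist (?v V) (?v (\<Union>D)) < \<epsilon>) (principal {V \<in> D. W n \<subseteq> V})"
        by (simp add: eventually_principal)
    qed
  qed
qed

lemma M_tau_eq_signed:
  assumes "second_countable (euclidean :: 'a::topological_space topology)"
  shows "M_tau = {\<mu> :: 'a set \<Rightarrow> real. signed_borel_measure \<mu>}"
  using signed_tau_additive[OF assms] by (auto simp: M_tau_def)

text \<open>Both positive parts are Daniell functionals, and their difference is \<open>L\<close> on
  nonnegative functions; adding the constant \<open>norm f\<close> reduces any \<open>f\<close> to
  these.\<close>

lemma sigma_smooth_imp_signed_integral:
  fixes L :: "('a::topological_space \<Rightarrow>\<^sub>C real) \<Rightarrow> real"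
  assumes pn: "perfectly_normal TYPE('a)" and L: "linear L" "sigma_smooth L"
  obtains \<mu> where "signed_borel_measure \<mu>" "L = signed_integral \<mu>"
proof -
  let ?N = "\<lambda>f. - L f"
  have N: "linear ?N" "sigma_smooth ?N"
    using L by (auto intro: linear_compose_neg sigma_smooth_uminus)
  have "daniell (positive_part K)" if "linear K" "sigma_smooth K" for K :: "('a \<Rightarrow>\<^sub>C real) \<Rightarrow> real"
    by unfold_locales
       (use that in \<open>auto intro: positive_part_nonneg positive_part_add positive_part_smooth\<close>)
  from daniell.riesz[OF this pn] obtain P N where
    P: "finite_measure P" "sets P = sets borel"
      "\<And>f. (\<And>x. 0 \<le> apply_bcontfun f x) \<Longrightarrow> positive_part L f = (LINT x|P. apply_bcontfun f x)"
    and N: "finite_measure N" "sets N = sets borel"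
      "\<And>f. (\<And>x. 0 \<le> apply_bcontfun f x) \<Longrightarrow> positive_part ?N f = (LINT x|N. apply_bcontfun f x)"
    using L N by meson
  obtain \<mu> where \<mu>: "signed_borel_measure \<mu>"
    "\<And>f. signed_integral \<mu> f = (LINT x|P. apply_bcontfun f x) - (LINT x|N. apply_bcontfun f x)"
    using signed_measure_of_finite_measures[OF P(1) N(1) P(2) N(2)] by blast
  have pos: "L f = signed_integral \<mu> f" if "\<And>x. 0 \<le> apply_bcontfun f x" for f
    using positive_part_diff[OF L that] P(3)[OF that] N(3)[OF that] \<mu>(2) by simp
  have "L f = signed_integral \<mu> f" for f
  proof -
    let ?c = "const_bcontfun (norm f)"
    have "L (f + ?c) = signed_integral \<mu> (f + ?c)"
    proof (rule pos)
      fix x show "0 \<le> apply_bcontfun (f + ?c) x" using abs_apply_le_norm[of f x] by simp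
    qed
    moreover have "L ?c = signed_integral \<mu> ?c" by (rule pos) simp
    ultimately show ?thesis
      by (simp add: linear_add[OF L(1)] linear_add[OF linear_signed_integral[OF \<mu>(1)]])
  qed
  then show thesis using that \<mu>(1) by blast
qed

section \<open>Limits of measures\<close>

text \<open>Subsets of the natural numbers become points of the Cantor space, and a countably
  additive set function becomes continuous there: partial sums depend on finitely many coordinates,
  and absolute summability makes their convergence uniform.\<close>

lemma continuous_on_subseries:
  fixes a :: "nat \<Rightarrow> real"
  assumes "summable (\<lambda>k. \<bar>a k\<bar>)"
  shows "continuous_on UNIV (\<lambda>s :: nat \<Rightarrow> bool. \<Sum>k. if s k then a k else 0)"
proof -
  have cont: "continuous_on UNIV (\<lambda>s :: nat \<Rightarrow> bool. if s k then a k else 0)" for k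
  proof -
    have "continuous_on UNIV (\<lambda>b :: bool. if b then a k else 0)"
      by (simp add: continuous_on_open_vimage open_discrete)
    then show ?thesis
      by (rule continuous_on_compose2) (auto intro: continuous_on_product_coordinates)
  qed
  have "uniform_limit UNIV (\<lambda>n s. \<Sum>k<n. if s k then a k else 0) (\<lambda>s. \<Sum>k. if s k then a k else 0) sequentially"
    by (rule Weierstrass_m_test[OF _ assms]) auto
  then show ?thesis
    by (rule uniform_limit_theorem[rotated])
       (auto intro!: always_eventually continuous_on_sum cont)
qed

text \<open>Some \<open>E n\<close> has nonempty interior in this compact Hausdorff space. A basic
  open set restricts finitely many coordinates, and \<open>K\<close> is taken beyond all of
  them.\<close>

lemma Baire_Cantor_space:
  fixes E :: "nat \<Rightarrow> (nat \<Rightarrow> bool) set"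
  assumes closed: "\<And>n. closed (E n)" and cover: "(\<Union>n. E n) = UNIV"
  obtains n K p where "\<And>s. (\<And>k. k < K \<Longrightarrow> s k = p k) \<Longrightarrow> s \<in> E n"
proof -
  let ?X = "euclidean :: (nat \<Rightarrow> bool) topology"
  have X: "?X = product_topology (\<lambda>_. euclidean) UNIV" by (rule euclidean_product_topology[symmetric])
  have "compact_space (euclidean :: bool topology)"
    unfolding compact_space_def by (simp add: finite_imp_compact)
  then have "compact_space ?X" unfolding X by (simp add: compact_space_product_topology)
  moreover have "Hausdorff_space (euclidean :: bool topology)"
    unfolding Hausdorff_space_def
  proof (intro allI impI)
    fix x y :: bool assume "x \<in> topspace euclidean \<and> y \<in> topspace euclidean \<and> x \<noteq> y"
    then show "\<exists>U V. openin euclidean U \<and> openin euclidean V \<and> x \<in> U \<and> y \<in> V \<and> disjnt U V"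
      by (intro exI[of _ "{x}"] exI[of _ "{y}"]) (simp add: open_discrete)
  qed
  then have "Hausdorff_space ?X"
    unfolding X by (simp add: Hausdorff_space_product_topology)
  ultimately have "locally_compact_space ?X \<and> regular_space ?X"
    by (simp add: compact_imp_locally_compact_space compact_Hausdorff_imp_regular_space)
  then have "\<not> (\<forall>T\<in>range E. closedin ?X T \<and> ?X interior_of T = {})"
    using Baire_category_alt[of ?X "range E"] cover by auto
  then obtain n where "?X interior_of (E n) \<noteq> {}" using closed by auto
  then obtain p where p: "p \<in> ?X interior_of (E n)" by blast
  have "openin (product_topology (\<lambda>_. euclidean) UNIV) (?X interior_of (E n))"
    unfolding X[symmetric] by simp
  then obtain U where U: "finite {i. U i \<noteq> (UNIV :: bool set)}" "p \<in> Pi\<^sub>E UNIV U"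
    "Pi\<^sub>E UNIV U \<subseteq> ?X interior_of (E n)"
    using p unfolding openin_product_topology_alt by force
  obtain K where K: "\<And>i. U i \<noteq> UNIV \<Longrightarrow> i < K"
    using finite_nat_set_iff_bounded[THEN iffD1, OF U(1)] by auto
  have "s \<in> E n" if "\<And>k. k < K \<Longrightarrow> s k = p k" for s
  proof -
    have "s i \<in> U i" for i
      using that[of i] K[of i] U(2) by (cases "U i = UNIV") (auto simp: PiE_iff)
    then have "s \<in> Pi\<^sub>E UNIV U" by (simp add: PiE_iff)
    then show ?thesis using U(3) interior_of_subset[of ?X "E n"] by (meson subsetD)
  qed
  then show thesis by (rule that)
qed

lemma tail_tendsto_zero:
  fixes a :: "nat \<Rightarrow> real"
  assumes "summable a"
  shows "(\<lambda>n. \<Sum>k. if n \<le> k then a k else 0) \<longlonglongrightarrow> 0"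
proof -
  have "(\<Sum>k. if n \<le> k then a k else 0) = suminf a - (\<Sum>k<n. a k)" for n
  proof -
    have "(\<lambda>k. a k - (if k \<in> {..<n} then a k else 0)) sums (suminf a - (\<Sum>k<n. a k))"
      by (intro sums_diff summable_sums assms sums_If_finite_set) simp
    moreover have "(\<lambda>k. a k - (if k \<in> {..<n} then a k else 0)) = (\<lambda>k. if n \<le> k then a k else 0)"
      by auto
    ultimately show ?thesis by (metis sums_unique)
  qed
  then show ?thesis
    using tendsto_diff[OF tendsto_const[of "suminf a"] summable_LIMSEQ[OF assms]] by simp
qed

text \<open>By Baire, one of the closed sets \<open>E n\<close> contains all \<open>s\<close> agreeing with some \<open>p\<close> below \<open>K\<close>. The
  indicator of any \<open>S \<subseteq> {K..}\<close> is a difference of two such \<open>s\<close>, so \<open>m i S\<close> converges uniformly in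
  these \<open>S\<close>.\<close>

lemma Nikodym_nat:
  fixes a :: "nat \<Rightarrow> nat \<Rightarrow> real" and m :: "nat \<Rightarrow> nat set \<Rightarrow> real"
  assumes sums: "\<And>n S. (\<lambda>k. if k \<in> S then a n k else 0) sums m n S"
    and lim: "\<And>S. (\<lambda>n. m n S) \<longlonglongrightarrow> M S"
  shows "(\<lambda>k. M {k..}) \<longlonglongrightarrow> 0"
proof -
  have abs: "summable (\<lambda>k. \<bar>a n k\<bar>)" for n
  proof -
    \<comment> \<open>Summability over the nonnegative and over the negative terms amounts to
      absolute summability.\<close>
    have "summable (\<lambda>k. (if k \<in> {k. 0 \<le> a n k} then a n k else 0) - (if k \<in> {k. a n k < 0} then a n k else 0))"
      by (intro summable_diff sums_summable[OF sums])
    then show ?thesis by (rule back_subst[of summable]) (auto simp: fun_eq_iff)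
  qed
  define \<phi> where "\<phi> n s = (\<Sum>k. if s k then a n k else 0)" for n and s :: "nat \<Rightarrow> bool"
  have \<phi>: "\<phi> n s = m n {k. s k}" for n s
    using sums_unique[OF sums[of "{k. s k}" n]] by (simp add: \<phi>_def)
  have cont: "continuous_on UNIV (\<phi> n)" for n
    unfolding \<phi>_def by (rule continuous_on_subseries[OF abs])
  show ?thesis
  proof (rule LIMSEQ_I)
    fix \<epsilon> :: real assume \<epsilon>: "\<epsilon> > 0"
    \<comment> \<open>Two points of \<open>E n\<close> are subtracted later, giving
      \<open>\<epsilon> / 2\<close>; the tail of the single measure \<open>m n\<close> takes the
      other half.\<close>
    define E where "E n = {s. \<forall>i\<ge>n. \<forall>j\<ge>n. \<bar>\<phi> i s - \<phi> j s\<bar> \<le> \<epsilon> / 4}" for n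
    have "closed (E n)" for n
    proof -
      have "E n = (\<Inter>i\<in>{n..}. \<Inter>j\<in>{n..}. {s. \<bar>\<phi> i s - \<phi> j s\<bar> \<le> \<epsilon> / 4})" by (auto simp: E_def)
      moreover have "closed {s. \<bar>\<phi> i s - \<phi> j s\<bar> \<le> \<epsilon> / 4}" for i j
        by (intro closed_Collect_le continuous_intros cont)
      ultimately show ?thesis by (auto intro!: closed_INT)
    qed
    moreover have "(\<Union>n. E n) = UNIV"
    proof -
      have "\<exists>n. s \<in> E n" for s
      proof -
        have "Cauchy (\<lambda>n. \<phi> n s)" unfolding \<phi> using lim by (intro LIMSEQ_imp_Cauchy)
        then obtain n where "\<forall>i\<ge>n. \<forall>j\<ge>n. norm (\<phi> i s - \<phi> j s) < \<epsilon> / 4"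
          using CauchyD[of "\<lambda>n. \<phi> n s" "\<epsilon> / 4"] \<epsilon> by auto
        then show ?thesis by (intro exI[of _ n]) (auto simp: E_def less_imp_le)
      qed
      then show ?thesis by blast
    qed
    ultimately obtain n K p where E: "\<And>s. (\<And>k. k < K \<Longrightarrow> s k = p k) \<Longrightarrow> s \<in> E n"
      using Baire_Cantor_space[of E] by metis
    have close: "\<bar>m i S - m j S\<bar> \<le> \<epsilon> / 2" if S: "S \<subseteq> {K..}" and ij: "n \<le> i" "n \<le> j" for S i j
    proof -
      define s1 where "s1 k = (if k < K then p k else k \<in> S)" for k
      define s0 where "s0 k = (if k < K then p k else False)" for k
      have diff: "m i S = \<phi> i s1 - \<phi> i s0" for i
      proof -
        have "(\<lambda>k. (if k \<in> {k. s1 k} then a i k else 0) - (if k \<in> {k. s0 k} then a i k else 0))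
            sums (m i {k. s1 k} - m i {k. s0 k})"
          by (intro sums_diff sums)
        moreover have "(\<lambda>k. (if k \<in> {k. s1 k} then a i k else 0) - (if k \<in> {k. s0 k} then a i k else 0)) =
            (\<lambda>k. if k \<in> S then a i k else 0)"
          using S by (auto simp: s1_def s0_def fun_eq_iff)
        ultimately show ?thesis using sums[of S i] sums_unique2 unfolding \<phi> by metis
      qed
      have "s1 \<in> E n" "s0 \<in> E n" by (auto intro!: E simp: s1_def s0_def)
      then have "\<bar>\<phi> i s1 - \<phi> j s1\<bar> \<le> \<epsilon> / 4" "\<bar>\<phi> i s0 - \<phi> j s0\<bar> \<le> \<epsilon> / 4"
        using ij by (auto simp: E_def)
      then show ?thesis unfolding diff by linarith
    qed
    have M: "\<bar>m n S - M S\<bar> \<le> \<epsilon> / 2" if S: "S \<subseteq> {K..}" for S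
    proof (rule LIMSEQ_le_const2)
      show "(\<lambda>j. \<bar>m n S - m j S\<bar>) \<longlonglongrightarrow> \<bar>m n S - M S\<bar>"
        by (intro tendsto_intros lim)
      show "\<exists>N. \<forall>j\<ge>N. \<bar>m n S - m j S\<bar> \<le> \<epsilon> / 2" using close[OF S] by blast
    qed
    have "m n {k..} = (\<Sum>j. if k \<le> j then a n j else 0)" for k
      using sums_unique[OF sums[of "{k..}" n]] by simp
    then have "(\<lambda>k. m n {k..}) \<longlonglongrightarrow> 0"
      using tail_tendsto_zero[OF summable_rabs_cancel[OF abs[of n]]] by simp
    from LIMSEQ_D[OF this, of "\<epsilon> / 2"] \<epsilon> obtain k0 where
      k0: "\<And>k. k \<ge> k0 \<Longrightarrow> \<bar>m n {k..}\<bar> < \<epsilon> / 2" by auto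
    have "norm (M {k..} - 0) < \<epsilon>" if "k \<ge> max k0 K" for k
    proof -
      have "{k..} \<subseteq> {K..}" using that by auto
      then have "\<bar>m n {k..} - M {k..}\<bar> \<le> \<epsilon> / 2" by (rule M)
      moreover have "\<bar>m n {k..}\<bar> < \<epsilon> / 2" using k0[of k] that by simp
      ultimately show ?thesis unfolding real_norm_def by linarith
    qed
    then show "\<exists>no. \<forall>k\<ge>no. norm (M {k..} - 0) < \<epsilon>" by blast
  qed
qed

text \<open>For \<open>f\<close> decreasing to \<open>0\<close>, all subseries of \<open>\<Sum>(f k - f (k + 1))\<close> converge to a continuous function,
  because the remainders are dominated by \<open>f n\<close>, which is small near any given point.\<close>

lemma decreasing_subseries:
  fixes f :: "nat \<Rightarrow> 'a::topological_space \<Rightarrow>\<^sub>C real"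
  assumes dec: "\<And>n x. apply_bcontfun (f (Suc n)) x \<le> apply_bcontfun (f n) x"
    and lim: "\<And>x. (\<lambda>n. apply_bcontfun (f n) x) \<longlonglongrightarrow> 0"
  obtains F where "\<And>S x. (\<lambda>k. if k \<in> S then apply_bcontfun (f k - f (Suc k)) x else 0) sums apply_bcontfun (F S) x"
    "\<And>k. F {k..} = f k"
proof -
  define g where "g k x = apply_bcontfun (f k) x - apply_bcontfun (f (Suc k)) x" for k x
  have g0: "0 \<le> g k x" for k x using dec by (simp add: g_def)
  have f0: "0 \<le> apply_bcontfun (f n) x" for n x
    by (rule decseq_ge[OF _ lim]) (rule decseq_SucI, rule dec)
  have gs: "(\<lambda>k. g (k + n) x) sums apply_bcontfun (f n) x" for n x
  proof -
    have "(\<lambda>k. apply_bcontfun (f (k + n)) x) \<longlonglongrightarrow> 0" by (rule LIMSEQ_ignore_initial_segment[OF lim])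
    from telescope_sums'[OF this] show ?thesis by (simp add: g_def)
  qed
  define h where "h S x = (\<Sum>k. if k \<in> S then g k x else 0)" for S x
  have gsum: "summable (\<lambda>k. g k x)" for x using sums_summable[OF gs[of 0 x]] by simp
  have hsum: "summable (\<lambda>k. if k \<in> S then g k x else 0)" for S x
    by (rule summable_comparison_test'[OF gsum, of 0]) (use g0 in auto)
  have h_le: "0 \<le> (\<Sum>k. if k + n \<in> S then g (k + n) x else 0)"
    "(\<Sum>k. if k + n \<in> S then g (k + n) x else 0) \<le> apply_bcontfun (f n) x" for S n x
  proof -
    have sm: "summable (\<lambda>k. if k + n \<in> S then g (k + n) x else 0)"
      using summable_ignore_initial_segment[OF hsum[of S x], of n] .
    show "0 \<le> (\<Sum>k. if k + n \<in> S then g (k + n) x else 0)"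
      by (rule suminf_nonneg[OF sm]) (use g0 in auto)
    show "(\<Sum>k. if k + n \<in> S then g (k + n) x else 0) \<le> apply_bcontfun (f n) x"
      unfolding sums_unique[OF gs[of n x]]
      by (rule suminf_le[OF _ sm sums_summable[OF gs]]) (use g0 in auto)
  qed
  have split: "h S x = (\<Sum>k. if k + n \<in> S then g (k + n) x else 0) + (\<Sum>k<n. if k \<in> S then g k x else 0)"
    for S n x
    unfolding h_def using suminf_split_initial_segment[OF hsum[of S x], of n] by simp
  have cont: "continuous_on UNIV (h S)" for S
    unfolding continuous_on_def
  proof (intro ballI tendstoI)
    fix x0 and \<epsilon> :: real assume \<epsilon>: "\<epsilon> > 0"
    let ?P = "\<lambda>n x. \<Sum>k<n. if k \<in> S then g k x else 0"
    obtain n where n: "apply_bcontfun (f n) x0 < \<epsilon> / 3"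
    proof -
      have "\<forall>\<^sub>F n in sequentially. apply_bcontfun (f n) x0 < \<epsilon> / 3"
        using \<epsilon> by (intro order_tendstoD[OF lim]) simp
      then show ?thesis using that by (auto simp: eventually_sequentially)
    qed
    have "(apply_bcontfun (f n) \<longlongrightarrow> apply_bcontfun (f n) x0) (at x0)"
      using continuous_on_apply_bcontfun[of UNIV "f n"] by (simp add: continuous_on_def)
    then have 1: "\<forall>\<^sub>F x in at x0. apply_bcontfun (f n) x < \<epsilon> / 3"
      using n by (rule order_tendstoD)
    have "continuous_on UNIV (\<lambda>x. if k \<in> S then g k x else 0)" for k
      by (cases "k \<in> S") (auto simp: g_def intro!: continuous_intros)
    then have "continuous_on UNIV (?P n)" by (intro continuous_on_sum)
    then have "(?P n \<longlongrightarrow> ?P n x0) (at x0)" by (simp add: continuous_on_def)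
    then have 2: "\<forall>\<^sub>F x in at x0. dist (?P n x) (?P n x0) < \<epsilon> / 3"
      using \<epsilon> by (intro tendstoD) auto
    from 1 2 show "\<forall>\<^sub>F x in at x0. dist (h S x) (h S x0) < \<epsilon>"
    proof eventually_elim
      case (elim x)
      then show ?case
        using n h_le[where n = n and S = S and x = x] h_le[where n = n and S = S and x = x0]
        unfolding split[of S x n] split[of S x0 n] dist_real_def by linarith
    qed
  qed
  have "\<bar>h S x\<bar> \<le> norm (f 0)" for S x
    using h_le[of 0 S x, unfolded add_0_right] abs_apply_le_norm[of "f 0" x]
    unfolding h_def by linarith
  then have "\<exists>F. apply_bcontfun F = h S" for S by (rule ex_bcontfun[OF cont])
  then obtain F where F: "\<And>S. apply_bcontfun (F S) = h S" by metis
  show thesis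
  proof
    show "(\<lambda>k. if k \<in> S then apply_bcontfun (f k - f (Suc k)) x else 0) sums apply_bcontfun (F S) x" for S x
      using summable_sums[OF hsum[of S x]] unfolding F h_def g_def minus_bcontfun.rep_eq .
    show "F {k..} = f k" for k
    proof (rule bcontfun_eqI)
      fix x
      have "(\<Sum>j<k. if j \<in> {k..} then g j x else 0) = 0" by (intro sum.neutral) auto
      then show "apply_bcontfun (F {k..}) x = apply_bcontfun (f k) x"
        unfolding F split[of "{k..}" x k] using sums_unique[OF gs[of k x]] by simp
    qed
  qed
qed

text \<open>The set functions \<open>S \<mapsto> \<integral>F S d\<mu> n\<close> converge for every
  \<open>S\<close> because each \<open>F S\<close> is itself a test function, and
  \<open>F {k..} = f k\<close> makes the tails in Nikodym's conclusion the values
  \<open>L (f k)\<close>.\<close>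

lemma limit_sigma_smooth:
  fixes \<mu> :: "nat \<Rightarrow> 'a::topological_space set \<Rightarrow> real"
  assumes \<mu>: "\<And>n. signed_borel_measure (\<mu> n)"
    and lim: "\<And>f. (\<lambda>n. signed_integral (\<mu> n) f) \<longlonglongrightarrow> L f"
  shows "sigma_smooth L"
  unfolding sigma_smooth_def
proof (intro allI impI, elim conjE)
  fix f :: "nat \<Rightarrow> 'a \<Rightarrow>\<^sub>C real"
  assume dec: "\<forall>n x. apply_bcontfun (f (Suc n)) x \<le> apply_bcontfun (f n) x"
    and f0: "\<forall>x. (\<lambda>n. apply_bcontfun (f n) x) \<longlonglongrightarrow> 0"
  obtain F where F: "\<And>S x. (\<lambda>k. if k \<in> S then apply_bcontfun (f k - f (Suc k)) x else 0) sums apply_bcontfun (F S) x"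
    "\<And>k. F {k..} = f k"
  proof (rule decreasing_subseries[OF dec[rule_format] f0[rule_format]])
    fix F
    assume "\<And>S x. (\<lambda>k. if k \<in> S then apply_bcontfun (f k - f (Suc k)) x else 0) sums apply_bcontfun (F S) x"
      "\<And>k. F {k..} = f k"
    then show thesis by (rule that)
  qed
  have "(\<lambda>k. if k \<in> S then signed_integral (\<mu> n) (f k - f (Suc k)) else 0) sums signed_integral (\<mu> n) (F S)"
    for n S
  proof -
    let ?p = "\<lambda>N. \<Sum>k<N. if k \<in> S then f k - f (Suc k) else 0"
    have p: "apply_bcontfun (?p N) x = (\<Sum>k<N. if k \<in> S then apply_bcontfun (f k - f (Suc k)) x else 0)" for N x
      unfolding apply_sum_bcontfun by (rule sum.cong) auto
    have nn: "0 \<le> (if k \<in> S then apply_bcontfun (f k - f (Suc k)) x else 0)" for k x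
      using dec by simp
    have "(\<lambda>N. signed_integral (\<mu> n) (?p N)) \<longlonglongrightarrow>
        (LINT x|pos_part (\<mu> n). apply_bcontfun (F S) x) - (LINT x|neg_part (\<mu> n). apply_bcontfun (F S) x)"
    proof (rule signed_integral_dominated_convergence[OF \<mu>])
      show "(\<lambda>N. apply_bcontfun (?p N) x) \<longlonglongrightarrow> apply_bcontfun (F S) x" for x
        unfolding p using F(1)[of S x] unfolding sums_def .
      \<comment> \<open>The terms are nonnegative, so partial sums lie between 0 and
        \<open>F S\<close>.\<close>
      show "\<bar>apply_bcontfun (?p N) x\<bar> \<le> norm (F S)" for N x
      proof -
        have "apply_bcontfun (?p N) x \<le> apply_bcontfun (F S) x"
          unfolding p sums_unique[OF F(1)[of S x]]
          by (rule sum_le_suminf[OF sums_summable[OF F(1)]]) (use nn in auto)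
        moreover have "0 \<le> apply_bcontfun (?p N) x" unfolding p by (intro sum_nonneg nn)
        ultimately show ?thesis using abs_apply_le_norm[of "F S" x] by simp
      qed
    qed simp
    moreover have "signed_integral (\<mu> n) (?p N) =
        (\<Sum>k<N. if k \<in> S then signed_integral (\<mu> n) (f k - f (Suc k)) else 0)" for N
      unfolding linear_sum[OF linear_signed_integral[OF \<mu>]]
      by (rule sum.cong) (auto simp: linear_0[OF linear_signed_integral[OF \<mu>]])
    ultimately show ?thesis by (simp add: sums_def signed_integral_def)
  qed
  from Nikodym_nat[OF this lim] show "(\<lambda>k. L (f k)) \<longlonglongrightarrow> 0" by (simp add: F(2))
qed

section \<open>Weights on the Stone--Cech compactification\<close>

lemma closed_if_compact_fun:
  fixes Q :: "('i \<Rightarrow> real) set"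
  assumes "compact Q" shows "closed Q"
proof -
  have "Hausdorff_space (euclidean :: ('i \<Rightarrow> real) topology)"
    unfolding euclidean_product_topology[symmetric] by (simp add: Hausdorff_space_product_topology)
  then show ?thesis
    unfolding closed_closedin by (rule compactin_imp_closedin) (use assms in simp)
qed

lemma separating_function_fun:
  fixes Q :: "('i \<Rightarrow> real) set"
  assumes "closed Q" "z0 \<notin> Q"
  obtains \<gamma> where "continuous_on UNIV \<gamma>" "\<And>z. 0 \<le> \<gamma> z" "\<And>z. \<gamma> z \<le> (1 :: real)"
    "\<And>z. z \<in> Q \<Longrightarrow> \<gamma> z = 0" "0 < \<gamma> z0"
proof -
  have "completely_regular_space (euclidean :: real topology)"
    by (simp add: metrizable_imp_completely_regular_space metrizable_space_euclidean)
  then have "completely_regular_space (euclidean :: ('i \<Rightarrow> real) topology)"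
    unfolding euclidean_product_topology[symmetric] by (simp add: completely_regular_space_product_topology)
  then obtain f :: "('i \<Rightarrow> real) \<Rightarrow> real" where f: "continuous_map euclidean (top_of_set {0..1}) f" "f z0 = 0" "f ` Q \<subseteq> {1}"
    unfolding completely_regular_space_def using assms by (metis DiffI UNIV_I closed_closedin topspace_euclidean)
  have c: "continuous_on UNIV f" and r: "f z \<in> {0..1}" for z
    using f(1) by (auto simp: continuous_map_in_subtopology)
  show thesis
  proof
    show "continuous_on UNIV (\<lambda>z. 1 - f z)" by (intro continuous_intros c)
    show "1 - f z = 0" if "z \<in> Q" for z using f(3) that by auto
  qed (use r f(2) in auto)
qed

lemma continuous_on_sc_embed: "continuous_on UNIV sc_embed"
  unfolding sc_embed_def by (intro continuous_on_coordinatewise_then_product) simp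

lemma compact_stone_cech: "compact (stone_cech :: (('a::topological_space \<Rightarrow>\<^sub>C real) \<Rightarrow> real) set)"
proof -
  let ?K = "Pi\<^sub>E UNIV (\<lambda>f :: 'a \<Rightarrow>\<^sub>C real. {- norm f..norm f})"
  have "compactin (product_topology (\<lambda>_. euclidean) UNIV) ?K" by (simp add: compactin_PiE)
  then have K: "compact ?K" by (simp add: euclidean_product_topology)
  have "range sc_embed \<subseteq> ?K"
  proof -
    have "sc_embed x \<in> ?K" for x :: 'a
      using abs_apply_le_norm[of _ x] by (auto simp: sc_embed_def PiE_iff abs_le_iff minus_le_iff)
    then show ?thesis by blast
  qed
  then have "stone_cech \<subseteq> ?K"
    unfolding stone_cech_def by (rule closure_minimal[OF _ closed_if_compact_fun[OF K]])
  then have "stone_cech = ?K \<inter> (stone_cech :: (('a \<Rightarrow>\<^sub>C real) \<Rightarrow> real) set)" by blast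
  moreover have "compact (?K \<inter> (stone_cech :: (('a \<Rightarrow>\<^sub>C real) \<Rightarrow> real) set))"
    by (rule compact_Int_closed[OF K]) (simp add: stone_cech_def)
  ultimately show ?thesis by simp
qed

lemma sc_embed_in_stone_cech [simp]: "sc_embed x \<in> stone_cech"
  unfolding stone_cech_def by (rule subsetD[OF closure_subset]) simp

section \<open>Weighted seminorms and neighbourhoods in \<open>beta_Q\<close>\<close>

definition weight_seminorm ::
    "((('a::topological_space \<Rightarrow>\<^sub>C real) \<Rightarrow> real) \<Rightarrow> real) \<Rightarrow> ('a \<Rightarrow>\<^sub>C real) \<Rightarrow> real" where
  "weight_seminorm h f = (SUP x. \<bar>h (sc_embed x) * apply_bcontfun f x\<bar>)"

lemma weight_seminorm_upper:
  assumes "continuous_on stone_cech h"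
  shows "\<bar>h (sc_embed x) * apply_bcontfun f x\<bar> \<le> weight_seminorm h f"
proof -
  have "bounded (h ` stone_cech)"
    by (intro compact_imp_bounded compact_continuous_image assms compact_stone_cech)
  then obtain B where B: "\<And>z. z \<in> stone_cech \<Longrightarrow> \<bar>h z\<bar> \<le> B"
    unfolding bounded_iff by (auto simp: image_iff)
  have "\<bar>h (sc_embed x) * apply_bcontfun f x\<bar> \<le> B * norm f" for x
    unfolding abs_mult using B[of "sc_embed x"] abs_apply_le_norm[of f x] by (intro mult_mono) auto
  then have "bdd_above (range (\<lambda>x. \<bar>h (sc_embed x) * apply_bcontfun f x\<bar>))"
    by (intro bdd_aboveI[of _ "B * norm f"]) auto
  then show ?thesis unfolding weight_seminorm_def by (intro cSUP_upper) auto
qed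

lemma weight_seminorm_least:
  "(\<And>x. \<bar>h (sc_embed x) * apply_bcontfun f x\<bar> \<le> c) \<Longrightarrow> weight_seminorm h f \<le> c"
  unfolding weight_seminorm_def by (intro cSUP_least) auto

lemma beta_Q_eq:
  "beta_Q Q = topology_generated_by {{y. weight_seminorm h (y - x) < \<epsilon>} | h x \<epsilon>.
     continuous_on stone_cech h \<and> (\<forall>z\<in>Q. h z = 0) \<and> 0 < \<epsilon>}"
proof -
  have eq: "{\<lambda>f. SUP x. \<bar>h (sc_embed x) * apply_bcontfun f x\<bar> | h. continuous_on stone_cech h \<and> (\<forall>z\<in>Q. h z = 0)} =
      weight_seminorm ` {h. continuous_on stone_cech h \<and> (\<forall>z\<in>Q. h z = 0)}"
    by (auto simp: weight_seminorm_def[abs_def])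
  then show ?thesis
    unfolding beta_Q_def seminorm_topology_def eq
    by (intro arg_cong[where f = topology_generated_by]) blast
qed

text \<open>A single weight describes a neighbourhood: \<open>\<bar>h\<bar> + \<bar>k\<bar>\<close>
  serves an intersection, and radii are absorbed by rescaling the weight.\<close>

lemma beta_Q_neighbourhood:
  fixes Q :: "(('a::topological_space \<Rightarrow>\<^sub>C real) \<Rightarrow> real) set"
  assumes "openin (beta_Q Q) U" "f0 \<in> U"
  shows "\<exists>h. continuous_on stone_cech h \<and> (\<forall>z\<in>Q. h z = 0) \<and>
    (\<forall>f. (\<forall>x. \<bar>h (sc_embed x) * apply_bcontfun (f - f0) x\<bar> \<le> 1) \<longrightarrow> f \<in> U)"
  using assms unfolding beta_Q_eq openin_topology_generated_by_iff
proof (induction rule: generate_topology_on.induct)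
  case (Int U V)
  then obtain h k where h: "continuous_on stone_cech h" "\<forall>z\<in>Q. h z = 0"
      "\<And>f. (\<forall>x. \<bar>h (sc_embed x) * apply_bcontfun (f - f0) x\<bar> \<le> 1) \<Longrightarrow> f \<in> U"
    and k: "continuous_on stone_cech k" "\<forall>z\<in>Q. k z = 0"
      "\<And>f. (\<forall>x. \<bar>k (sc_embed x) * apply_bcontfun (f - f0) x\<bar> \<le> 1) \<Longrightarrow> f \<in> V"
    by blast
  let ?l = "\<lambda>z. \<bar>h z\<bar> + \<bar>k z\<bar>"
  have "f \<in> U \<inter> V" if f: "\<forall>x. \<bar>?l (sc_embed x) * apply_bcontfun (f - f0) x\<bar> \<le> 1" for f
  proof -
    have "\<bar>h (sc_embed x) * apply_bcontfun (f - f0) x\<bar> \<le> 1 \<and> \<bar>k (sc_embed x) * apply_bcontfun (f - f0) x\<bar> \<le> 1"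
      for x
    proof -
      let ?r = "\<bar>apply_bcontfun (f - f0) x\<bar>"
      have "\<bar>h (sc_embed x)\<bar> * ?r + \<bar>k (sc_embed x)\<bar> * ?r \<le> 1"
        using f[rule_format, of x] by (simp add: abs_mult distrib_right)
      moreover have "0 \<le> \<bar>h (sc_embed x)\<bar> * ?r" "0 \<le> \<bar>k (sc_embed x)\<bar> * ?r" by simp_all
      ultimately show ?thesis unfolding abs_mult by linarith
    qed
    then show ?thesis using h(3) k(3) by blast
  qed
  moreover have "continuous_on stone_cech ?l" using h(1) k(1) by (intro continuous_intros)
  ultimately show ?case using h(2) k(2) by (intro exI[of _ ?l]) auto
next
  case (UN K)
  then obtain V where V: "V \<in> K" "f0 \<in> V" by blast
  from UN.IH[OF this] V(1) show ?case by (meson UnionI)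
next
  case (Basis U)
  then obtain h g \<epsilon> where U: "U = {y. weight_seminorm h (y - g) < \<epsilon>}"
    and h: "continuous_on stone_cech h" "\<forall>z\<in>Q. h z = 0" "0 < \<epsilon>" by blast
  \<comment> \<open>The room left at \<open>f0\<close> inside the ball. The weight is scaled to use
    only half of it, so that the final inequality is strict.\<close>
  define d where "d = \<epsilon> - weight_seminorm h (f0 - g)"
  have d: "d > 0" using Basis(2) by (simp add: U d_def)
  have "f \<in> U" if f: "\<forall>x. \<bar>(2 / d * h (sc_embed x)) * apply_bcontfun (f - f0) x\<bar> \<le> 1" for f
  proof -
    have "weight_seminorm h (f - g) \<le> d / 2 + weight_seminorm h (f0 - g)"
    proof (rule weight_seminorm_least)
      fix x
      define r where "r = h (sc_embed x) * apply_bcontfun (f - f0) x"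
      have "\<bar>2 / d * r\<bar> \<le> 1" using f[rule_format, of x] unfolding r_def mult.assoc .
      then have "\<bar>r\<bar> \<le> d / 2" using d by (simp add: abs_mult field_simps)
      then have "\<bar>h (sc_embed x) * apply_bcontfun (f - f0) x\<bar> \<le> d / 2" by (simp only: r_def)
      moreover have "\<bar>h (sc_embed x) * apply_bcontfun (f0 - g) x\<bar> \<le> weight_seminorm h (f0 - g)"
        by (rule weight_seminorm_upper[OF h(1)])
      moreover have "h (sc_embed x) * apply_bcontfun (f - g) x =
          h (sc_embed x) * apply_bcontfun (f - f0) x + h (sc_embed x) * apply_bcontfun (f0 - g) x"
        by (simp add: algebra_simps)
      ultimately show "\<bar>h (sc_embed x) * apply_bcontfun (f - g) x\<bar> \<le> d / 2 + weight_seminorm h (f0 - g)"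
        by linarith
    qed
    moreover have "d / 2 + weight_seminorm h (f0 - g) < d + weight_seminorm h (f0 - g)" using d by simp
    moreover have "d + weight_seminorm h (f0 - g) = \<epsilon>" by (simp add: d_def)
    ultimately have "weight_seminorm h (f - g) < \<epsilon>" by (metis le_less_trans)
    then show ?thesis by (simp add: U)
  qed
  moreover have "continuous_on stone_cech (\<lambda>z. 2 / d * h z)" using h(1) by (intro continuous_intros)
  ultimately show ?case using h(2) by (intro exI[of _ "\<lambda>z. 2 / d * h z"]) auto
qed simp

lemma beta_Q_continuousI:
  fixes L :: "('a::topological_space \<Rightarrow>\<^sub>C real) \<Rightarrow> real"
  assumes L: "linear L" and h: "continuous_on stone_cech h" "\<forall>z\<in>Q. h z = 0"
    and bound: "\<And>f. (\<And>x. \<bar>h (sc_embed x) * apply_bcontfun f x\<bar> \<le> 1) \<Longrightarrow> \<bar>L f\<bar> \<le> C"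
  shows "continuous_map (beta_Q Q) euclideanreal L"
proof -
  have C: "0 \<le> C" using bound[of 0] by (simp add: linear_0[OF L])
  have "openin (beta_Q Q) {f. L f \<in> S}" if S: "open S" for S
  proof (subst openin_subopen, intro ballI)
    fix f0 assume "f0 \<in> {f. L f \<in> S}"
    then obtain e where e: "e > 0" "\<And>r. \<bar>r - L f0\<bar> < e \<Longrightarrow> r \<in> S"
      using S unfolding open_dist dist_real_def by auto
    \<comment> \<open>The summand 1 covers \<open>C = 0\<close> and makes
      \<open>\<delta> * C < e\<close> strict.\<close>
    define \<delta> where "\<delta> = e / (C + 1)"
    have \<delta>: "\<delta> > 0" "\<delta> * C < e" using e(1) C by (auto simp: \<delta>_def field_simps)
    let ?T = "{f. weight_seminorm h (f - f0) < \<delta>}"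
    have "openin (beta_Q Q) ?T"
      unfolding beta_Q_eq by (rule topology_generated_by_Basis) (use h \<delta> in blast)
    moreover have "weight_seminorm h 0 \<le> 0" by (rule weight_seminorm_least) simp
    then have "f0 \<in> ?T" using \<delta> by simp
    moreover have "?T \<subseteq> {f. L f \<in> S}"
    proof
      fix f assume "f \<in> ?T"
      then have f: "\<bar>h (sc_embed x) * apply_bcontfun (f - f0) x\<bar> \<le> \<delta>" for x
        using weight_seminorm_upper[OF h(1), of x "f - f0"] by simp
      have "\<bar>L ((1 / \<delta>) *\<^sub>R (f - f0))\<bar> \<le> C"
      proof (rule bound)
        fix x show "\<bar>h (sc_embed x) * apply_bcontfun ((1 / \<delta>) *\<^sub>R (f - f0)) x\<bar> \<le> 1"
          using f[of x] \<delta>(1) by (simp add: abs_mult field_simps)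
      qed
      then have "\<bar>L (f - f0)\<bar> / \<delta> \<le> C"
        unfolding linear_cmul[OF L] using \<delta>(1) by (simp add: abs_mult)
      then have "\<bar>L (f - f0)\<bar> \<le> \<delta> * C"
        using \<delta>(1) by (simp only: pos_divide_le_eq mult.commute)
      then show "f \<in> {f. L f \<in> S}" using e(2)[of "L f"] \<delta>(2) by (simp add: linear_diff[OF L])
    qed
    ultimately show "\<exists>T. openin (beta_Q Q) T \<and> f0 \<in> T \<and> T \<subseteq> {f. L f \<in> S}" by blast
  qed
  then show ?thesis by (simp add: continuous_map_def topspace_beta_Q)
qed

text \<open>The coarsest topology making \<open>L\<close> continuous has to be locally convex to
  compete in the definition of \<open>\<beta>\<close>.\<close>

lemma locally_convex_pullback:
  fixes L :: "'v::real_vector \<Rightarrow> real"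
  assumes L: "linear L"
  shows "locally_convex (pullback_topology UNIV L euclideanreal)"
proof -
  let ?T = "pullback_topology UNIV L euclideanreal"
  have cL: "continuous_map ?T euclideanreal L"
    using continuous_map_pullback[of euclideanreal euclideanreal "\<lambda>x. x" UNIV L] by (simp add: o_def)
  have top: "topspace ?T = UNIV" by (simp add: topspace_pullback_topology)
  have "continuous_map (prod_topology ?T ?T) euclideanreal (\<lambda>z. L (fst z) + L (snd z))"
    using continuous_map_compose[OF continuous_map_fst cL] continuous_map_compose[OF continuous_map_snd cL]
    by (intro continuous_map_add) (simp_all add: o_def)
  then have "continuous_map (prod_topology ?T ?T) ?T (\<lambda>(x, y). x + y)"
    by (intro continuous_map_pullback') (simp_all add: o_def case_prod_unfold linear_add[OF L])
  moreover have "continuous_map (prod_topology euclideanreal ?T) euclideanreal (\<lambda>z. fst z * L (snd z))"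
    using continuous_map_fst continuous_map_compose[OF continuous_map_snd cL]
    by (intro continuous_map_real_mult) (simp_all add: o_def)
  then have "continuous_map (prod_topology euclideanreal ?T) ?T (\<lambda>(c, x). c *\<^sub>R x)"
    by (intro continuous_map_pullback') (simp_all add: o_def case_prod_unfold linear_cmul[OF L])
  moreover have "\<exists>V. openin ?T V \<and> convex V \<and> 0 \<in> V \<and> V \<subseteq> U" if U: "openin ?T U" "0 \<in> U" for U
  proof -
    obtain S where S: "open S" "U = L -` S" using U(1) by (auto simp: openin_pullback_topology)
    then obtain e where e: "e > 0" "ball 0 e \<subseteq> S"
      using U(2) linear_0[OF L] by (metis openE vimageE)
    have "openin ?T (L -` ball 0 e)" by (auto simp: openin_pullback_topology)
    moreover have "convex (L -` ball 0 e)" by (rule convex_linear_vimage[OF L convex_ball])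
    moreover have "0 \<in> L -` ball 0 e" using e(1) linear_0[OF L] by simp
    ultimately show ?thesis using e(2) S(2) by blast
  qed
  ultimately show ?thesis unfolding locally_convex_def using top by blast
qed

text \<open>The pullback topology of \<open>L\<close> lies below \<open>beta_Q Q\<close> exactly
  when \<open>L\<close> is continuous there. If this holds for all admissible \<open>Q\<close>, it
  lies below \<open>\<beta>\<close>, the finest such topology.\<close>

lemma continuous_dual_strict_topology:
  "continuous_dual (strict_topology :: ('a::topological_space \<Rightarrow>\<^sub>C real) topology) =
     {L. linear L \<and> (\<forall>Q. admissible Q \<longrightarrow> continuous_map (beta_Q Q) euclideanreal L)}"
proof (intro equalityI subsetI)
  fix L :: "('a \<Rightarrow>\<^sub>C real) \<Rightarrow> real"
  assume L: "L \<in> continuous_dual strict_topology"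
  have "continuous_map (beta_Q Q) euclideanreal L" if Q: "admissible Q" for Q
  proof -
    have "coarser_than strict_topology (beta_Q Q)" by (rule strict_topology_finest(2)[OF Q])
    then have "continuous_map (beta_Q Q) strict_topology (\<lambda>f. f)"
      by (auto simp: continuous_map_def coarser_than_def topspace_beta_Q)
    from continuous_map_compose[OF this] show ?thesis
      using L by (auto simp: continuous_dual_def o_def)
  qed
  then show "L \<in> {L. linear L \<and> (\<forall>Q. admissible Q \<longrightarrow> continuous_map (beta_Q Q) euclideanreal L)}"
    using L by (auto simp: continuous_dual_def)
next
  fix L :: "('a \<Rightarrow>\<^sub>C real) \<Rightarrow> real"
  assume "L \<in> {L. linear L \<and> (\<forall>Q. admissible Q \<longrightarrow> continuous_map (beta_Q Q) euclideanreal L)}"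
  then have L: "linear L" "\<And>Q. admissible Q \<Longrightarrow> continuous_map (beta_Q Q) euclideanreal L" by auto
  let ?T = "pullback_topology UNIV L euclideanreal"
  have "coarser_than ?T strict_topology"
  proof (rule strict_topology_finest(3)[OF locally_convex_pullback[OF L(1)]])
    fix Q :: "(('a \<Rightarrow>\<^sub>C real) \<Rightarrow> real) set" assume "admissible Q"
    from L(2)[OF this] show "coarser_than ?T (beta_Q Q)"
      by (auto simp: coarser_than_def topspace_pullback_topology topspace_beta_Q openin_pullback_topology
          continuous_map_def vimage_def)
  qed
  moreover have "topspace (strict_topology :: ('a \<Rightarrow>\<^sub>C real) topology) = UNIV"
    using strict_topology_finest(1)[where 'a = 'a] unfolding locally_convex_def by (rule conjunct1)
  ultimately have "continuous_map strict_topology ?T (\<lambda>f. f)"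
    by (auto simp: continuous_map_def coarser_than_def)
  moreover have "continuous_map ?T euclideanreal L"
    using continuous_map_pullback[of euclideanreal euclideanreal "\<lambda>x. x" UNIV L] by (simp add: o_def)
  ultimately have "continuous_map strict_topology euclideanreal (L \<circ> (\<lambda>f. f))"
    by (rule continuous_map_compose)
  then show "L \<in> continuous_dual strict_topology"
    using L(1) by (simp add: continuous_dual_def o_def)
qed

text \<open>Given \<open>f n\<close> decreasing to \<open>0\<close> and \<open>\<eta> > 0\<close>, the set \<open>Q\<close> of points of the compactification at which
  all \<open>f n\<close> stay above \<open>\<eta>\<close> is admissible; a weight vanishing on \<open>Q\<close> is small wherever \<open>(f n - \<eta>)\<^sup>+\<close>
  is nonzero, for large \<open>n\<close>.\<close>

lemma continuous_functional_sigma_smooth: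
  fixes L :: "('a::topological_space \<Rightarrow>\<^sub>C real) \<Rightarrow> real"
  assumes L: "linear L"
    and cont: "\<And>Q. admissible Q \<Longrightarrow> continuous_map (beta_Q Q) euclideanreal L"
  shows "sigma_smooth L"
  unfolding sigma_smooth_def
proof (intro allI impI, elim conjE)
  fix f :: "nat \<Rightarrow> 'a \<Rightarrow>\<^sub>C real"
  assume dec: "\<forall>n x. apply_bcontfun (f (Suc n)) x \<le> apply_bcontfun (f n) x"
    and f0: "\<forall>x. (\<lambda>n. apply_bcontfun (f n) x) \<longlonglongrightarrow> 0"
  have decs: "decseq (\<lambda>n. apply_bcontfun (f n) x)" for x
    by (rule decseq_SucI) (use dec in blast)
  have pos: "0 \<le> apply_bcontfun (f n) x" for n x
    by (rule decseq_ge[OF decs]) (use f0 in blast)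
  have weight: "\<exists>h. continuous_on stone_cech h \<and> (\<forall>z\<in>Q. h z = 0) \<and>
      (\<forall>g. (\<forall>x. \<bar>h (sc_embed x) * apply_bcontfun g x\<bar> \<le> 1) \<longrightarrow> \<bar>L g\<bar> < 1)"
    if Q: "admissible Q" for Q
  proof -
    have "openin (beta_Q Q) {g \<in> topspace (beta_Q Q). L g \<in> ball 0 1}"
      by (rule openin_continuous_map_preimage[OF cont[OF Q]]) simp
    then have "openin (beta_Q Q) {g. \<bar>L g\<bar> < 1}" by (simp add: topspace_beta_Q)
    from beta_Q_neighbourhood[OF this, of 0] show ?thesis by (simp add: linear_0[OF L])
  qed
  have scale: "\<bar>L g\<bar> < c" if c: "c > 0" and g: "\<bar>L ((1 / c) *\<^sub>R g)\<bar> < 1" for c g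
    using g c unfolding linear_cmul[OF L] by (simp add: abs_mult)
  \<comment> \<open>The case \<open>Q = {}\<close> yields a bound in the uniform norm, with constant
    \<open>B\<close>.\<close>
  have "admissible {}" by (simp add: admissible_def)
  from weight[OF this] obtain k where k: "continuous_on stone_cech k"
    "\<And>g. (\<forall>x. \<bar>k (sc_embed x) * apply_bcontfun g x\<bar> \<le> 1) \<Longrightarrow> \<bar>L g\<bar> < 1" by blast
  have "bounded (k ` stone_cech)"
    by (intro compact_imp_bounded compact_continuous_image k(1) compact_stone_cech)
  then obtain B where B: "B > 0" "\<And>z. z \<in> stone_cech \<Longrightarrow> \<bar>k z\<bar> \<le> B"
    unfolding bounded_pos by (auto simp: image_iff)
  have bound: "\<bar>L g\<bar> < B * c" if c: "c > 0" and g: "\<And>x. \<bar>apply_bcontfun g x\<bar> \<le> c" for g c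
  proof (rule scale)
    show "B * c > 0" using B(1) c by simp
    show "\<bar>L ((1 / (B * c)) *\<^sub>R g)\<bar> < 1"
    proof (rule k(2), intro allI)
      fix x
      have "\<bar>k (sc_embed x)\<bar> * \<bar>apply_bcontfun g x\<bar> \<le> B * c"
        by (intro mult_mono) (use B g[of x] c in auto)
      then show "\<bar>k (sc_embed x) * apply_bcontfun ((1 / (B * c)) *\<^sub>R g) x\<bar> \<le> 1"
        using B(1) c by (simp add: abs_mult divide_le_eq)
    qed
  qed
  show "(\<lambda>n. L (f n)) \<longlonglongrightarrow> 0"
  proof (rule LIMSEQ_I)
    fix \<epsilon> :: real assume \<epsilon>: "\<epsilon> > 0"
    \<comment> \<open>\<open>f n\<close> is capped at height \<open>\<eta>\<close>; by the uniform
      bound the capped part costs less than \<open>B * \<eta> = \<epsilon> / 2\<close>.\<close>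
    define \<eta> where "\<eta> = \<epsilon> / (2 * B)"
    have \<eta>: "\<eta> > 0" "B * \<eta> = \<epsilon> / 2" using \<epsilon> B(1) by (auto simp: \<eta>_def)
    have coord: "continuous_on UNIV (\<lambda>z :: ('a \<Rightarrow>\<^sub>C real) \<Rightarrow> real. z g)" for g
      by (rule continuous_on_product_coordinates)
    define Q where "Q = stone_cech \<inter> (\<Inter>n. {z. \<eta> \<le> z (f n)})"
    have "admissible Q"
      unfolding admissible_def
    proof
      show "compact Q"
        unfolding Q_def
        by (intro compact_Int_closed compact_stone_cech closed_INT ballI closed_Collect_le coord continuous_on_const)
      have "sc_embed x \<notin> Q" for x
      proof -
        have "\<forall>\<^sub>F n in sequentially. apply_bcontfun (f n) x < \<eta>"
          by (rule order_tendstoD(2)[OF f0[rule_format] \<eta>(1)])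
        then obtain n where "apply_bcontfun (f n) x < \<eta>" by (auto simp: eventually_sequentially)
        then show ?thesis by (auto simp: Q_def sc_embed_def not_le)
      qed
      then show "Q \<subseteq> stone_cech - range sc_embed" by (auto simp: Q_def)
    qed
    from weight[OF this] obtain h where h: "continuous_on stone_cech h" "\<And>z. z \<in> Q \<Longrightarrow> h z = 0"
      "\<And>g. (\<forall>x. \<bar>h (sc_embed x) * apply_bcontfun g x\<bar> \<le> 1) \<Longrightarrow> \<bar>L g\<bar> < 1" by blast
    define b where "b = norm (f 0) + 1"
    have b: "b > 0" unfolding b_def using norm_ge_zero[of "f 0"] by linarith
    have fb: "apply_bcontfun (f n) x \<le> b" for n x
      using decseqD[OF decs[of x], of 0 n] abs_apply_le_norm[of "f 0" x] by (simp add: b_def)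
    \<comment> \<open>Where \<open>\<bar>h\<bar> < \<kappa>\<close>, the excess over
      \<open>\<eta>\<close> is at most \<open>b\<close>, so its weighted size is at most
      \<open>\<kappa> * b = \<epsilon> / 2\<close>.\<close>
    define \<kappa> where "\<kappa> = \<epsilon> / (2 * b)"
    have \<kappa>: "\<kappa> > 0" "\<kappa> * b = \<epsilon> / 2" using \<epsilon> b by (auto simp: \<kappa>_def)
    define K where "K = stone_cech \<inter> (\<lambda>z. \<bar>h z\<bar>) -` {\<kappa>..}"
    have "continuous_on stone_cech (\<lambda>z. \<bar>h z\<bar>)" by (intro continuous_intros h(1))
    then have "closed ((\<lambda>z. \<bar>h z\<bar>) -` {\<kappa>..} \<inter> stone_cech)"
      by (subst (asm) continuous_on_closed_vimage) (auto simp: stone_cech_def)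
    then have "compact (stone_cech \<inter> ((\<lambda>z. \<bar>h z\<bar>) -` {\<kappa>..} \<inter> stone_cech))"
      by (rule compact_Int_closed[OF compact_stone_cech])
    then have K: "compact K" by (simp add: K_def Int_commute Int_left_commute)
    \<comment> \<open>Dini's argument: \<open>K\<close> avoids \<open>Q\<close>, so at each of its
      points some \<open>f n\<close> drops below \<open>\<eta>\<close>; compactness and monotonicity
      give one index for the points of \<open>X\<close> in \<open>K\<close>.\<close>
    have cov: "K \<subseteq> (\<Union>n\<in>UNIV. {z. z (f n) < \<eta>})"
    proof
      fix z assume z: "z \<in> K"
      then have "h z \<noteq> 0" using \<kappa>(1) by (auto simp: K_def)
      then have "z \<notin> Q" using h(2) by blast
      then show "z \<in> (\<Union>n\<in>UNIV. {z. z (f n) < \<eta>})" using z by (auto simp: Q_def K_def not_le)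
    qed
    have op: "open {z. z (f n) < \<eta>}" for n
      by (intro open_Collect_less coord continuous_on_const)
    obtain C :: "nat set" where C: "finite C" "K \<subseteq> (\<Union>n\<in>C. {z. z (f n) < \<eta>})"
      by (rule compactE_image[OF K op cov])
    obtain N where N: "\<And>i. i \<in> C \<Longrightarrow> i < N"
      using finite_nat_set_iff_bounded[THEN iffD1, OF C(1)] by auto
    have "norm (L (f n) - 0) < \<epsilon>" if n: "n \<ge> N" for n
    proof -
      let ?s = "bmin (f n) (const_bcontfun \<eta>)" and ?r = "bmax 0 (f n - const_bcontfun \<eta>)"
      have "f n = ?r + ?s" by (rule bcontfun_eqI) (auto simp: min_def max_def)
      then have "L (f n) = L ?r + L ?s" using linear_add[OF L, of ?r ?s] by simp
      then have le: "norm (L (f n) - 0) \<le> \<bar>L ?r\<bar> + \<bar>L ?s\<bar>" by simp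
      have s: "\<bar>L ?s\<bar> < B * \<eta>"
        by (rule bound[OF \<eta>(1)]) (use pos \<eta>(1) in \<open>auto simp: min_def\<close>)
      have "\<bar>L ?r\<bar> < \<epsilon> / 2"
      proof (rule scale)
        show "\<epsilon> / 2 > 0" using \<epsilon> by simp
        show "\<bar>L ((1 / (\<epsilon> / 2)) *\<^sub>R ?r)\<bar> < 1"
        proof (rule h(3), intro allI)
          fix x
          have "\<bar>h (sc_embed x)\<bar> * apply_bcontfun ?r x \<le> \<epsilon> / 2"
          proof (cases "\<kappa> \<le> \<bar>h (sc_embed x)\<bar>")
            case True
            then have "sc_embed x \<in> K" by (simp add: K_def)
            then obtain i where i: "i \<in> C" "apply_bcontfun (f i) x < \<eta>"
              using C(2) by (auto simp: sc_embed_def)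
            have "apply_bcontfun (f n) x \<le> apply_bcontfun (f i) x"
              by (rule decseqD[OF decs]) (use N[OF i(1)] n in simp)
            then have "apply_bcontfun ?r x = 0" using i(2) by simp
            then show ?thesis using \<epsilon> by simp
          next
            case False
            have "apply_bcontfun ?r x \<le> b" using fb[of n x] b \<eta>(1) by simp
            then have "\<bar>h (sc_embed x)\<bar> * apply_bcontfun ?r x \<le> \<kappa> * b"
              using False by (intro mult_mono) (use \<kappa>(1) in auto)
            then show ?thesis by (simp add: \<kappa>(2))
          qed
          moreover have "0 \<le> apply_bcontfun ?r x" by simp
          ultimately show "\<bar>h (sc_embed x) * apply_bcontfun ((1 / (\<epsilon> / 2)) *\<^sub>R ?r) x\<bar> \<le> 1"
            unfolding scaleR_bcontfun.rep_eq real_scaleR_def abs_mult using \<epsilon>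
            by (simp only: abs_of_nonneg) (simp add: divide_le_eq)
        qed
      qed
      from add_strict_mono[OF this s] le show ?thesis unfolding \<eta>(2) by simp
    qed
    then show "\<exists>N. \<forall>n\<ge>N. norm (L (f n) - 0) < \<epsilon>" by blast
  qed
qed

text \<open>For each point of \<open>X\<close> complete regularity gives a function vanishing on
  \<open>Q\<close> and positive at that point. Countably many of their positivity sets cover
  \<open>X\<close>, and a geometrically weighted sum is positive on all of it.\<close>

lemma ex_positive_on_range:
  fixes Q :: "(('a::topological_space \<Rightarrow>\<^sub>C real) \<Rightarrow> real) set"
  assumes sc: "second_countable (euclidean :: 'a topology)" and Q: "admissible Q"
  obtains G :: "(('a \<Rightarrow>\<^sub>C real) \<Rightarrow> real) \<Rightarrow> real" where "continuous_on UNIV G" "\<And>z. 0 \<le> (G z :: real)" "\<And>z. z \<in> Q \<Longrightarrow> G z = 0"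
    "\<And>x. 0 < G (sc_embed x)"
proof -
  have clQ: "closed Q" using Q by (auto simp: admissible_def intro: closed_if_compact_fun)
  have "\<exists>\<gamma>. continuous_on UNIV \<gamma> \<and> (\<forall>z. 0 \<le> \<gamma> z \<and> \<gamma> z \<le> (1 :: real)) \<and> (\<forall>z\<in>Q. \<gamma> z = 0) \<and> 0 < \<gamma> (sc_embed x)"
    for x :: 'a
  proof -
    have "sc_embed x \<notin> Q" using Q by (auto simp: admissible_def)
    from separating_function_fun[OF clQ this] show ?thesis by metis
  qed
  then obtain \<gamma> where \<gamma>: "\<And>x :: 'a. continuous_on UNIV (\<gamma> x)" "\<And>x z. 0 \<le> \<gamma> x z" "\<And>x z. \<gamma> x z \<le> (1 :: real)"
    "\<And>x z. z \<in> Q \<Longrightarrow> \<gamma> x z = 0" "\<And>x. 0 < \<gamma> x (sc_embed x)"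
    by metis
  define O' where "O' y = {x. 0 < \<gamma> y (sc_embed x)}" for y
  have "open (O' y)" for y
  proof -
    have "continuous_on UNIV (\<lambda>x. \<gamma> y (sc_embed x))"
      by (rule continuous_on_compose2[OF \<gamma>(1) continuous_on_sc_embed]) auto
    then show ?thesis unfolding O'_def by (intro open_Collect_less continuous_on_const)
  qed
  then obtain E where E: "countable E" "E \<subseteq> range O'" "\<Union>E = \<Union>(range O')"
    by (rule_tac Lindelof_open_cover[OF sc, of "range O'"]) auto
  obtain Y where Y: "countable Y" "E = O' ` Y"
    using countable_subset_image[of E O' UNIV] E(1,2) by auto
  have cov: "\<Union>E = UNIV" unfolding E(3) using \<gamma>(5) by (auto simp: O'_def)
  then have "Y \<noteq> {}" using Y(2) by auto
  define e where "e = from_nat_into Y"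
  have e: "range e = Y" unfolding e_def by (rule range_from_nat_into[OF \<open>Y \<noteq> {}\<close> Y(1)])
  define G where "G z = (\<Sum>n. (1/2) ^ n * \<gamma> (e n) z)" for z
  have sm: "summable (\<lambda>n. (1/2 :: real) ^ n)" by (rule summable_geometric) simp
  have smG: "summable (\<lambda>n. (1/2) ^ n * \<gamma> (e n) z)" for z
    by (rule summable_comparison_test'[OF sm, of 0]) (use \<gamma>(2,3) in \<open>simp add: mult_left_le\<close>)
  show thesis
  proof
    have "uniform_limit UNIV (\<lambda>N z. \<Sum>n<N. (1/2) ^ n * \<gamma> (e n) z) G sequentially"
      unfolding G_def by (rule Weierstrass_m_test[OF _ sm]) (use \<gamma>(2,3) in \<open>simp add: mult_left_le\<close>)
    then show "continuous_on UNIV G"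
      by (rule uniform_limit_theorem[rotated])
         (auto intro!: always_eventually continuous_intros \<gamma>(1))
    show "0 \<le> G z" for z unfolding G_def by (rule suminf_nonneg[OF smG]) (use \<gamma>(2) in simp)
    show "G z = 0" if "z \<in> Q" for z using \<gamma>(4)[OF that] by (simp add: G_def)
    show "0 < G (sc_embed x)" for x
    proof -
      obtain y where "y \<in> Y" "x \<in> O' y" using cov Y(2) by blast
      then obtain n where n: "0 < \<gamma> (e n) (sc_embed x)" using e by (auto simp: O'_def)
      show ?thesis unfolding G_def
        by (rule suminf_pos2[OF smG, of _ n]) (use \<gamma>(2) n in auto)
    qed
  qed
qed

text \<open>With \<open>G\<close> as above, choose \<open>t j\<close> such that \<open>{G < t j}\<close> has measure at most \<open>4\<close> to the power \<open>-j\<close>.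
  The weight \<open>h\<close> is at least \<open>2\<close> to the power \<open>-j\<close> off that set, so \<open>1 / h\<close> is integrable.\<close>

lemma finite_measure_weight:
  fixes P :: "'a::topological_space measure" and Q :: "(('a \<Rightarrow>\<^sub>C real) \<Rightarrow> real) set"
  assumes sc: "second_countable (euclidean :: 'a topology)" and Q: "admissible Q"
    and P: "finite_measure P" "sets P = sets borel"
  obtains h :: "(('a \<Rightarrow>\<^sub>C real) \<Rightarrow> real) \<Rightarrow> real" and C where "continuous_on UNIV h" "\<And>z. z \<in> Q \<Longrightarrow> h z = 0"
    "\<And>f. (\<And>x. \<bar>h (sc_embed x) * apply_bcontfun f x\<bar> \<le> 1) \<Longrightarrow> \<bar>LINT x|P. apply_bcontfun f x\<bar> \<le> C"
proof -
  interpret P: finite_measure P by (rule P(1))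
  obtain G :: "(('a \<Rightarrow>\<^sub>C real) \<Rightarrow> real) \<Rightarrow> real" where G: "continuous_on UNIV G" "\<And>z. 0 \<le> (G z :: real)" "\<And>z. z \<in> Q \<Longrightarrow> G z = 0"
    "\<And>x. 0 < G (sc_embed x)" using ex_positive_on_range[OF sc Q] by metis
  have cG: "continuous_on UNIV (\<lambda>x. G (sc_embed x))"
    by (rule continuous_on_compose2[OF G(1) continuous_on_sc_embed]) auto
  define S where "S t = {x. G (sc_embed x) < t}" for t
  have S: "S t \<in> sets P" for t
    unfolding S_def P(2) by (intro borel_open open_Collect_less cG continuous_on_const)
  have "\<exists>t>0. measure P (S t) \<le> (1/4) ^ j" for j :: nat
  proof -
    \<comment> \<open>The sets shrink to the empty set because \<open>G\<close> is positive on
      \<open>X\<close>.\<close>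
    have "(\<lambda>k. measure P (S (1 / real (Suc k)))) \<longlonglongrightarrow> measure P (\<Inter>k. S (1 / real (Suc k)))"
    proof (rule P.finite_Lim_measure_decseq)
      show "range (\<lambda>k. S (1 / real (Suc k))) \<subseteq> sets P" using S by auto
      show "decseq (\<lambda>k. S (1 / real (Suc k)))"
      proof (rule decseq_SucI)
        fix k
        have "1 / real (Suc (Suc k)) \<le> 1 / real (Suc k)" by (intro divide_left_mono) auto
        then show "S (1 / real (Suc (Suc k))) \<subseteq> S (1 / real (Suc k))" by (auto simp: S_def)
      qed
    qed
    moreover have "(\<Inter>k. S (1 / real (Suc k))) = {}"
    proof -
      have "\<exists>k. x \<notin> S (1 / real (Suc k))" for x
      proof -
        obtain k where "inverse (real (Suc k)) < G (sc_embed x)" using reals_Archimedean[OF G(4)] by blast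
        then show ?thesis by (intro exI[of _ k]) (simp add: S_def inverse_eq_divide)
      qed
      then show ?thesis by blast
    qed
    ultimately have "(\<lambda>k. measure P (S (1 / real (Suc k)))) \<longlonglongrightarrow> 0" by simp
    then have "\<forall>\<^sub>F k in sequentially. measure P (S (1 / real (Suc k))) < (1/4) ^ j"
      by (rule order_tendstoD) simp
    then obtain k where "measure P (S (1 / real (Suc k))) < (1/4) ^ j" by (auto simp: eventually_sequentially)
    then show ?thesis by (intro exI[of _ "1 / real (Suc k)"]) auto
  qed
  then obtain t where t: "\<And>j :: nat. 0 < t j" "\<And>j. measure P (S (t j)) \<le> (1/4) ^ j" by metis
  \<comment> \<open>Truncation at 1 makes the series uniformly convergent; the \<open>j\<close>-th
    term attains \<open>(1/2) ^ j\<close> once \<open>G z \<ge> t j\<close>.\<close>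
  define h where "h z = (\<Sum>j. (1/2) ^ j * min 1 (G z / t j))" for z
  have sm: "summable (\<lambda>j. (1/2 :: real) ^ j)" by (rule summable_geometric) simp
  have m0: "0 \<le> min 1 (G z / t j)" for z j using G(2)[of z] t(1)[of j] by simp
  have smh: "summable (\<lambda>j. (1/2) ^ j * min 1 (G z / t j))" for z
    by (rule summable_comparison_test'[OF sm, of 0]) (use m0 in \<open>simp add: mult_left_le\<close>)
  have unif: "uniform_limit UNIV (\<lambda>N z. \<Sum>j<N. (1/2) ^ j * min 1 (G z / t j)) h sequentially"
    unfolding h_def by (rule Weierstrass_m_test[OF _ sm]) (use m0 in \<open>simp add: mult_left_le\<close>)
  have h_ge: "(1/2) ^ j \<le> h (sc_embed x)" if "x \<notin> S (t j)" for x j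
  proof -
    have "min 1 (G (sc_embed x) / t j) = 1" using that t(1)[of j] by (simp add: S_def min_def field_simps)
    moreover have "(\<Sum>i\<in>{j}. (1/2) ^ i * min 1 (G (sc_embed x) / t i)) \<le> h (sc_embed x)"
      unfolding h_def by (rule sum_le_suminf[OF smh]) (use m0 in auto)
    ultimately show ?thesis by simp
  qed
  \<comment> \<open>A common majorant of all \<open>\<bar>f\<bar>\<close> with
    \<open>\<bar>h * f\<bar> \<le> 1\<close>. If \<open>j = Suc i\<close> is the first index with
    \<open>x \<notin> S (t j)\<close>, then \<open>\<bar>f x\<bar> \<le> 2 ^ j = 2 * 2 ^ i\<close>
    and \<open>x \<in> S (t i)\<close>; the summand 1 covers \<open>j = 0\<close>. The series
    integrates to at most the sum of \<open>2 * 2 ^ j * (1/4) ^ j\<close>, which is 4.\<close>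
  let ?w = "\<lambda>x. 1 + (\<Sum>j. ennreal (2 * 2 ^ j) * indicator (S (t j)) x)"
  have meas: "(\<lambda>x. ennreal (2 * 2 ^ j) * indicator (S (t j)) x) \<in> borel_measurable P" for j
    using S by auto
  have int_w: "(\<integral>\<^sup>+x. ?w x \<partial>P) \<le> ennreal (measure P (space P) + 4)"
  proof -
    have "(\<integral>\<^sup>+x. ?w x \<partial>P) = emeasure P (space P) + (\<Sum>j. ennreal (2 * 2 ^ j) * emeasure P (S (t j)))"
      using meas S by (subst nn_integral_add) (auto simp: nn_integral_suminf nn_integral_cmult_indicator)
    also have "(\<Sum>j. ennreal (2 * 2 ^ j) * emeasure P (S (t j))) \<le> (\<Sum>j. ennreal (2 * (1/2) ^ j))"
    proof (rule suminf_le)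
      fix j
      have "2 * 2 ^ j * measure P (S (t j)) \<le> 2 * 2 ^ j * (1/4) ^ j"
        using t(2)[of j] by (intro mult_left_mono) auto
      also have "\<dots> = 2 * (2 * (1/4)) ^ j" by (simp only: power_mult_distrib mult.assoc)
      also have "\<dots> = 2 * (1/2) ^ j" by simp
      finally show "ennreal (2 * 2 ^ j) * emeasure P (S (t j)) \<le> ennreal (2 * (1/2) ^ j)"
        unfolding P.emeasure_eq_measure by (subst ennreal_mult[symmetric]) (auto intro: ennreal_leI)
    qed auto
    also have "(\<Sum>j. ennreal (2 * (1/2) ^ j)) = ennreal 4"
    proof (rule suminf_ennreal_eq)
      show "(\<lambda>j. 2 * (1/2 :: real) ^ j) sums 4"
        using sums_mult[OF geometric_sums[of "1/2 :: real"], of 2] by simp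
    qed simp
    finally show ?thesis by (simp add: P.emeasure_eq_measure add_left_mono ennreal_plus)
  qed
  show thesis
  proof
    show "continuous_on UNIV h"
      by (rule uniform_limit_theorem[OF _ unif])
         (use t(1) in \<open>auto intro!: always_eventually continuous_on_sum continuous_on_mult continuous_on_const
            continuous_on_min continuous_on_divide G(1) simp: less_imp_neq[symmetric]\<close>)
    show "h z = 0" if "z \<in> Q" for z by (simp add: h_def G(3)[OF that])
    fix f :: "'a \<Rightarrow>\<^sub>C real"
    assume f: "\<And>x. \<bar>h (sc_embed x) * apply_bcontfun f x\<bar> \<le> 1"
    have f_le: "\<bar>apply_bcontfun f x\<bar> \<le> 2 ^ j" if "x \<notin> S (t j)" for x j
    proof -
      have "(1/2) ^ j * \<bar>apply_bcontfun f x\<bar> \<le> \<bar>h (sc_embed x)\<bar> * \<bar>apply_bcontfun f x\<bar>"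
        using h_ge[OF that] by (intro mult_right_mono) auto
      also have "\<dots> \<le> 1" using f[of x] by (simp add: abs_mult)
      finally show ?thesis by (simp add: power_divide field_simps)
    qed
    have "ennreal (norm (apply_bcontfun f x)) \<le> ?w x" for x
    proof -
      have "\<bar>apply_bcontfun f x\<bar> \<le> 1 \<or> (\<exists>i. x \<in> S (t i) \<and> \<bar>apply_bcontfun f x\<bar> \<le> 2 * 2 ^ i)"
      proof (cases "\<exists>j. x \<notin> S (t j)")
        case True
        define j where "j = (LEAST j. x \<notin> S (t j))"
        have j: "x \<notin> S (t j)" unfolding j_def by (rule LeastI_ex[OF True])
        show ?thesis
        proof (cases j)
          case 0 then show ?thesis using f_le[OF j] by simp
        next
          case (Suc i)
          then have "x \<in> S (t i)" using not_less_Least[of i "\<lambda>j. x \<notin> S (t j)"] by (simp add: j_def)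
          then show ?thesis using f_le[OF j] Suc by auto
        qed
      next
        \<comment> \<open>Every indicator equals 1 at \<open>x\<close>, so any \<open>i\<close> with
          \<open>2 ^ i\<close> above \<open>\<bar>f x\<bar>\<close> will do.\<close>
        case False
        obtain i :: nat where "\<bar>apply_bcontfun f x\<bar> < 2 ^ i" using real_arch_pow[of 2] by auto
        then have "\<bar>apply_bcontfun f x\<bar> \<le> 2 * 2 ^ i" by simp
        then show ?thesis using False by blast
      qed
      then show ?thesis
      proof
        assume "\<bar>apply_bcontfun f x\<bar> \<le> 1"
        then have "ennreal (norm (apply_bcontfun f x)) \<le> 1" by simp
        then show ?thesis by (rule order_trans) simp
      next
        assume "\<exists>i. x \<in> S (t i) \<and> \<bar>apply_bcontfun f x\<bar> \<le> 2 * 2 ^ i"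
        then obtain i where i: "x \<in> S (t i)" "\<bar>apply_bcontfun f x\<bar> \<le> 2 * 2 ^ i" by blast
        have "ennreal (norm (apply_bcontfun f x)) \<le> (\<Sum>j\<in>{i}. ennreal (2 * 2 ^ j) * indicator (S (t j)) x)"
          using i by (simp add: ennreal_leI)
        also have "\<dots> \<le> (\<Sum>j. ennreal (2 * 2 ^ j) * indicator (S (t j)) x)"
          by (rule sum_le_suminf) auto
        also have "\<dots> \<le> ?w x" by simp
        finally show ?thesis .
      qed
    qed
    then have "(\<integral>\<^sup>+x. norm (apply_bcontfun f x) \<partial>P) \<le> (\<integral>\<^sup>+x. ?w x \<partial>P)"
      by (intro nn_integral_mono)
    also note int_w
    finally have "ennreal (norm (LINT x|P. apply_bcontfun f x)) \<le> ennreal (measure P (space P) + 4)"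
      using integral_norm_bound_ennreal[OF finite_borel_measure_integrable_bcontfun[OF P, of f]]
      by (meson order_trans)
    then show "\<bar>LINT x|P. apply_bcontfun f x\<bar> \<le> measure P (space P) + 4"
      by (subst (asm) ennreal_le_iff) (auto simp: add_nonneg_nonneg)
  qed
qed

text \<open>Each Jordan part has its own weight; the sum of their absolute values controls both
  integrals.\<close>

lemma signed_integral_continuous:
  fixes \<mu> :: "'a::topological_space set \<Rightarrow> real"
  assumes sc: "second_countable (euclidean :: 'a topology)" and \<mu>: "signed_borel_measure \<mu>"
    and Q: "admissible Q"
  shows "continuous_map (beta_Q Q) euclideanreal (signed_integral \<mu>)"
proof -
  obtain h :: "(('a \<Rightarrow>\<^sub>C real) \<Rightarrow> real) \<Rightarrow> real" and C where h: "continuous_on UNIV h" "\<And>z. z \<in> Q \<Longrightarrow> h z = 0"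
    "\<And>f. (\<And>x. \<bar>h (sc_embed x) * apply_bcontfun f x\<bar> \<le> 1) \<Longrightarrow> \<bar>LINT x|pos_part \<mu>. apply_bcontfun f x\<bar> \<le> C"
    using finite_measure_weight[OF sc Q jordan_parts(1,3)[OF \<mu>]] by blast
  obtain k :: "(('a \<Rightarrow>\<^sub>C real) \<Rightarrow> real) \<Rightarrow> real" and D where k: "continuous_on UNIV k" "\<And>z. z \<in> Q \<Longrightarrow> k z = 0"
    "\<And>f. (\<And>x. \<bar>k (sc_embed x) * apply_bcontfun f x\<bar> \<le> 1) \<Longrightarrow> \<bar>LINT x|neg_part \<mu>. apply_bcontfun f x\<bar> \<le> D"
    using finite_measure_weight[OF sc Q jordan_parts(2,4)[OF \<mu>]] by blast
  let ?l = "\<lambda>z. \<bar>h z\<bar> + \<bar>k z\<bar>"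
  show ?thesis
  proof (rule beta_Q_continuousI[OF linear_signed_integral[OF \<mu>], where h = ?l and C = "C + D"])
    have "continuous_on UNIV ?l" by (intro continuous_intros h(1) k(1))
    then show "continuous_on stone_cech ?l" by (rule continuous_on_subset) simp
    show "\<forall>z\<in>Q. ?l z = 0" using h(2) k(2) by simp
    fix f :: "'a \<Rightarrow>\<^sub>C real"
    assume f: "\<And>x. \<bar>?l (sc_embed x) * apply_bcontfun f x\<bar> \<le> 1"
    have hk: "\<bar>h (sc_embed x) * apply_bcontfun f x\<bar> \<le> 1" "\<bar>k (sc_embed x) * apply_bcontfun f x\<bar> \<le> 1" for x
    proof -
      let ?r = "\<bar>apply_bcontfun f x\<bar>"
      have "\<bar>h (sc_embed x)\<bar> * ?r + \<bar>k (sc_embed x)\<bar> * ?r \<le> 1"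
        using f[of x] by (simp add: abs_mult distrib_right)
      moreover have "0 \<le> \<bar>h (sc_embed x)\<bar> * ?r" "0 \<le> \<bar>k (sc_embed x)\<bar> * ?r" by simp_all
      ultimately show "\<bar>h (sc_embed x) * apply_bcontfun f x\<bar> \<le> 1" "\<bar>k (sc_embed x) * apply_bcontfun f x\<bar> \<le> 1"
        unfolding abs_mult by linarith+
    qed
    show "\<bar>signed_integral \<mu> f\<bar> \<le> C + D"
      using h(3)[OF hk(1)] k(3)[OF hk(2)] unfolding signed_integral_def by linarith
  qed
qed

section \<open>The weak topology and its Cauchy sequences\<close>

lemma openin_weak_topology_basic:
  "open U \<Longrightarrow> openin weak_topology {\<mu> \<in> M_tau. signed_integral \<mu> f \<in> U}"
  unfolding weak_topology_def by (rule topology_generated_by_Basis) blast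

lemma weakly_Cauchy_imp_Cauchy:
  fixes \<mu> :: "nat \<Rightarrow> 'a::topological_space set \<Rightarrow> real"
  assumes sc: "second_countable (euclidean :: 'a topology)"
    and \<mu>: "\<And>n. signed_borel_measure (\<mu> n)" and C: "weakly_Cauchy \<mu>"
  shows "Cauchy (\<lambda>n. signed_integral (\<mu> n) f)"
proof (rule metric_CauchyI)
  fix \<epsilon> :: real assume \<epsilon>: "\<epsilon> > 0"
  let ?V = "{\<rho> \<in> M_tau. signed_integral \<rho> f \<in> ball 0 \<epsilon>}"
  \<comment> \<open>Writing the zero measure as \<open>\<mu> 0 - \<mu> 0\<close> gives its
    membership and its vanishing integral at once.\<close>
  have zero: "(\<lambda>A. \<mu> 0 A - \<mu> 0 A) = (\<lambda>A. 0)" by simp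
  have "signed_borel_measure (\<lambda>A :: 'a set. 0 :: real)"
    using signed_diff[OF \<mu>[of 0] \<mu>[of 0]] by simp
  moreover have "signed_integral (\<lambda>A :: 'a set. 0) f = 0"
    using signed_integral_measure_diff[OF \<mu>[of 0] \<mu>[of 0], of f] by simp
  ultimately have "(\<lambda>A. 0) \<in> ?V" using \<epsilon> by (simp add: M_tau_eq_signed[OF sc])
  moreover have "openin weak_topology ?V" by (rule openin_weak_topology_basic) simp
  ultimately have "\<exists>N. \<forall>m\<ge>N. \<forall>n\<ge>N. (\<lambda>A. \<mu> m A - \<mu> n A) \<in> ?V"
    using C[unfolded weakly_Cauchy_def, rule_format, of ?V] by simp
  then obtain N where N: "\<forall>m\<ge>N. \<forall>n\<ge>N. (\<lambda>A. \<mu> m A - \<mu> n A) \<in> ?V" by (rule exE)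
  have "dist (signed_integral (\<mu> m) f) (signed_integral (\<mu> n) f) < \<epsilon>" if "m \<ge> N" "n \<ge> N" for m n
    using N[rule_format, OF that] signed_integral_measure_diff[OF \<mu> \<mu>, of m n f] by (simp add: dist_real_def)
  then show "\<exists>N. \<forall>m\<ge>N. \<forall>n\<ge>N. dist (signed_integral (\<mu> m) f) (signed_integral (\<mu> n) f) < \<epsilon>" by blast
qed

lemma limitin_weak_topologyI:
  fixes \<mu> :: "nat \<Rightarrow> 'a::topological_space set \<Rightarrow> real"
  assumes \<nu>: "\<nu> \<in> M_tau" and \<mu>: "\<And>n. \<mu> n \<in> M_tau"
    and lim: "\<And>f. (\<lambda>n. signed_integral (\<mu> n) f) \<longlonglongrightarrow> signed_integral \<nu> f"
  shows "limitin weak_topology \<mu> \<nu> sequentially"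
  unfolding limitin_def
proof (intro conjI allI impI)
  from openin_subset[OF openin_weak_topology_basic[OF open_UNIV]] show "\<nu> \<in> topspace weak_topology" using \<nu> by auto
  fix U :: "('a set \<Rightarrow> real) set"
  assume "openin weak_topology U \<and> \<nu> \<in> U"
  then have "generate_topology_on {{\<mu> \<in> M_tau. signed_integral \<mu> f \<in> U} | f U. open U} U" "\<nu> \<in> U"
    by (simp_all add: weak_topology_def openin_topology_generated_by_iff)
  then show "\<forall>\<^sub>F n in sequentially. \<mu> n \<in> U"
  proof (induction rule: generate_topology_on.induct)
    case (Int U V)
    then show ?case by (auto elim: eventually_elim2)
  next
    case (UN K)
    then obtain V where V: "V \<in> K" "\<nu> \<in> V" by blast
    show ?case by (rule eventually_mono[OF UN.IH[OF V]]) (use V in blast)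
  next
    case (Basis V)
    then obtain f S where V: "V = {\<mu> \<in> M_tau. signed_integral \<mu> f \<in> S}" "open S" by blast
    have "\<forall>\<^sub>F n in sequentially. signed_integral (\<mu> n) f \<in> S"
      by (rule topological_tendstoD[OF lim V(2)]) (use Basis(2) in \<open>simp add: V(1)\<close>)
    then show ?case using \<mu> by (simp add: V(1))
  qed simp
qed

theorem lemma1p9:
  assumes "metrizable_space (euclidean :: 'a::topological_space topology)"
    and "separable_space (euclidean :: 'a topology)"
  shows "bij_betw signed_integral (M_tau :: ('a set \<Rightarrow> real) set) (continuous_dual strict_topology) \<and>
         (\<forall>\<mu> :: nat \<Rightarrow> 'a set \<Rightarrow> real.
           (\<forall>n. \<mu> n \<in> M_tau) \<and> weakly_Cauchy \<mu> \<longrightarrow>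
           (\<exists>\<nu>\<in>M_tau. limitin weak_topology \<mu> \<nu> sequentially))"
proof
  note sc = second_countable_if_separable_metrizable[OF assms]
  note pn = perfectly_normal_if_metrizable[OF assms(1)]
  note M = M_tau_eq_signed[OF sc]
  show "bij_betw signed_integral (M_tau :: ('a set \<Rightarrow> real) set) (continuous_dual strict_topology)"
    unfolding bij_betw_def
  proof
    show "inj_on signed_integral (M_tau :: ('a set \<Rightarrow> real) set)"
      by (rule inj_onI) (auto simp: M intro: signed_measure_eqI[OF pn])
    show "signed_integral ` (M_tau :: ('a set \<Rightarrow> real) set) = continuous_dual strict_topology"
    proof (intro equalityI subsetI)
      fix L assume "L \<in> signed_integral ` (M_tau :: ('a set \<Rightarrow> real) set)"
      then show "L \<in> continuous_dual strict_topology"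
        unfolding continuous_dual_strict_topology
        by (auto simp: M intro: linear_signed_integral signed_integral_continuous[OF sc])
    next
      fix L :: "('a \<Rightarrow>\<^sub>C real) \<Rightarrow> real" assume "L \<in> continuous_dual strict_topology"
      then have L: "linear L" "sigma_smooth L"
        unfolding continuous_dual_strict_topology by (auto intro: continuous_functional_sigma_smooth)
      obtain \<mu> where "signed_borel_measure \<mu>" "L = signed_integral \<mu>"
        by (rule sigma_smooth_imp_signed_integral[OF pn L])
      then show "L \<in> signed_integral ` M_tau" by (simp add: M)
    qed
  qed
  show "\<forall>\<mu> :: nat \<Rightarrow> 'a set \<Rightarrow> real. (\<forall>n. \<mu> n \<in> M_tau) \<and> weakly_Cauchy \<mu> \<longrightarrow>
      (\<exists>\<nu>\<in>M_tau. limitin weak_topology \<mu> \<nu> sequentially)"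
  proof (intro allI impI, elim conjE)
    fix \<mu> :: "nat \<Rightarrow> 'a set \<Rightarrow> real"
    assume \<mu>M: "\<forall>n. \<mu> n \<in> M_tau" and C: "weakly_Cauchy \<mu>"
    then have \<mu>: "signed_borel_measure (\<mu> n)" for n by (simp add: M)
    define L where "L f = lim (\<lambda>n. signed_integral (\<mu> n) f)" for f
    have lim: "(\<lambda>n. signed_integral (\<mu> n) f) \<longlonglongrightarrow> L f" for f
      unfolding L_def using weakly_Cauchy_imp_Cauchy[OF sc \<mu> C, of f]
      by (simp add: Cauchy_convergent_iff convergent_LIMSEQ_iff)
    have "linear L"
    proof (rule linearI)
      note lin = linear_signed_integral[OF \<mu>]
      show "L (f + g) = L f + L g" for f g
        by (rule LIMSEQ_unique[OF lim]) (simp add: linear_add[OF lin] tendsto_add lim)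
      show "L (r *\<^sub>R f) = r *\<^sub>R L f" for r f
        by (rule LIMSEQ_unique[OF lim]) (simp add: linear_cmul[OF lin] tendsto_mult lim)
    qed
    moreover have "sigma_smooth L" by (rule limit_sigma_smooth[OF \<mu> lim])
    ultimately obtain \<nu> where \<nu>: "signed_borel_measure \<nu>" "L = signed_integral \<nu>"
      using sigma_smooth_imp_signed_integral[OF pn] by blast
    then have "\<nu> \<in> M_tau" by (simp add: M)
    moreover have "limitin weak_topology \<mu> \<nu> sequentially"
      using \<open>\<nu> \<in> M_tau\<close> \<mu>M lim unfolding \<nu>(2) by (intro limitin_weak_topologyI) auto
    ultimately show "\<exists>\<nu>\<in>M_tau. limitin weak_topology \<mu> \<nu> sequentially" by blast
  qed
qed

end
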